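(* Let $q\in\mathbb C\setminus\{0\}$ be not a root of unity. Then every finite dimensional (complex) representation of $U'_q(\mathrm{so}_4)$ is completely reducible.
   Context: $U'_q(\mathrm{so}_4)$ is the complex unital associative algebra generated by $I_{21},I_{32},I_{43}$ with defining relations $$I_{21}I_{32}^2-(q+q^{-1})I_{32}I_{21}I_{32}+I_{32}^2I_{21}=-I_{21},\quad I_{32}I_{21}^2-(q+q^{-1})I_{21}I_{32}I_{21}+I_{21}^2I_{32}=-I_{32},$$ $$I_{32}I_{43}^2-(q+q^{-1})I_{43}I_{32}I_{43}+I_{43}^2I_{32}=-I_{32},\quad I_{43}I_{32}^2-(q+q^{-1})I_{32}I_{43}I_{32}+I_{32}^2I_{43}=-I_{43},$$ $$I_{21}I_{43}=I_{43}I_{21}.$$ *)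

theory Defs
  imports Complex_Main "HOL-Library.Poly_Mapping" "HOL-Library.FuncSet" "HOL-Algebra.QuotRing"
begin

subsection \<open>The free complex associative algebra on three generators\<close>

datatype gen = I21 | I32 | I43

text \<open>The free monoid on \<^typ>\<open>gen\<close>, written additively so that \<^type>\<open>poly_mapping\<close>
  supplies the convolution product; a separate type because lists carry no monoid instance.\<close>

datatype word = Word (letters: "gen list")

instantiation word :: monoid_add
begin

definition zero_word :: word where "0 = Word []"

definition plus_word :: "word \<Rightarrow> word \<Rightarrow> word" where
  "u + v = Word (letters u @ letters v)"

instance
  by standard (simp_all add: zero_word_def plus_word_def)

end

type_synonym free_alg = "word \<Rightarrow>\<^sub>0 complex"

definition gen_elem :: "gen \<Rightarrow> free_alg" where
  "gen_elem g = Poly_Mapping.single (Word [g]) 1"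

definition const_elem :: "complex \<Rightarrow> free_alg" where
  "const_elem c = Poly_Mapping.single 0 c"

definition free_ring :: "free_alg ring" where
  "free_ring = \<lparr>carrier = UNIV, mult = (*), one = 1, zero = 0, add = (+)\<rparr>"

lemma free_ring_ring: "ring free_ring"
proof (rule ringI)
  show "abelian_group free_ring"
  proof (rule abelian_groupI)
    fix x assume "x \<in> carrier free_ring"
    show "\<exists>y\<in>carrier free_ring. y \<oplus>\<^bsub>free_ring\<^esub> x = \<zero>\<^bsub>free_ring\<^esub>"
      by (rule bexI[of _ "- x"]) (simp_all add: free_ring_def)
  qed (simp_all add: free_ring_def algebra_simps)
  show "monoid free_ring"
    by (rule monoidI) (simp_all add: free_ring_def algebra_simps)
qed (simp_all add: free_ring_def algebra_simps)


subsection \<open>The algebra $U'_q(\mathrm{so}_4)$\<close>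

definition cubic_relator :: "complex \<Rightarrow> gen \<Rightarrow> gen \<Rightarrow> free_alg" where
  "cubic_relator q a b =
    (let x = gen_elem a; y = gen_elem b in
      x * y ^ 2 - const_elem (q + inverse q) * (y * x * y) + y ^ 2 * x - (- x))"

definition relators :: "complex \<Rightarrow> free_alg set" where
  "relators q =
    {cubic_relator q I21 I32, cubic_relator q I32 I21,
     cubic_relator q I32 I43, cubic_relator q I43 I32,
     gen_elem I21 * gen_elem I43 - gen_elem I43 * gen_elem I21}"

text \<open>Ideals of a non-commutative ring are two-sided in \<^theory>\<open>HOL-Algebra.Ideal\<close>.\<close>

definition rel_ideal :: "complex \<Rightarrow> free_alg set" where
  "rel_ideal q = genideal free_ring (relators q)"

definition Uq_so4 :: "complex \<Rightarrow> free_alg set ring" where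
  "Uq_so4 q = FactRing free_ring (rel_ideal q)"

definition Uq_smult :: "complex \<Rightarrow> complex \<Rightarrow> free_alg set \<Rightarrow> free_alg set" where
  "Uq_smult q c x =
    mult (Uq_so4 q) (a_r_coset free_ring (rel_ideal q) (const_elem c)) x"


subsection \<open>Representations\<close>

text \<open>The representation space is a whole type \<^typ>\<open>'v\<close>, a complex vector space via \<open>scale\<close>.\<close>

definition End_ring :: "(complex \<Rightarrow> 'v \<Rightarrow> 'v) \<Rightarrow> ('v::ab_group_add \<Rightarrow> 'v) ring" where
  "End_ring scale =
    \<lparr>carrier = {f. Vector_Spaces.linear scale scale f}, mult = (\<circ>), one = id,
     zero = (\<lambda>v. 0), add = (\<lambda>f g v. f v + g v)\<rparr>"

text \<open>\<^const>\<open>ring_hom\<close> includes preservation of the unit.\<close>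

definition is_representation ::
  "complex \<Rightarrow> (complex \<Rightarrow> 'v \<Rightarrow> 'v) \<Rightarrow> (free_alg set \<Rightarrow> 'v::ab_group_add \<Rightarrow> 'v) \<Rightarrow> bool" where
  "is_representation q scale \<rho> \<longleftrightarrow>
    \<rho> \<in> ring_hom (Uq_so4 q) (End_ring scale) \<and>
    (\<forall>c. \<forall>x \<in> carrier (Uq_so4 q). \<forall>v. \<rho> (Uq_smult q c x) v = scale c (\<rho> x v))"

definition subrepresentation ::
  "complex \<Rightarrow> (complex \<Rightarrow> 'v \<Rightarrow> 'v) \<Rightarrow> (free_alg set \<Rightarrow> 'v::ab_group_add \<Rightarrow> 'v) \<Rightarrow> 'v set \<Rightarrow> bool" where
  "subrepresentation q scale \<rho> W \<longleftrightarrow>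
    module.subspace scale W \<and> (\<forall>x \<in> carrier (Uq_so4 q). \<rho> x ` W \<subseteq> W)"

definition irreducible_subrepresentation ::
  "complex \<Rightarrow> (complex \<Rightarrow> 'v \<Rightarrow> 'v) \<Rightarrow> (free_alg set \<Rightarrow> 'v::ab_group_add \<Rightarrow> 'v) \<Rightarrow> 'v set \<Rightarrow> bool" where
  "irreducible_subrepresentation q scale \<rho> W \<longleftrightarrow>
    subrepresentation q scale \<rho> W \<and> W \<noteq> {0} \<and>
    (\<forall>W'. subrepresentation q scale \<rho> W' \<and> W' \<subseteq> W \<longrightarrow> W' = {0} \<or> W' = W)"

text \<open>Summands of a direct sum of nonzero subspaces are pairwise distinct, so a set of subspaces
  (rather than an indexed family) loses nothing. The empty set covers the zero space.\<close>

definition internal_direct_sum :: "'v::ab_group_add set set \<Rightarrow> bool" where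
  "internal_direct_sum \<W> \<longleftrightarrow>
    (\<forall>v. \<exists>!f. f \<in> (\<Pi>\<^sub>E W\<in>\<W>. W) \<and> v = (\<Sum>W\<in>\<W>. f W))"

definition completely_reducible ::
  "complex \<Rightarrow> (complex \<Rightarrow> 'v \<Rightarrow> 'v) \<Rightarrow> (free_alg set \<Rightarrow> 'v::ab_group_add \<Rightarrow> 'v) \<Rightarrow> bool" where
  "completely_reducible q scale \<rho> \<longleftrightarrow>
    (\<exists>\<W>. finite \<W> \<and> (\<forall>W\<in>\<W>. irreducible_subrepresentation q scale \<rho> W) \<and>
       internal_direct_sum \<W>)"

definition root_of_unity :: "complex \<Rightarrow> bool" where
  "root_of_unity z \<longleftrightarrow> (\<exists>n>0. z ^ n = 1)"

end

(*
  Rescale the generators to A, B, C so that an eigenvalue of A can be written x - 1/x; the cubic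
  relations then say that B maps the eigenspace labelled x into those labelled q x and x / q.

  On the pair (A, B) a central element Y measures the composite of a step down and a step up as
  an explicit function of x minus Y. Running this along a whole string, over the complex numbers
  and over the dual numbers (eigenvector + eps * Jordan partner), shows that A is diagonalizable and
  that no label with x^2 = -q^(2m) occurs. So A and C are simultaneously diagonalizable, and the
  four components of B between joint eigenspaces K x y, labelled by pairs (x, y), behave like two
  commuting, slightly deformed copies of the sl2 raising and lowering operators. The usual string
  argument produces complements, but on the level of labels; since (x, y), (-1/x, y), (x, -1/y) and
  (-1/x, -1/y) label the same space, the resulting projections are averaged over these four labels.
*)
theory Submission
  imports Defs "HOL-Library.Product_Plus" "HOL-Computational_Algebra.Fundamental_Theorem_Algebra"
    "HOL-Computational_Algebra.Formal_Power_Series"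
begin

section \<open>Pairs satisfying the cubic relations and their central element\<close>

text \<open>The rescaling is what makes labels work: with the constant (q - 1/q)^2 on the right, the
  quadratic satisfied by the A-eigenvalues occurring in B v has the roots \<open>lam (q * x)\<close>
  and \<open>lam (x / q)\<close>. The first obstacle is the fold x^2 = -1, where the labels x and
  -1/x coincide. The derivative 1 + 1/x^2 of \<open>lam\<close> vanishes there, so a Jordan partner
  cannot be absorbed into a label x + eps; and \<open>br x\<close>, the factor by which B is
  recovered from its components, is zero. So the fold and all its translates by powers of q are
  shown to carry no eigenvector before the ladder relations are derived; \<open>good\<close> records
  this. The second obstacle is that each ladder satisfies an sl2-like relation only up to a term of
  the other ladder, so the two are treated one after the other, the second inside the kernel of the
  first raising operator. Splitting rests on weights: finite dimension forces the squared weight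
  \<open>wt\<close> of a highest vector to be q^(2k) with k >= 0, while each lowering step divides
  the weight by q^2. As q is not a root of unity, no nonzero highest vector lies strictly below
  another one in its string.\<close>

locale cubic_pair = module scale
  for scale :: "'k::comm_ring_1 \<Rightarrow> 'v::ab_group_add \<Rightarrow> 'v" (infixr \<open>*s\<close> 75) +
  fixes q qi :: 'k and A B :: "'v \<Rightarrow> 'v"
  assumes q_qi: "q * qi = 1"
    and hom_A: "module_hom scale scale A"
    and hom_B: "module_hom scale scale B"
    and AAB: "A (A (B v)) = (q + qi) *s A (B (A v)) - B (A (A v)) + ((q - qi)^2) *s B v"
    and ABB: "A (B (B v)) = (q + qi) *s B (A (B v)) - B (B (A v)) + ((q - qi)^2) *s A v"
begin

lemmas lin =
  module_hom.add[OF hom_A] module_hom.diff[OF hom_A] module_hom.scale[OF hom_A]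
  module_hom.add[OF hom_B] module_hom.diff[OF hom_B] module_hom.scale[OF hom_B]
  module_hom.zero[OF hom_A] module_hom.zero[OF hom_B]
  module_hom.neg[OF hom_A] module_hom.neg[OF hom_B]

lemma q_qi': "q * (qi * z) = z" "qi * q = 1" "qi * (q * z) = z"
proof -
  show "q * (qi * z) = z" by (simp add: mult.assoc[symmetric] q_qi)
  show "qi * q = 1" by (simp add: mult.commute q_qi)
  then show "qi * (q * z) = z" by (simp add: mult.assoc[symmetric])
qed

lemma scale_two: "2 *s v = v + v" "(a * 2) *s v = a *s v + a *s v"
  "(a * (b * (e * 2))) *s v = (a * (b * e)) *s v + (a * (b * e)) *s v"
proof -
  show *: "(a * 2) *s v = a *s v + a *s v" for a
    by (metis mult_2_right scale_left_distrib)
  show "2 *s v = v + v" using *[of 1] by simp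
  show "(a * (b * (e * 2))) *s v = (a * (b * e)) *s v + (a * (b * e)) *s v"
    using *[of "a * (b * e)"] by (simp add: mult.assoc)
qed

text \<open>The q-commutator serves as a third generator: with it the cubic relations become the
  quadratic rules \<open>A_B\<close>, \<open>D_B\<close> and \<open>A_D\<close>, which move B to the
  left and A to the right.\<close>

definition D :: "'v \<Rightarrow> 'v" where "D v = q *s A (B v) - B (A v)"

lemma lin_D: "D (u + v) = D u + D v" "D (u - v) = D u - D v" "D (r *s v) = r *s D v" "D 0 = 0"
  "D (- u) = - D u"
  by (simp_all add: D_def lin algebra_simps)

lemma A_B: "A (B v) = qi *s (B (A v) + D v)"
  by (simp add: D_def scale_right_distrib scale_right_diff_distrib q_qi')

lemma D_B: "D (B v) = q *s (B (D v) + ((q - qi)^2) *s A v)"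
proof -
  have "D (B v) = q *s A (B (B v)) - B (A (B v))" by (simp add: D_def)
  also have "\<dots> = q *s (B (D v) + ((q - qi)^2) *s A v)"
    by (simp add: ABB D_def lin algebra_simps power2_eq_square q_qi q_qi')
  finally show ?thesis .
qed

lemma A_D: "A (D v) = q *s (D (A v) + ((q - qi)^2) *s B v)"
proof -
  have "A (D v) = q *s A (A (B v)) - A (B (A v))" by (simp add: D_def lin)
  also have "\<dots> = q *s (D (A v) + ((q - qi)^2) *s B v)"
    by (simp add: AAB D_def lin algebra_simps power2_eq_square q_qi q_qi')
  finally show ?thesis .
qed

text \<open>A Casimir element of the pair. Its terms are written in the order B, D, A, so that
  centrality is a computation with the three reordering rules.\<close>

definition Y :: "'v \<Rightarrow> 'v" where
  "Y v = (q - qi) *s B (D (A v)) + (q * (q - qi)^2) *s (A (A v) + B (B v)) - (qi * qi) *s D (D v)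
     + ((q - qi)^2 * (q + qi)) *s v"

lemma Y_A: "Y (A v) = A (Y v)"
  unfolding Y_def by (simp add: A_B D_B A_D lin lin_D algebra_simps power2_eq_square q_qi q_qi')

lemma Y_B: "Y (B v) = B (Y v)"
  unfolding Y_def by (simp add: A_B D_B A_D lin lin_D algebra_simps power2_eq_square q_qi q_qi')

lemma lin_Y: "Y (u + v) = Y u + Y v" "Y (u - v) = Y u - Y v" "Y (r *s v) = r *s Y v" "Y 0 = 0"
  by (simp_all add: Y_def lin lin_D algebra_simps)

text \<open>\<open>xi\<close> stands for the inverse of \<open>x\<close>. It is a separate argument
  because the scalars form only a commutative ring: the same lemmas serve the complex numbers and
  power series acting as dual numbers.\<close>

definition K :: "'k \<Rightarrow> 'k \<Rightarrow> 'v set" where "K x xi = {v. A v = (x - xi) *s v}"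

text \<open>Subtracting the eigenvalue of the label x / q removes that component of B v, so that a
  multiple of the component with label q x survives; \<open>L\<close> is the mirror image.\<close>

definition R :: "'k \<Rightarrow> 'k \<Rightarrow> 'v \<Rightarrow> 'v" where "R x xi v = A (B v) - (x * qi - q * xi) *s B v"
definition L :: "'k \<Rightarrow> 'k \<Rightarrow> 'v \<Rightarrow> 'v" where "L x xi v = A (B v) - (q * x - xi * qi) *s B v"

lemma R_K: assumes "x * xi = 1" "v \<in> K x xi" shows "R x xi v \<in> K (q * x) (xi * qi)"
proof -
  have x: "x * (xi * z) = z" for z by (simp add: mult.assoc[symmetric] assms(1))
  have v: "A v = (x - xi) *s v" using assms by (simp add: K_def)
  show ?thesis unfolding K_def R_def mem_Collect_eq
    by (simp add: AAB v lin algebra_simps power2_eq_square q_qi q_qi' x assms(1) scale_two)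
qed

lemma L_K: assumes "x * xi = 1" "v \<in> K x xi" shows "L x xi v \<in> K (x * qi) (q * xi)"
proof -
  have x: "x * (xi * z) = z" for z by (simp add: mult.assoc[symmetric] assms(1))
  have v: "A v = (x - xi) *s v" using assms by (simp add: K_def)
  show ?thesis unfolding K_def L_def mem_Collect_eq
    by (simp add: AAB v lin algebra_simps power2_eq_square q_qi q_qi' x assms(1) scale_two)
qed

lemma R_L: assumes "x * xi = 1" "v \<in> K x xi"
  shows "R (x * qi) (q * xi) (L x xi v) = ((q - qi)^2 * (x * x * qi + q * xi * xi)) *s v - Y v"
proof -
  have x: "x * (xi * z) = z" for z by (simp add: mult.assoc[symmetric] assms(1))
  have v: "A v = (x - xi) *s v" using assms by (simp add: K_def)
  show ?thesis unfolding R_def L_def Y_def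
    by (simp add: A_B D_B A_D v lin lin_D algebra_simps power2_eq_square q_qi q_qi' x assms(1) scale_two)
qed

lemma L_R: assumes "x * xi = 1" "v \<in> K x xi"
  shows "L (q * x) (xi * qi) (R x xi v) = ((q - qi)^2 * (q * x * x + xi * xi * qi)) *s v - Y v"
proof -
  have x: "x * (xi * z) = z" for z by (simp add: mult.assoc[symmetric] assms(1))
  have v: "A v = (x - xi) *s v" using assms by (simp add: K_def)
  show ?thesis unfolding R_def L_def Y_def
    by (simp add: A_B D_B A_D v lin lin_D algebra_simps power2_eq_square q_qi q_qi' x assms(1) scale_two)
qed

end

section \<open>Linear operators on finite-dimensional complex spaces\<close>

primrec shift_prod :: "('k \<Rightarrow> 'v::ab_group_add \<Rightarrow> 'v) \<Rightarrow> ('v \<Rightarrow> 'v) \<Rightarrow> 'k list \<Rightarrow> 'v \<Rightarrow> 'v" where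
  "shift_prod scale T [] v = v"
| "shift_prod scale T (l # ls) v = shift_prod scale T ls (T v - scale l v)"

locale complex_space = finite_dimensional_vector_space scale Basis
  for scale :: "complex \<Rightarrow> 'v::ab_group_add \<Rightarrow> 'v" (infixr \<open>*s\<close> 75) and Basis

locale complex_operator = complex_space scale Basis
  for scale :: "complex \<Rightarrow> 'v::ab_group_add \<Rightarrow> 'v" (infixr \<open>*s\<close> 75) and Basis +
  fixes T :: "'v \<Rightarrow> 'v"
  assumes hom_T: "module_hom scale scale T"
begin

lemmas linT = module_hom.add[OF hom_T] module_hom.diff[OF hom_T] module_hom.scale[OF hom_T]
  module_hom.zero[OF hom_T] module_hom.neg[OF hom_T]

definition pe :: "complex poly \<Rightarrow> 'v \<Rightarrow> 'v" where
  "pe p v = fold_coeffs (\<lambda>a w. a *s v + T w) p 0"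

lemma pe_0 [simp]: "pe 0 v = 0"
  by (simp add: pe_def)

lemma pe_pCons: "pe (pCons a p) v = a *s v + T (pe p v)"
  by (cases "p = 0"; cases "a = 0") (simp_all add: pe_def linT)

lemma pe_add: "pe (p + r) v = pe p v + pe r v"
  by (induction p r rule: poly_induct2) (simp_all add: pe_pCons linT algebra_simps)

lemma pe_smult: "pe (smult a p) v = a *s pe p v"
  by (induction p) (simp_all add: pe_pCons linT algebra_simps)

lemma pe_root: "pe ([:- l, 1:] * p) v = T (pe p v) - l *s pe p v"
proof -
  have "[:- l, 1:] * p = smult (- l) p + pCons 0 p" by simp
  then show ?thesis by (simp only: pe_add pe_smult pe_pCons) simp
qed

lemma pe_shift: "T (pe p v) - l *s pe p v = pe p (T v - l *s v)"
proof (induction p)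
  case (pCons a p)
  have "T (pe (pCons a p) v) - l *s pe (pCons a p) v
      = a *s (T v - l *s v) + T (T (pe p v) - l *s pe p v)"
    by (simp add: pe_pCons linT algebra_simps)
  then show ?case by (simp add: pe_pCons pCons)
qed (simp add: linT)

lemma shift_prod_of_poly:
  assumes "p \<noteq> 0" "pe p v = 0"
  shows "\<exists>ls. shift_prod scale T ls v = 0"
  using assms
proof (induction "degree p" arbitrary: p v)
  case 0
  then obtain a where a: "p = [:a:]" using degree_eq_zeroE[of p] by metis
  then have "a \<noteq> 0" using 0 by auto
  with 0 a have "v = 0" by (simp add: pe_pCons linT)
  then show ?case by (intro exI[of _ "[]"]) simp
next
  case (Suc n)
  then obtain l where "poly p l = 0"
    using fundamental_theorem_of_algebra[of p] constant_degree[of p] by auto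
  then have "[:- l, 1:] dvd p" by (simp only: poly_eq_0_iff_dvd)
  then obtain r where r: "p = [:- l, 1:] * r" ..
  then have "r \<noteq> 0" using Suc.prems by auto
  then have "degree p = Suc (degree r)" unfolding r by (subst degree_mult_eq) simp_all
  then have d: "n = degree r" using Suc.hyps by simp
  have "pe r (T v - l *s v) = 0" using Suc.prems(2) by (simp only: r pe_root pe_shift)
  from Suc.hyps(1)[OF d \<open>r \<noteq> 0\<close> this] obtain ls where "shift_prod scale T ls (T v - l *s v) = 0" ..
  then have "shift_prod scale T (l # ls) v = 0" by simp
  then show ?case ..
qed

lemma annihilating_poly: "\<exists>p. p \<noteq> 0 \<and> pe p v = 0"
proof -
  let ?f = "\<lambda>i. (T ^^ i) v"
  have "\<exists>k. ?f k \<in> span (?f ` {..<k})"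
  proof (rule ccontr)
    assume neg: "\<not> ?thesis"
    have ind: "independent (?f ` {..<k}) \<and> card (?f ` {..<k}) = k" for k
    proof (induction k)
      case 0
      show ?case by (simp add: independent_empty)
    next
      case (Suc k)
      have *: "?f k \<notin> span (?f ` {..<k})" using neg by simp
      then have "?f k \<notin> ?f ` {..<k}" by (meson span_base)
      moreover have "?f ` {..<Suc k} = insert (?f k) (?f ` {..<k})" by (simp add: lessThan_Suc)
      ultimately show ?case using Suc * by (simp add: independent_insertI)
    qed
    have "card (?f ` {..<Suc (dim UNIV)}) \<le> dim UNIV"
      using ind by (intro independent_card_le_dim) auto
    then show False using ind[of "Suc (dim UNIV)"] by simp
  qed
  then obtain k where k: "?f k \<in> span (?f ` {..<k})" ..
  have mon: "pe (monom 1 i) v = ?f i" for i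
    by (induction i) (simp_all add: pe_pCons linT monom_0 monom_Suc)
  have "\<exists>p. (\<forall>i\<ge>k. coeff p i = 0) \<and> pe p v = u" if "u \<in> span (?f ` {..<k})" for u
    using that
  proof (induction rule: span_induct_alt)
    case base
    show ?case by (intro exI[of _ 0]) simp
  next
    case (step c x y)
    then obtain p i where "\<forall>i\<ge>k. coeff p i = 0" "pe p v = y" "x = ?f i" "i < k" by auto
    then show ?case
      by (intro exI[of _ "smult c (monom 1 i) + p"]) (auto simp: pe_add pe_smult mon)
  qed
  from this[OF k] obtain p where p: "\<forall>i\<ge>k. coeff p i = 0" "pe p v = ?f k" by blast
  have "coeff (monom 1 k + smult (- 1) p) k = 1" using p by simp
  then have "monom 1 k + smult (- 1) p \<noteq> 0" by (metis coeff_0 zero_neq_one)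
  moreover have "pe (monom 1 k + smult (- 1) p) v = 0" by (simp only: pe_add pe_smult mon p(2)) simp
  ultimately show ?thesis by blast
qed

lemma shift_prod_exists: "\<exists>ls. shift_prod scale T ls v = 0"
  using annihilating_poly shift_prod_of_poly by blast

lemma shift_prod_lin:
  "shift_prod scale T ls (a *s u) = a *s shift_prod scale T ls u"
  "shift_prod scale T ls (u + w) = shift_prod scale T ls u + shift_prod scale T ls w"
proof -
  show "shift_prod scale T ls (a *s u) = a *s shift_prod scale T ls u"
  proof (induction ls arbitrary: u)
    case (Cons l ls)
    have "T (a *s u) - l *s (a *s u) = a *s (T u - l *s u)"
      by (simp add: linT scale_right_diff_distrib scale_left_commute)
    then show ?case by (simp only: shift_prod.simps Cons)
  qed simp
  show "shift_prod scale T ls (u + w) = shift_prod scale T ls u + shift_prod scale T ls w"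
  proof (induction ls arbitrary: u w)
    case (Cons l ls)
    have "T (u + w) - l *s (u + w) = (T u - l *s u) + (T w - l *s w)"
      by (simp add: linT algebra_simps)
    then show ?case by (simp only: shift_prod.simps Cons)
  qed simp
qed

lemma shift_prod_0 [simp]: "shift_prod scale T ls 0 = 0"
  using shift_prod_lin(1)[of ls 0 0] by simp

lemma shift_prod_append:
  "shift_prod scale T (ls @ ms) v = shift_prod scale T ms (shift_prod scale T ls v)"
  by (induction ls arbitrary: v) simp_all

lemma shift_prod_comm:
  "shift_prod scale T ls (T v - l *s v) = T (shift_prod scale T ls v) - l *s shift_prod scale T ls v"
proof (induction ls arbitrary: v)
  case (Cons m ls)
  have "T (T v - l *s v) - m *s (T v - l *s v) = T (T v - m *s v) - l *s (T v - m *s v)"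
    by (simp add: linT algebra_simps)
  then show ?case by (simp add: Cons.IH)
qed simp

lemma shift_prod_swap:
  "shift_prod scale T ls (shift_prod scale T ms v) = shift_prod scale T ms (shift_prod scale T ls v)"
  by (induction ms arbitrary: v) (simp_all add: shift_prod_comm)

text \<open>Concatenating annihilating lists of the basis vectors gives one list that annihilates
  the whole space, and every eigenvalue must occur in it.\<close>

lemma finite_eigenvalues: "finite {l. \<exists>v. v \<noteq> 0 \<and> T v = l *s v}"
proof -
  have "\<exists>ls. \<forall>v\<in>S. shift_prod scale T ls v = 0" if "finite S" for S
    using that
  proof induction
    case (insert b S)
    then obtain ls where ls: "\<forall>v\<in>S. shift_prod scale T ls v = 0" by blast
    obtain ms where ms: "shift_prod scale T ms b = 0" using shift_prod_exists by blast
    have "\<forall>v\<in>insert b S. shift_prod scale T (ls @ ms) v = 0"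
      using ls ms by (metis insertE shift_prod_0 shift_prod_append shift_prod_swap)
    then show ?case by blast
  qed simp
  from this[OF finite_Basis] obtain ls where ls: "\<forall>v\<in>Basis. shift_prod scale T ls v = 0" ..
  have all: "shift_prod scale T ls v = 0" for v
  proof -
    have "v \<in> span Basis" by (simp add: span_Basis)
    then show ?thesis by (induction rule: span_induct_alt) (simp_all add: shift_prod_lin ls)
  qed
  have "l \<in> set ls" if "v \<noteq> 0" "T v = l *s v" for l v
  proof (rule ccontr)
    assume "l \<notin> set ls"
    then have "shift_prod scale T ls v \<noteq> 0" using that
    proof (induction ls arbitrary: v)
      case (Cons m ls)
      then have "T v - m *s v = (l - m) *s v" by (simp add: algebra_simps)
      moreover have "(l - m) *s v \<noteq> 0" using Cons.prems by simp
      moreover have "T ((l - m) *s v) = l *s ((l - m) *s v)" using Cons.prems by (simp add: linT mult.commute)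
      ultimately show ?case using Cons by auto
    qed simp
    with all show False by blast
  qed
  then have "{l. \<exists>v. v \<noteq> 0 \<and> T v = l *s v} \<subseteq> set ls" by auto
  then show ?thesis by (rule finite_subset) simp
qed

text \<open>The hypothesis \<open>ss\<close> excludes Jordan blocks of size two in U. The roots of
  an annihilating product are peeled off one at a time, which requires solving T w - l w = u for u
  already in the span.\<close>

lemma span_eigenvectors:
  assumes U: "subspace U" "\<And>u. u \<in> U \<Longrightarrow> T u \<in> U"
    and ss: "\<And>l w. w \<in> U \<Longrightarrow> T (T w - l *s w) = l *s (T w - l *s w) \<Longrightarrow> T w = l *s w"
    and "v \<in> U"
  shows "v \<in> span {u \<in> U. \<exists>l. T u = l *s u}"
proof -
  let ?E = "{u \<in> U. \<exists>l. T u = l *s u}"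
  have EU: "span ?E \<subseteq> U" using U(1) by (intro span_minimal) auto
  \<comment> \<open>On an eigenvector with value m different from l, the operator T - l is inverted
    by dividing by m - l; for m = l the eigenvector goes into the remainder e.\<close>
  have "\<exists>w\<in>span ?E. \<exists>e\<in>U. u = T w - l *s w + e \<and> T e = l *s e" if "u \<in> span ?E" for u l
    using that
  proof (induction rule: span_induct_alt)
    case base
    then show ?case using U(1) by (intro bexI[of _ 0]) (auto simp: linT span_zero subspace_0)
  next
    case (step c x y)
    then obtain w e m where *: "w \<in> span ?E" "e \<in> U" "y = T w - l *s w + e" "T e = l *s e"
      "x \<in> U" "T x = m *s x" by auto
    show ?case
    proof (cases "m = l")
      case True
      then show ?thesis using * U(1)
        by (intro bexI[of _ w] bexI[of _ "c *s x + e"])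
          (auto simp: linT algebra_simps subspace_add subspace_scale)
    next
      case False
      have "T ((c / (m - l)) *s x) - l *s ((c / (m - l)) *s x) = (c / (m - l) * (m - l)) *s x"
        using * by (simp add: linT mult.commute diff_divide_distrib flip: scale_left_diff_distrib) (simp flip: diff_divide_distrib right_diff_distrib)
      also have "c / (m - l) * (m - l) = c" using False by simp
      finally have "c *s x = T ((c / (m - l)) *s x) - l *s ((c / (m - l)) *s x)" by simp
      moreover have "(c / (m - l)) *s x \<in> span ?E" using * by (intro span_scale span_base) auto
      ultimately show ?thesis using *
        by (intro bexI[of _ "(c / (m - l)) *s x + w"] bexI[of _ e])
          (auto simp: linT algebra_simps span_add)
    qed
  qed
  note solve = this
  obtain ls where "shift_prod scale T ls v = 0" using shift_prod_exists by blast
  then show ?thesis using \<open>v \<in> U\<close>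
  proof (induction ls arbitrary: v)
    case Nil
    then show ?case by (simp add: span_zero)
  next
    case (Cons l ls)
    have "T v - l *s v \<in> U" using U Cons.prems by (simp add: subspace_diff subspace_scale)
    with Cons have "T v - l *s v \<in> span ?E" by simp
    from solve[OF this, of l] obtain w e where *: "w \<in> span ?E" "e \<in> U" "T e = l *s e"
      "T v - l *s v = T w - l *s w + e" by blast
    \<comment> \<open>T - l maps v - w to the l-eigenvector e, which is exactly the situation of
      \<open>ss\<close>.\<close>
    then have "T (v - w) - l *s (v - w) = e" by (simp add: linT algebra_simps)
    moreover have "v - w \<in> U" using * EU Cons.prems U(1) by (auto intro: subspace_diff)
    ultimately have "T (v - w) = l *s (v - w)" "v - w \<in> U" using ss * by auto
    then have "v - w \<in> span ?E" by (intro span_base) auto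
    then show ?case using * by (metis diff_add_cancel span_add)
  qed
qed

end

section \<open>Strings for one pair\<close>

context cubic_pair
begin

text \<open>\<open>Finite_Set.fold\<close> over these commuting factors is the product of all a k -
  Y with k in a set; a set of indices allows any single factor to be split off.\<close>

definition Yf :: "(nat \<Rightarrow> 'k) \<Rightarrow> nat \<Rightarrow> 'v \<Rightarrow> 'v" where "Yf a k v = a k *s v - Y v"

lemma Yf_commute: "Yf a k (Yf b j v) = Yf b j (Yf a k v)"
  by (simp add: Yf_def lin_Y algebra_simps)

lemma Yf_0: "Yf a k 0 = 0"
  by (simp add: Yf_def lin_Y)

sublocale Yf: comp_fun_commute "Yf a" for a
  by standard (simp add: fun_eq_iff Yf_commute)

lemma fold_Yf_intertwine:
  assumes "finite I" "\<And>k u. f (Yf a k u) = Yf a k (f u)"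
  shows "f (Finite_Set.fold (Yf a) v I) = Finite_Set.fold (Yf a) (f v) I"
  using assms(1) by (induction rule: finite_induct) (simp_all add: assms(2))

lemma R_Yf: "R x xi (Yf a k v) = Yf a k (R x xi v)"
  by (simp add: R_def Yf_def lin lin_Y Y_A Y_B algebra_simps)

lemma L_Yf: "L x xi (Yf a k v) = Yf a k (L x xi v)"
  by (simp add: L_def Yf_def lin lin_Y Y_A Y_B algebra_simps)

lemma q_pow: "q ^ n * (qi ^ n * z) = z"
  by (metis mult.assoc mult_1 power_mult_distrib power_one q_qi)

text \<open>The argument m counts the steps already taken, so that every label stays expressed
  relative to the fixed start x.\<close>

primrec Lch :: "'k \<Rightarrow> 'k \<Rightarrow> nat \<Rightarrow> nat \<Rightarrow> 'v \<Rightarrow> 'v" where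
  "Lch x xi 0 m v = v"
| "Lch x xi (Suc n) m v = Lch x xi n (Suc m) (L (x * qi ^ m) (q ^ m * xi) v)"

primrec Rch :: "'k \<Rightarrow> 'k \<Rightarrow> nat \<Rightarrow> nat \<Rightarrow> 'v \<Rightarrow> 'v" where
  "Rch x xi 0 m v = v"
| "Rch x xi (Suc n) m v = Rch x xi n (Suc m) (R (x * q ^ m) (qi ^ m * xi) v)"

text \<open>The scalars that \<open>R_L\<close> and \<open>L_R\<close> produce at the labels k steps
  below and k steps above x.\<close>

definition cL :: "'k \<Rightarrow> 'k \<Rightarrow> nat \<Rightarrow> 'k" where
  "cL x xi k = (q - qi)^2 * (qi ^ (2 * k + 1) * (x * x) + q ^ (2 * k + 1) * (xi * xi))"
definition cR :: "'k \<Rightarrow> 'k \<Rightarrow> nat \<Rightarrow> 'k" where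
  "cR x xi k = (q - qi)^2 * (q ^ (2 * k + 1) * (x * x) + qi ^ (2 * k + 1) * (xi * xi))"

lemma x_pow: "x * xi = 1 \<Longrightarrow> (x * qi ^ m) * (q ^ m * xi) = 1" "x * xi = 1 \<Longrightarrow> (x * q ^ m) * (qi ^ m * xi) = 1"
  using q_pow[of m 1] by (simp_all add: algebra_simps)

lemma Lch_K: "x * xi = 1 \<Longrightarrow> v \<in> K (x * qi ^ m) (q ^ m * xi) \<Longrightarrow> Lch x xi n m v \<in> K (x * qi ^ (n + m)) (q ^ (n + m) * xi)"
proof (induction n arbitrary: m v)
  case (Suc n)
  have "L (x * qi ^ m) (q ^ m * xi) v \<in> K (x * qi ^ Suc m) (q ^ Suc m * xi)"
    using L_K[OF x_pow(1) Suc.prems(2)] Suc.prems(1) by (simp add: ac_simps)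
  with Suc.IH Suc.prems(1) show ?case by fastforce
qed simp

lemma Rch_K: "x * xi = 1 \<Longrightarrow> v \<in> K (x * q ^ m) (qi ^ m * xi) \<Longrightarrow> Rch x xi n m v \<in> K (x * q ^ (n + m)) (qi ^ (n + m) * xi)"
proof (induction n arbitrary: m v)
  case (Suc n)
  have "R (x * q ^ m) (qi ^ m * xi) v \<in> K (x * q ^ Suc m) (qi ^ Suc m * xi)"
    using R_K[OF x_pow(2) Suc.prems(2)] Suc.prems(1) by (simp add: ac_simps)
  with Suc.IH Suc.prems(1) show ?case by fastforce
qed simp

text \<open>Walking back up turns each step down into a factor \<open>cL k - Y\<close>. These
  factors commute with all steps, so a string that ends makes their product vanish on its
  head.\<close>

lemma Lch_fold:
  assumes "x * xi = 1" "v \<in> K (x * qi ^ m) (q ^ m * xi)" "Lch x xi n m v = 0"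
  shows "Finite_Set.fold (Yf (cL x xi)) v {m..<m + n} = 0"
  using assms(2,3)
proof (induction n arbitrary: m v)
  case (Suc n)
  let ?x = "x * qi ^ m" and ?xi = "q ^ m * xi"
  have "L ?x ?xi v \<in> K (x * qi ^ Suc m) (q ^ Suc m * xi)"
    using L_K[OF x_pow(1) Suc.prems(1)] assms(1) by (simp add: ac_simps)
  from Suc.IH[OF this] Suc.prems(2)
  have "Finite_Set.fold (Yf (cL x xi)) (L ?x ?xi v) {Suc m..<Suc m + n} = 0" by simp
  then have "R (?x * qi) (q * ?xi) (Finite_Set.fold (Yf (cL x xi)) (L ?x ?xi v) {Suc m..<Suc m + n}) = 0"
    by (simp add: R_def lin)
  then have "Finite_Set.fold (Yf (cL x xi)) (R (?x * qi) (q * ?xi) (L ?x ?xi v)) {Suc m..<Suc m + n} = 0"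
    by (simp add: fold_Yf_intertwine[of _ "R (?x * qi) (q * ?xi)", OF _ R_Yf])
  moreover have "R (?x * qi) (q * ?xi) (L ?x ?xi v) = Yf (cL x xi) m v"
    unfolding R_L[OF x_pow(1)[OF assms(1)] Suc.prems(1)] Yf_def cL_def
    by (simp add: ac_simps power_mult power2_eq_square power_mult_distrib)
  moreover have "{m..<m + Suc n} = insert m {Suc m..<Suc m + n}" by auto
  moreover have "Finite_Set.fold (Yf (cL x xi)) v (insert m {Suc m..<Suc m + n})
      = Finite_Set.fold (Yf (cL x xi)) (Yf (cL x xi) m v) {Suc m..<Suc m + n}"
    by (rule Yf.fold_insert2) auto
  ultimately show ?case by metis
qed simp

lemma Rch_fold:
  assumes "x * xi = 1" "v \<in> K (x * q ^ m) (qi ^ m * xi)" "Rch x xi n m v = 0"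
  shows "Finite_Set.fold (Yf (cR x xi)) v {m..<m + n} = 0"
  using assms(2,3)
proof (induction n arbitrary: m v)
  case (Suc n)
  let ?x = "x * q ^ m" and ?xi = "qi ^ m * xi"
  have "R ?x ?xi v \<in> K (x * q ^ Suc m) (qi ^ Suc m * xi)"
    using R_K[OF x_pow(2) Suc.prems(1)] assms(1) by (simp add: ac_simps)
  from Suc.IH[OF this] Suc.prems(2)
  have "Finite_Set.fold (Yf (cR x xi)) (R ?x ?xi v) {Suc m..<Suc m + n} = 0" by simp
  then have "L (q * ?x) (?xi * qi) (Finite_Set.fold (Yf (cR x xi)) (R ?x ?xi v) {Suc m..<Suc m + n}) = 0"
    by (simp add: L_def lin)
  then have "Finite_Set.fold (Yf (cR x xi)) (L (q * ?x) (?xi * qi) (R ?x ?xi v)) {Suc m..<Suc m + n} = 0"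
    by (simp add: fold_Yf_intertwine[of _ "L (q * ?x) (?xi * qi)", OF _ L_Yf])
  moreover have "L (q * ?x) (?xi * qi) (R ?x ?xi v) = Yf (cR x xi) m v"
    unfolding L_R[OF x_pow(2)[OF assms(1)] Suc.prems(1)] Yf_def cR_def
    by (simp add: ac_simps power_mult power2_eq_square power_mult_distrib)
  moreover have "{m..<m + Suc n} = insert m {Suc m..<Suc m + n}" by auto
  moreover have "Finite_Set.fold (Yf (cR x xi)) v (insert m {Suc m..<Suc m + n})
      = Finite_Set.fold (Yf (cR x xi)) (Yf (cR x xi) m v) {Suc m..<Suc m + n}"
    by (rule Yf.fold_insert2) auto
  ultimately show ?case by metis
qed simp

end

section \<open>Labels of eigenvalues for q not a root of unity\<close>

definition lam :: "complex \<Rightarrow> complex" where "lam x = x - 1 / x"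
definition br :: "complex \<Rightarrow> complex" where "br x = x + 1 / x"

locale non_root =
  fixes q :: complex
  assumes q_nz: "q \<noteq> 0" and q_pow_1: "\<And>n. q ^ n = 1 \<Longrightarrow> n = 0"
begin

lemma q_pow_inj: "q ^ m = q ^ n \<Longrightarrow> m = n"
proof (induction m n rule: linorder_wlog)
  case (le m n)
  have "q ^ m * q ^ (n - m) = q ^ n" using le(1) by (simp flip: power_add)
  then have "q ^ m * q ^ (n - m) = q ^ m * 1" using le(2) by simp
  then show ?case using q_pow_1[of "n - m"] q_nz le by simp
qed simp

lemma finite_lam: "finite {x. x \<noteq> 0 \<and> lam x = l}"
proof -
  have "{x. x \<noteq> 0 \<and> lam x = l} \<subseteq> {x. poly [:- 1, - l, 1:] x = 0}"
    by (auto simp: lam_def field_simps)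
  then show ?thesis by (rule finite_subset) (intro poly_roots_finite, simp)
qed

text \<open>The powers of q are distinct and an eigenvalue has only finitely many labels, so a
  string of labels leaves a finite spectrum; every termination argument below goes through
  this.\<close>

lemma finite_chain:
  assumes "finite E" "x \<noteq> 0"
  shows "finite {n. lam (x * q ^ n) \<in> E}" "finite {n. lam (x / q ^ n) \<in> E}"
proof -
  have fin: "finite (\<Union>l\<in>E. {x. x \<noteq> 0 \<and> lam x = l})" using assms finite_lam by auto
  have "inj (\<lambda>n. x * q ^ n)" using assms q_pow_inj by (auto simp: inj_def)
  from finite_vimageI[OF fin this] show "finite {n. lam (x * q ^ n) \<in> E}"
    using assms q_nz by (simp add: vimage_def)
  have "inj (\<lambda>n. x / q ^ n)" using assms q_nz q_pow_inj by (auto simp: inj_def)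
  from finite_vimageI[OF fin this] show "finite {n. lam (x / q ^ n) \<in> E}"
    using assms q_nz by (simp add: vimage_def)
qed

end

section \<open>One pair over the complex numbers and over the dual numbers\<close>

locale so3_rep = complex_space scale Basis + non_root q
  for scale :: "complex \<Rightarrow> 'v::ab_group_add \<Rightarrow> 'v" (infixr \<open>*s\<close> 75) and Basis and q :: complex +
  fixes A B :: "'v \<Rightarrow> 'v"
  assumes hom_A: "module_hom scale scale A"
    and hom_B: "module_hom scale scale B"
    and AAB: "A (A (B v)) = (q + inverse q) *s A (B (A v)) - B (A (A v)) + ((q - inverse q)^2) *s B v"
    and ABB: "A (B (B v)) = (q + inverse q) *s B (A (B v)) - B (B (A v)) + ((q - inverse q)^2) *s A v"
begin

sublocale P: cubic_pair scale q "inverse q" A B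
  using hom_A hom_B AAB ABB q_nz by unfold_locales (auto simp: module_hom.add module_hom.scale)

sublocale opA: complex_operator scale Basis A
  using hom_A by unfold_locales (auto simp: module_hom.add module_hom.scale)

text \<open>Power series act on \<open>v + eps w = (v, w)\<close> through their first two coefficients. This gives the dual
  numbers without a new type, and invertible elements \<open>x + eps\<close>.\<close>
definition scale2 :: "complex fps \<Rightarrow> 'v \<times> 'v \<Rightarrow> 'v \<times> 'v" where
  "scale2 f v = (fps_nth f 0 *s fst v, fps_nth f 0 *s snd v + fps_nth f 1 *s fst v)"

sublocale P2: cubic_pair scale2 "fps_const q" "fps_const (inverse q)" "map_prod A A" "map_prod B B"
proof unfold_locales
  show "fps_const q * fps_const (inverse q) = 1" using q_nz by simp
qed (auto simp: scale2_def prod_eq_iff P.lin AAB ABB algebra_simps fps_mult_nth_1 power2_eq_square)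

lemma P2_Y: "P2.Y (v, w) = (P.Y v, P.Y w)"
  by (simp add: P2.Y_def P.Y_def P2.D_def P.D_def scale2_def power2_eq_square fps_mult_nth_1 prod_eq_iff)

text \<open>If two products of factors \<open>a k - Y\<close> and \<open>b j - Y\<close> over the dual numbers kill a vector,
  then its leading component is an eigenvector for all \<open>a k\<close> and all \<open>b j\<close> simultaneously; hence
  only the case of one factor each survives, and there the derivatives disagree.\<close>
lemma fold_coprime:
  assumes "finite I" "finite J"
    and "Finite_Set.fold (P2.Yf a) w I = 0" "Finite_Set.fold (P2.Yf b) w J = 0"
    and "\<And>k k' j. k \<in> I \<Longrightarrow> k' \<in> I \<Longrightarrow> j \<in> J \<Longrightarrow> fps_nth (a k) 0 = fps_nth (b j) 0 \<Longrightarrow>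
      fps_nth (a k') 0 = fps_nth (b j) 0 \<Longrightarrow> k = k'"
    and "\<And>k j j'. k \<in> I \<Longrightarrow> j \<in> J \<Longrightarrow> j' \<in> J \<Longrightarrow> fps_nth (a k) 0 = fps_nth (b j) 0 \<Longrightarrow>
      fps_nth (a k) 0 = fps_nth (b j') 0 \<Longrightarrow> j = j'"
    and "\<And>k j. k \<in> I \<Longrightarrow> j \<in> J \<Longrightarrow> fps_nth (a k) 0 = fps_nth (b j) 0 \<Longrightarrow>
      fps_nth (a k) 1 \<noteq> fps_nth (b j) 1"
  shows "fst w = 0"
  using assms
proof (induction "card I + card J" arbitrary: I J w rule: less_induct)
  case less
  have F: "fst (P2.Yf a k w) = fps_nth (a k) 0 *s fst w - P.Y (fst w)" for a k w
    by (cases w) (simp add: P2.Yf_def P2_Y scale2_def)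
  have S: "snd (P2.Yf a k w) = fps_nth (a k) 0 *s snd w + fps_nth (a k) 1 *s fst w - P.Y (snd w)" for a k w
    by (cases w) (simp add: P2.Yf_def P2_Y scale2_def)
  show ?case
  proof (rule ccontr)
    assume v: "fst w \<noteq> 0"
    \<comment> \<open>Applying the factor with index k leaves a vector killed by the product without
      k and still by the other product. The smaller instance shows that its leading component is
      zero, that is, \<open>fst w\<close> is an eigenvector of Y with value a k.\<close>
    have IY: "fps_nth (a k) 0 *s fst w = P.Y (fst w)" if k: "k \<in> I" for k
    proof -
      have "Finite_Set.fold (P2.Yf a) (P2.Yf a k w) (I - {k}) = Finite_Set.fold (P2.Yf a) w I"
        using k less.prems(1) P2.Yf.fold_insert2[of "I - {k}" k a w] by (simp add: insert_absorb)
      moreover have "Finite_Set.fold (P2.Yf b) (P2.Yf a k w) J = P2.Yf a k (Finite_Set.fold (P2.Yf b) w J)"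
        using less.prems(2) P2.fold_Yf_intertwine[of J "P2.Yf a k" b w] P2.Yf_commute by simp
      ultimately have "fst (P2.Yf a k w) = 0"
        using less.prems(1,2,3,4) k card_Diff1_less[OF less.prems(1) k]
        by (intro less.hyps[of "I - {k}" J]) (auto simp: P2.Yf_0 intro: less.prems(5,6) dest: less.prems(7))
      then show ?thesis by (simp add: F)
    qed
    have JY: "fps_nth (b k) 0 *s fst w = P.Y (fst w)" if k: "k \<in> J" for k
    proof -
      have "Finite_Set.fold (P2.Yf b) (P2.Yf b k w) (J - {k}) = Finite_Set.fold (P2.Yf b) w J"
        using k less.prems(2) P2.Yf.fold_insert2[of "J - {k}" k b w] by (simp add: insert_absorb)
      moreover have "Finite_Set.fold (P2.Yf a) (P2.Yf b k w) I = P2.Yf b k (Finite_Set.fold (P2.Yf a) w I)"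
        using less.prems(1) P2.fold_Yf_intertwine[of I "P2.Yf b k" a w] P2.Yf_commute by simp
      ultimately have "fst (P2.Yf b k w) = 0"
        using less.prems(1,2,3,4) k card_Diff1_less[OF less.prems(2) k]
        by (intro less.hyps[of I "J - {k}"]) (auto simp: P2.Yf_0 intro: less.prems(5,6) dest: less.prems(7))
      then show ?thesis by (simp add: F)
    qed
    have "I \<noteq> {}" "J \<noteq> {}" using less.prems(3,4) v by auto
    then obtain k j where kj: "k \<in> I" "j \<in> J" by blast
    have eq: "fps_nth (a k') 0 = fps_nth (b j') 0" if "k' \<in> I" "j' \<in> J" for k' j'
      using IY[OF that(1)] JY[OF that(2)] v by (metis scale_cancel_right)
    have "I = {k}" "J = {j}" using kj eq less.prems(5,6) by blast+
    then have "P2.Yf a k w = 0" "P2.Yf b j w = 0" using less.prems(3,4) by simp_all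
    then have "snd (P2.Yf a k w) = 0" "snd (P2.Yf b j w) = 0" by simp_all
    then have "fps_nth (a k) 0 *s snd w + fps_nth (a k) 1 *s fst w = fps_nth (b j) 0 *s snd w + fps_nth (b j) 1 *s fst w"
      unfolding S by (metis right_minus_eq)
    then have "fps_nth (a k) 1 *s fst w = fps_nth (b j) 1 *s fst w"
      unfolding eq[OF kj] by (rule add_left_imp_eq)
    then have "fps_nth (a k) 1 = fps_nth (b j) 1" using v by simp
    then show False using less.prems(7)[OF kj eq[OF kj]] by simp
  qed
qed

text \<open>A label outside the spectrum of A has zero eigenspace over the dual numbers too: first
  the leading component vanishes, then the eps component satisfies the same equation.\<close>

lemma chain_vanish:
  assumes X: "fps_nth X 0 = x" "x \<noteq> 0" "X * Xi = 1" and w: "w \<in> P2.K X Xi"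
  shows "\<exists>n. P2.Lch X Xi n 0 w = 0" "\<exists>n. P2.Rch X Xi n 0 w = 0"
proof -
  have Xi: "fps_nth Xi 0 = 1 / x" using X by (metis fps_mult_nth_0 fps_one_nth nonzero_eq_divide_eq mult.commute)
  let ?E = "{l. \<exists>v. v \<noteq> 0 \<and> A v = l *s v}"
  have z: "u = 0" if "u \<in> P2.K F G" "fps_nth F 0 = f" "fps_nth G 0 = 1 / f" "lam f \<notin> ?E" for u F G f
  proof -
    obtain v w where u: "u = (v, w)" by fastforce
    have *: "A v = lam f *s v" "A w = lam f *s w + (fps_nth F 1 - fps_nth G 1) *s v"
      using that(1,2,3) by (simp_all add: P2.K_def u scale2_def lam_def)
    then have "v = 0" using that(4) by blast
    with * have "w = 0" using that(4) by auto
    with u \<open>v = 0\<close> show ?thesis by (simp add: zero_prod_def)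
  qed
  have "\<exists>n. n \<notin> {n. lam (x / q ^ n) \<in> ?E}" "\<exists>n. n \<notin> {n. lam (x * q ^ n) \<in> ?E}"
    using finite_chain[OF opA.finite_eigenvalues X(2)] by (metis ex_new_if_finite infinite_UNIV_nat)+
  then obtain m n where mn: "lam (x / q ^ m) \<notin> ?E" "lam (x * q ^ n) \<notin> ?E" by blast
  have "P2.Lch X Xi m 0 w \<in> P2.K (X * fps_const (inverse q) ^ (m + 0)) (fps_const q ^ (m + 0) * Xi)"
    using w by (intro P2.Lch_K X) simp
  from z[OF this, of "x / q ^ m"] mn have "P2.Lch X Xi m 0 w = 0"
    by (simp add: X Xi fps_const_power divide_inverse power_inverse)
  then show "\<exists>n. P2.Lch X Xi n 0 w = 0" ..
  have "P2.Rch X Xi n 0 w \<in> P2.K (X * fps_const q ^ (n + 0)) (fps_const (inverse q) ^ (n + 0) * Xi)"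
    using w by (intro P2.Rch_K X) simp
  from z[OF this, of "x * q ^ n"] mn have "P2.Rch X Xi n 0 w = 0"
    by (simp add: X Xi fps_const_power divide_inverse power_inverse)
  then show "\<exists>n. P2.Rch X Xi n 0 w = 0" ..
qed

end

section \<open>Diagonalizability for one pair\<close>

context non_root
begin

lemma q_sq: "q\<^sup>2 \<noteq> 1" and q_diff: "q - inverse q \<noteq> 0"
proof -
  show "q\<^sup>2 \<noteq> 1" using q_pow_1[of 2] by auto
  then show "q - inverse q \<noteq> 0" using q_nz by (simp add: field_simps power2_eq_square)
qed

lemma h_eq_iff:
  fixes u w :: complex
  assumes "u \<noteq> 0" "w \<noteq> 0"
  shows "u + 1 / u = w + 1 / w \<longleftrightarrow> u = w \<or> u * w = 1"
proof -
  have "u * w * (u + 1 / u - (w + 1 / w)) = (u - w) * (u * w - 1)"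
    using assms by (simp add: field_simps)
  then show ?thesis using assms by (metis eq_iff_diff_eq_0 mult_eq_0_iff)
qed

text \<open>Both values have the form u + 1/u, so u = w or u w = 1; the former would make q a root
  of unity.\<close>

lemma chain_values_eq:
  assumes "x \<noteq> 0"
    and "x\<^sup>2 / q ^ (2 * k + 1) + q ^ (2 * k + 1) / x\<^sup>2 = x\<^sup>2 * q ^ (2 * j + 1) + 1 / (x\<^sup>2 * q ^ (2 * j + 1))"
  shows "x ^ 4 * q ^ (2 * j) = q ^ (2 * k)"
proof -
  let ?u = "x\<^sup>2 / q ^ (2 * k + 1)" and ?w = "x\<^sup>2 * q ^ (2 * j + 1)"
  have "?u = ?w \<or> ?u * ?w = 1" using h_eq_iff[of ?u ?w] assms q_nz by simp
  then show ?thesis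
  proof
    assume "?u = ?w"
    then have "q ^ (2 * k + 1) * q ^ (2 * j + 1) = 1" using assms(1) q_nz by (simp add: field_simps)
    then have "q ^ ((2 * k + 1) + (2 * j + 1)) = 1" by (simp only: power_add)
    from q_pow_1[OF this] show ?thesis by simp
  next
    assume "?u * ?w = 1"
    then show ?thesis using q_nz by (simp add: field_simps power2_eq_square power4_eq_xxxx)
  qed
qed

text \<open>Keeps x away from the fold points and from all their translates by integer powers of q;
  the two inequalities with natural exponents cover the two signs.\<close>

definition good :: "complex \<Rightarrow> bool" where
  "good x \<longleftrightarrow> x \<noteq> 0 \<and> (\<forall>m. x\<^sup>2 \<noteq> - (q ^ (2 * m)) \<and> x\<^sup>2 * q ^ (2 * m) \<noteq> - 1)"

lemma lam_surj: "\<exists>x. x \<noteq> 0 \<and> lam x = l"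
proof -
  have "\<not> constant (poly [:- 1, - l, 1:])" by (simp add: constant_degree)
  then obtain x where "poly [:- 1, - l, 1:] x = 0" using fundamental_theorem_of_algebra by blast
  then have "x \<noteq> 0" "x * (x - l) = 1" by (auto simp: algebra_simps)
  then show ?thesis by (intro exI[of _ x]) (simp add: lam_def field_simps)
qed

end

context so3_rep
begin

lemma cL_nth:
  assumes "fps_nth X 0 = x" "fps_nth Xi 0 = 1 / x" "fps_nth X 1 = x1" "fps_nth Xi 1 = - x1 / x\<^sup>2" "x \<noteq> 0"
  shows "fps_nth (P2.cL X Xi k) 0 = (q - inverse q)\<^sup>2 * (x\<^sup>2 / q ^ (2 * k + 1) + q ^ (2 * k + 1) / x\<^sup>2)"
    and "fps_nth (P2.cR X Xi k) 0 = (q - inverse q)\<^sup>2 * (x\<^sup>2 * q ^ (2 * k + 1) + 1 / (x\<^sup>2 * q ^ (2 * k + 1)))"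
    and "fps_nth (P2.cL X Xi k) 1 = (q - inverse q)\<^sup>2 * 2 * x1 * (x / q ^ (2 * k + 1) - q ^ (2 * k + 1) / x ^ 3)"
    and "fps_nth (P2.cR X Xi k) 1 = (q - inverse q)\<^sup>2 * 2 * x1 * (x * q ^ (2 * k + 1) - 1 / (x ^ 3 * q ^ (2 * k + 1)))"
proof -
  have c: "(fps_const q - fps_const (inverse q))\<^sup>2 = fps_const ((q - inverse q)\<^sup>2)"
    by (simp add: fps_const_power)
  have L: "P2.cL X Xi k = fps_const ((q - inverse q)\<^sup>2) * (fps_const (1 / q ^ (2 * k + 1)) * (X * X)
      + fps_const (q ^ (2 * k + 1)) * (Xi * Xi))"
    unfolding P2.cL_def c fps_const_power by (simp add: power_inverse divide_inverse)
  have R: "P2.cR X Xi k = fps_const ((q - inverse q)\<^sup>2) * (fps_const (q ^ (2 * k + 1)) * (X * X)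
      + fps_const (1 / q ^ (2 * k + 1)) * (Xi * Xi))"
    unfolding P2.cR_def c fps_const_power by (simp add: power_inverse divide_inverse)
  note nth = fps_mult_left_const_nth fps_add_nth fps_mult_nth_0 fps_mult_nth_1 assms(1-4)
  show "fps_nth (P2.cL X Xi k) 0 = (q - inverse q)\<^sup>2 * (x\<^sup>2 / q ^ (2 * k + 1) + q ^ (2 * k + 1) / x\<^sup>2)"
    unfolding L nth by (simp add: power2_eq_square divide_inverse ac_simps)
  show "fps_nth (P2.cR X Xi k) 0 = (q - inverse q)\<^sup>2 * (x\<^sup>2 * q ^ (2 * k + 1) + 1 / (x\<^sup>2 * q ^ (2 * k + 1)))"
    unfolding R nth by (simp add: power2_eq_square divide_inverse ac_simps)
  have three: "1 / x * (- x1 / x\<^sup>2) + - x1 / x\<^sup>2 * (1 / x) = - (2 * x1) / x ^ 3"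
    by (simp add: power2_eq_square power3_eq_cube)
  show "fps_nth (P2.cL X Xi k) 1 = (q - inverse q)\<^sup>2 * 2 * x1 * (x / q ^ (2 * k + 1) - q ^ (2 * k + 1) / x ^ 3)"
    unfolding L nth three by (simp add: divide_inverse algebra_simps)
  show "fps_nth (P2.cR X Xi k) 1 = (q - inverse q)\<^sup>2 * 2 * x1 * (x * q ^ (2 * k + 1) - 1 / (x ^ 3 * q ^ (2 * k + 1)))"
    unfolding R nth three by (simp add: divide_inverse algebra_simps)
qed

text \<open>With a = q^(2k+1) and b = q^(2j+1) the hypothesis reads x^4 b = a; equal derivatives
  would then give a b = 1.\<close>

lemma derivatives_differ:
  assumes "x \<noteq> 0" "x ^ 4 * q ^ (2 * j) = q ^ (2 * k)"
  shows "x / q ^ (2 * k + 1) - q ^ (2 * k + 1) / x ^ 3 \<noteq> x * q ^ (2 * j + 1) - 1 / (x ^ 3 * q ^ (2 * j + 1))"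
proof
  define a b where "a = q ^ (2 * k + 1)" and "b = q ^ (2 * j + 1)"
  have nz: "a \<noteq> 0" "b \<noteq> 0" using q_nz by (simp_all add: a_def b_def)
  assume "x / q ^ (2 * k + 1) - q ^ (2 * k + 1) / x ^ 3 = x * q ^ (2 * j + 1) - 1 / (x ^ 3 * q ^ (2 * j + 1))"
  then have "x / a - a / x ^ 3 = x * b - 1 / (x ^ 3 * b)" by (simp only: a_def b_def)
  then have "(x / a - a / x ^ 3) * (a * x ^ 3 * b) = (x * b - 1 / (x ^ 3 * b)) * (a * x ^ 3 * b)" by simp
  moreover have "(x / a - a / x ^ 3) * (a * x ^ 3 * b) = x ^ 4 * b - a * a * b"
    using assms(1) nz by (simp add: left_diff_distrib power4_eq_xxxx power3_eq_cube)
  moreover have "(x * b - 1 / (x ^ 3 * b)) * (a * x ^ 3 * b) = x ^ 4 * b * b * a - a"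
    using assms(1) nz by (simp add: left_diff_distrib power4_eq_xxxx power3_eq_cube)
  ultimately have "x ^ 4 * b - a * a * b = x ^ 4 * b * b * a - a" by simp
  moreover have x4: "x ^ 4 * b = a" using assms(2) by (simp add: a_def b_def algebra_simps)
  ultimately have "a - a * a * b = a * b * a - a" by simp
  then have "2 * a * (a * b - 1) = 0" by (simp add: algebra_simps)
  then have "a * b = 1" using nz by simp
  then have "q ^ ((2 * k + 1) + (2 * j + 1)) = 1" unfolding a_def b_def by (simp only: power_add)
  from q_pow_1[OF this] show False by simp
qed

lemma A_semisimple:
  assumes x: "x \<noteq> 0" "x\<^sup>2 \<noteq> - 1"
    and w: "A (A w - lam x *s w) = lam x *s (A w - lam x *s w)"
  shows "A w = lam x *s w"
proof -
  let ?X = "fps_const x + fps_X" let ?Xi = "inverse ?X"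
  have X: "fps_nth ?X 0 = x" "fps_nth ?X 1 = 1" "?X * ?Xi = 1" "fps_nth ?Xi 0 = 1 / x"
    using x by (simp_all add: inverse_mult_eq_1' divide_inverse)
  have "fps_nth (?X * ?Xi) 1 = 0" unfolding X(3) by simp
  then have Xi1: "fps_nth ?Xi 1 = - 1 / x\<^sup>2"
    unfolding fps_mult_nth_1 X(1,2,4) using x by (simp add: field_simps power2_eq_square eq_neg_iff_add_eq_0)
  \<comment> \<open>The derivative of \<open>lam\<close> at x, nonzero because x is not a fold
    point.\<close>
  let ?e = "1 + 1 / x\<^sup>2"
  have e: "?e \<noteq> 0"
  proof
    assume "?e = 0"
    then have "x\<^sup>2 * ?e = 0" by simp
    then have "x\<^sup>2 + 1 = 0" using x(1) by (simp add: distrib_left)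
    then show False using x(2) by (simp add: eq_neg_iff_add_eq_0)
  qed
  \<comment> \<open>This normalization makes A w = lam x w + ?e ?v, so that ?v + eps w is an
    eigenvector with label x + eps.\<close>
  let ?v = "(1 / ?e) *s (A w - lam x *s w)"
  have ev: "?e *s ?v = A w - lam x *s w" using e by simp
  have "A ?v = (1 / ?e) *s A (A w - lam x *s w)" by (rule P.lin)
  also have "\<dots> = lam x *s ?v" unfolding w by (rule scale_left_commute)
  finally have "A ?v = lam x *s ?v" .
  moreover have "A w = lam x *s w + ?e *s ?v" unfolding ev by simp
  ultimately have K: "(?v, w) \<in> P2.K ?X ?Xi"
    unfolding P2.K_def by (simp add: scale2_def X Xi1 lam_def del: fps_inverse_nth_0 One_nat_def)
  from chain_vanish[OF X(1) x(1) X(3) K] obtain m n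
    where mn: "P2.Lch ?X ?Xi m 0 (?v, w) = 0" "P2.Rch ?X ?Xi n 0 (?v, w) = 0" by blast
  have F: "Finite_Set.fold (P2.Yf (P2.cL ?X ?Xi)) (?v, w) {0..<m} = 0"
    "Finite_Set.fold (P2.Yf (P2.cR ?X ?Xi)) (?v, w) {0..<n} = 0"
    using P2.Lch_fold[OF X(3) _ mn(1)] P2.Rch_fold[OF X(3) _ mn(2)] K by simp_all
  note nth = cL_nth[OF X(1,4,2) Xi1 x(1)]
  have c: "(q - inverse q)\<^sup>2 \<noteq> 0" using q_diff by simp
  have eq: "x ^ 4 * q ^ (2 * j) = q ^ (2 * k)"
    if "fps_nth (P2.cL ?X ?Xi k) 0 = fps_nth (P2.cR ?X ?Xi j) 0" for k j
    using that c unfolding nth by (intro chain_values_eq x) simp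
  have "fst (?v, w) = 0"
  proof (rule fold_coprime[OF _ _ F])
    fix k k' j
    assume "fps_nth (P2.cL ?X ?Xi k) 0 = fps_nth (P2.cR ?X ?Xi j) 0" "fps_nth (P2.cL ?X ?Xi k') 0 = fps_nth (P2.cR ?X ?Xi j) 0"
    from eq[OF this(1)] eq[OF this(2)] have "q ^ (2 * k) = q ^ (2 * k')" by metis
    then show "k = k'" using q_pow_inj by fastforce
  next
    fix k j j'
    assume "fps_nth (P2.cL ?X ?Xi k) 0 = fps_nth (P2.cR ?X ?Xi j) 0" "fps_nth (P2.cL ?X ?Xi k) 0 = fps_nth (P2.cR ?X ?Xi j') 0"
    from eq[OF this(1)] eq[OF this(2)] have "x ^ 4 * q ^ (2 * j) = x ^ 4 * q ^ (2 * j')" by metis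
    then show "j = j'" using x q_pow_inj by fastforce
  next
    fix k j
    assume "fps_nth (P2.cL ?X ?Xi k) 0 = fps_nth (P2.cR ?X ?Xi j) 0"
    from derivatives_differ[OF x(1) eq[OF this]]
    show "fps_nth (P2.cL ?X ?Xi k) 1 \<noteq> fps_nth (P2.cR ?X ?Xi j) 1"
      unfolding nth using c by simp
  qed simp_all
  then have "?v = 0" by simp
  with ev show ?thesis by simp
qed

text \<open>At the fold q x and x / q label the same eigenvalue, so B w is killed by the square of A
  minus that value. Semisimplicity at q x makes B w an eigenvector; this fixes Y on w, and with that
  value of Y the upward string from B w never stops, against the finiteness of the spectrum.\<close>

lemma no_fold_eigenvector:
  assumes x: "x\<^sup>2 = - 1" and w: "A w = lam x *s w"
  shows "w = 0"
proof (rule ccontr)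
  assume w0: "w \<noteq> 0"
  let ?s = "q + inverse q" and ?c = "(q - inverse q)\<^sup>2"
  have c0: "?c \<noteq> 0" using q_diff by simp
  have xx: "x * x = - 1" using x by (simp add: power2_eq_square)
  have x0: "x \<noteq> 0" using xx by auto
  have xi: "1 / x = - x" using x0 xx by (simp add: field_simps)
  have lx: "lam x = 2 * x" using xi by (simp add: lam_def)
  have sc: "?s * ?s = ?c + 4" using q_nz by (simp add: power2_eq_square algebra_simps)
  let ?u = "B w" and ?l = "x * ?s"
  have lq: "lam (q * x) = ?l"
    using q_nz x0 xi by (simp add: lam_def divide_inverse algebra_simps)
  have "A (A ?u) = (2 * x * ?s) *s A ?u - (4 * (x * x)) *s ?u + ?c *s ?u"
    unfolding AAB w lx by (simp add: P.lin w lx mult.commute mult.assoc)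
  moreover have ll: "?l * ?l = 4 * (x * x) - ?c"
  proof -
    have "?l * ?l = (x * x) * (?s * ?s)" by (simp only: ac_simps)
    then show ?thesis by (simp only: xx sc) simp
  qed
  moreover have "(2 * ?l) *s z = ?l *s z + ?l *s z" for z
    by (metis mult_2 scale_left_distrib)
  ultimately have "A (A ?u) = ?l *s A ?u + ?l *s A ?u - (?l * ?l) *s ?u"
    by (simp add: scale_left_diff_distrib mult.assoc)
  then have "A (A ?u - lam (q * x) *s ?u) = lam (q * x) *s (A ?u - lam (q * x) *s ?u)"
    unfolding lq by (simp only: P.lin scale_right_diff_distrib scale_scale) simp
  moreover have "q * x \<noteq> 0" using q_nz x0 by simp
  moreover have "(q * x)\<^sup>2 \<noteq> - 1" using q_sq x by (simp add: power_mult_distrib)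
  ultimately have u: "A ?u = lam (q * x) *s ?u" using A_semisimple by blast
  have wK: "w \<in> P.K x (- x)" using w lx by (simp add: P.K_def)
  have "P.R x (- x) w = 0" using u lq by (simp add: P.R_def algebra_simps)
  then have "(?c * (q * x * x + x * x * inverse q)) *s w = P.Y w"
    using P.L_R[OF _ wK] xx by (simp add: P.L_def P.lin)
  then have Yw: "P.Y w = (- (?c * ?s)) *s w" using xx by (simp add: algebra_simps)
  have Yu: "P.Y ?u = (- (?c * ?s)) *s ?u" by (simp add: P.Y_B Yw P.lin)
  \<comment> \<open>If B w were zero, the relation \<open>ABB\<close> would force A w = 0, although
    the eigenvalue of w is 2 x.\<close>
  have u0: "?u \<noteq> 0"
  proof
    assume "?u = 0"
    then have "?c *s A w = 0" using ABB[of w] w by (simp add: P.lin)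
    then show False using c0 w0 x0 lx w by simp
  qed
  \<comment> \<open>The string starts at B w, with label x q^(n+1) for n = 0, because the raising
    step from w itself vanishes.\<close>
  have "\<exists>u. u \<noteq> 0 \<and> u \<in> P.K (x * q ^ Suc n) (- x * inverse q ^ Suc n) \<and> P.Y u = (- (?c * ?s)) *s u" for n
  proof (induction n)
    case 0
    show ?case using u0 u Yu lq by (intro exI[of _ ?u]) (simp add: P.K_def algebra_simps)
  next
    case (Suc n)
    let ?x = "x * q ^ Suc n" and ?xi = "- x * inverse q ^ Suc n"
    from Suc obtain u where *: "u \<noteq> 0" "u \<in> P.K ?x ?xi" "P.Y u = (- (?c * ?s)) *s u" by blast
    let ?u = "P.R ?x ?xi u"
    have qq: "q ^ Suc n * inverse q ^ Suc n = 1" using q_nz by (metis power_mult_distrib power_one right_inverse)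
    have one: "?x * ?xi = 1"
    proof -
      have "?x * ?xi = - (x * x) * (q ^ Suc n * inverse q ^ Suc n)" by (simp only: ac_simps mult_minus_left mult_minus_right)
      then show ?thesis by (simp only: xx qq) simp
    qed
    have K: "?u \<in> P.K (x * q ^ Suc (Suc n)) (- x * inverse q ^ Suc (Suc n))"
      using P.R_K[OF one *(2)] by (simp add: ac_simps)
    have Y: "P.Y ?u = (- (?c * ?s)) *s ?u"
      by (simp add: P.R_def P.lin_Y P.Y_A P.Y_B *(3) P.lin algebra_simps)
    have "?u \<noteq> 0"
    proof
      assume "?u = 0"
      then have "P.L (q * ?x) (?xi * inverse q) ?u = 0" by (simp only: P.L_def P.lin) simp
      then have "(?c * (q * ?x * ?x + ?xi * ?xi * inverse q)) *s u = (- (?c * ?s)) *s u"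
        using P.L_R[OF one *(2)] *(3) by (metis right_minus_eq)
      then have "?c * (q * ?x * ?x + ?xi * ?xi * inverse q) = - (?c * ?s)" using *(1) by (metis scale_cancel_right)
      then have "q * ?x * ?x + ?xi * ?xi * inverse q = - ?s" using c0 by (metis mult_cancel_left mult_minus_right)
      moreover have "q * ?x * ?x + ?xi * ?xi * inverse q = (x * x) * (q ^ (2 * n + 3) + inverse q ^ (2 * n + 3))"
        by (simp add: algebra_simps power_add power_mult power2_eq_square power3_eq_cube power_mult_distrib)
      ultimately have "(x * x) * (q ^ (2 * n + 3) + inverse q ^ (2 * n + 3)) = - ?s" by (simp only:)
      then have "- (q ^ (2 * n + 3) + inverse q ^ (2 * n + 3)) = - ?s" unfolding xx mult_minus1 .
      then have "q ^ (2 * n + 3) + 1 / q ^ (2 * n + 3) = q + 1 / q"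
        unfolding neg_equal_iff_equal power_inverse by (simp only: inverse_eq_divide)
      then have "q ^ (2 * n + 3) = q ^ 1 \<or> q ^ (2 * n + 3) * q = 1" using h_eq_iff[of "q ^ (2 * n + 3)" q] q_nz by simp
      then show False using q_pow_inj[of "2 * n + 3" 1] q_pow_1[of "2 * n + 4"]
        by (auto simp: power_add algebra_simps numeral_eq_Suc)
    qed
    then show ?case using K Y by blast
  qed
  note nz = this
  have "finite {n. lam (x * q ^ n) \<in> {l. \<exists>v. v \<noteq> 0 \<and> A v = l *s v}}"
    by (rule finite_chain[OF opA.finite_eigenvalues x0])
  moreover have "Suc n \<in> {n. lam (x * q ^ n) \<in> {l. \<exists>v. v \<noteq> 0 \<and> A v = l *s v}}" for n
  proof -
    have "lam (x * q ^ Suc n) = x * q ^ Suc n - (- x * inverse q ^ Suc n)"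
      unfolding lam_def using xi by (simp add: divide_inverse power_inverse)
    then show ?thesis using nz[of n] by (auto simp: P.K_def)
  qed
  ultimately have "finite (range Suc)" by (metis (no_types, lifting) finite_subset image_subsetI)
  then show False by (simp add: finite_image_iff)
qed

text \<open>The label m steps below x is a fold point with zero eigenspace, so only the factors with
  k < m occur on the way down. Since x^4 = q^(4m), a common value with the upward string would need
  2k = 4m + 2j.\<close>

lemma no_even_fold_eigenvector:
  assumes x: "x\<^sup>2 = - (q ^ (2 * m))" and w: "A w = lam x *s w"
  shows "w = 0"
proof -
  have x0: "x \<noteq> 0" using x q_nz by auto
  let ?X = "fps_const x" let ?Xi = "fps_const (1 / x)"
  have X: "fps_nth ?X 0 = x" "?X * ?Xi = 1" "fps_nth ?Xi 0 = 1 / x" "fps_nth ?X 1 = 0" "fps_nth ?Xi 1 = - 0 / x\<^sup>2"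
    using x0 by simp_all
  \<comment> \<open>The eps part is zero: since no two values coincide, \<open>fold_coprime\<close>
    is used here without its comparison of derivatives.\<close>
  have K: "(w, 0) \<in> P2.K ?X ?Xi"
    using w by (simp add: P2.K_def scale2_def lam_def P.lin)
  have "P2.Lch ?X ?Xi m 0 (w, 0) \<in> P2.K (?X * fps_const (inverse q) ^ (m + 0)) (fps_const q ^ (m + 0) * ?Xi)"
    using K by (intro P2.Lch_K X) simp
  moreover have "u = 0" if u: "u \<in> P2.K (?X * fps_const (inverse q) ^ (m + 0)) (fps_const q ^ (m + 0) * ?Xi)" for u
  proof -
    have "(x / q ^ m)\<^sup>2 = - 1" using x q_nz by (simp add: power_divide power_mult power2_eq_square power_mult_distrib)
    moreover have "A (fst u) = lam (x / q ^ m) *s fst u" "A (snd u) = lam (x / q ^ m) *s snd u"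
      using u by (cases u; simp add: P2.K_def scale2_def lam_def fps_const_power power_inverse divide_inverse mult.commute)+
    ultimately have "fst u = 0" "snd u = 0" using no_fold_eigenvector by blast+
    then show ?thesis by (simp add: prod_eq_iff)
  qed
  ultimately have L: "P2.Lch ?X ?Xi m 0 (w, 0) = 0" by blast
  obtain n where R: "P2.Rch ?X ?Xi n 0 (w, 0) = 0" using chain_vanish(2)[OF X(1) x0 X(2) K] by blast
  have F: "Finite_Set.fold (P2.Yf (P2.cL ?X ?Xi)) (w, 0) {0..<m} = 0"
    "Finite_Set.fold (P2.Yf (P2.cR ?X ?Xi)) (w, 0) {0..<n} = 0"
    using P2.Lch_fold[OF X(2) _ L] P2.Rch_fold[OF X(2) _ R] K by simp_all
  have c: "(q - inverse q)\<^sup>2 \<noteq> 0" using q_diff by simp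
  have neq: "fps_nth (P2.cL ?X ?Xi k) 0 \<noteq> fps_nth (P2.cR ?X ?Xi j) 0" if "k < m" for k j
  proof
    assume "fps_nth (P2.cL ?X ?Xi k) 0 = fps_nth (P2.cR ?X ?Xi j) 0"
    then have "x ^ 4 * q ^ (2 * j) = q ^ (2 * k)"
      using c unfolding cL_nth[OF X(1,3,4,5) x0] by (intro chain_values_eq x0) simp
    moreover have "x ^ 4 = q ^ (4 * m)"
      using x by (metis (no_types, lifting) mult.commute mult_2 numeral_Bit0 power2_minus power_mult power_mult_numeral)
    ultimately have "q ^ (4 * m + 2 * j) = q ^ (2 * k)" by (simp add: power_add)
    from q_pow_inj[OF this] that show False by simp
  qed
  have "fst (w, 0 :: 'v) = 0"
    by (rule fold_coprime[OF _ _ F]) (use neq in auto)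
  then show ?thesis by simp
qed

lemma eigenvalue_good:
  assumes "A w = lam x *s w" "w \<noteq> 0" "x \<noteq> 0"
  shows "good x"
  unfolding good_def
proof (intro conjI allI)
  fix m
  show "x\<^sup>2 \<noteq> - (q ^ (2 * m))" using no_even_fold_eigenvector assms by blast
  show "x\<^sup>2 * q ^ (2 * m) \<noteq> - 1"
  proof
    assume "x\<^sup>2 * q ^ (2 * m) = - 1"
    \<comment> \<open>The label -1/x names the same eigenvalue and turns the second condition into
      the first.\<close>
    then have "(- 1 / x)\<^sup>2 = - (q ^ (2 * m))"
      using assms(3) by (simp add: power_divide field_simps)
    moreover have "lam (- 1 / x) = lam x" using assms(3) by (simp add: lam_def)
    ultimately show False using no_even_fold_eigenvector[of "- 1 / x" m w] assms by simp
  qed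
qed (fact assms)

lemma span_A_eigenvectors:
  assumes "subspace U" "\<And>u. u \<in> U \<Longrightarrow> A u \<in> U" "v \<in> U"
  shows "v \<in> span {u \<in> U. \<exists>x. x \<noteq> 0 \<and> A u = lam x *s u}"
proof -
  have "v \<in> span {u \<in> U. \<exists>l. A u = l *s u}"
  proof (rule opA.span_eigenvectors[OF assms(1,2) _ assms(3)])
    fix l w
    assume w: "A (A w - l *s w) = l *s (A w - l *s w)"
    obtain x where x: "x \<noteq> 0" "lam x = l" using lam_surj by blast
    show "A w = l *s w"
    proof (cases "x\<^sup>2 = - 1")
      case True
      then have "A w - l *s w = 0" using no_fold_eigenvector[OF True, of "A w - l *s w"] w x(2) by blast
      then show ?thesis by simp
    next
      case False
      then show ?thesis using A_semisimple[OF x(1) False, of w] w unfolding x(2) by blast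
    qed
  qed
  moreover have "{u \<in> U. \<exists>l. A u = l *s u} = {u \<in> U. \<exists>x. x \<noteq> 0 \<and> A u = lam x *s u}"
    using lam_surj by metis
  ultimately show ?thesis by simp
qed

end

section \<open>Two pairs sharing B, with commuting outer generators A and C\<close>

locale so4_rep = complex_space scale Basis + non_root q
  for scale :: "complex \<Rightarrow> 'v::ab_group_add \<Rightarrow> 'v" (infixr \<open>*s\<close> 75) and Basis and q :: complex +
  fixes A B C :: "'v \<Rightarrow> 'v"
  assumes hom_A: "module_hom scale scale A"
    and hom_B: "module_hom scale scale B"
    and hom_C: "module_hom scale scale C"
    and AAB: "A (A (B v)) = (q + inverse q) *s A (B (A v)) - B (A (A v)) + ((q - inverse q)^2) *s B v"
    and ABB: "A (B (B v)) = (q + inverse q) *s B (A (B v)) - B (B (A v)) + ((q - inverse q)^2) *s A v"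
    and CCB: "C (C (B v)) = (q + inverse q) *s C (B (C v)) - B (C (C v)) + ((q - inverse q)^2) *s B v"
    and CBB: "C (B (B v)) = (q + inverse q) *s B (C (B v)) - B (B (C v)) + ((q - inverse q)^2) *s C v"
    and AC: "A (C v) = C (A v)"
begin

sublocale AB: so3_rep scale Basis q A B
  using hom_A hom_B AAB ABB by unfold_locales (auto simp: module_hom.add module_hom.scale)

sublocale CB: so3_rep scale Basis q C B
  using hom_C hom_B CCB CBB by unfold_locales (auto simp: module_hom.add module_hom.scale)

text \<open>Identities are proved for one of A and C and transported to the other by this
  instance.\<close>

lemma swap: "so4_rep scale Basis q C B A"
  using hom_A hom_B hom_C AAB ABB CCB CBB AC by unfold_locales (auto simp: module_hom.add module_hom.scale)

lemmas lins = AB.P.lin CB.P.lin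

definition K :: "complex \<Rightarrow> complex \<Rightarrow> 'v set" where
  "K x y = {v. A v = lam x *s v \<and> C v = lam y *s v}"

definition E :: "complex \<Rightarrow> complex \<Rightarrow> 'v \<Rightarrow> 'v" where
  "E h y v = C (B v) - lam (y / h) *s B v"

text \<open>The component of \<open>B v\<close> in \<open>K (g * x) (h * y)\<close>, for \<open>g\<close>, \<open>h\<close> in \<open>{q, inverse q}\<close>, up to a factor. Without the
  normalizing denominators the four ladder operators commute across the two copies of sl2.\<close>
definition rho :: "complex \<Rightarrow> complex \<Rightarrow> complex \<Rightarrow> complex \<Rightarrow> 'v \<Rightarrow> 'v" where
  "rho g h x y v = A (E h y v) - lam (x / g) *s E h y v"

end

section \<open>Ladder operators on joint eigenspaces\<close>

context non_root
begin

abbreviation "qi \<equiv> inverse q"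
abbreviation "d \<equiv> q - inverse q"

definition dir :: "complex \<Rightarrow> bool" where "dir g \<longleftrightarrow> g = q \<or> g = qi"

lemma dir_simps [simp]: "dir q" "dir qi"
  by (simp_all add: dir_def)

lemma dir_nz: "dir g \<Longrightarrow> g \<noteq> 0"
  using q_nz by (auto simp: dir_def)

text \<open>Together with \<open>lam_prod\<close> these are the Vieta formulas of the quadratic that
  the cubic relation imposes on the C-eigenvalues occurring in B v.\<close>

lemma lam_sum: "dir h \<Longrightarrow> y \<noteq> 0 \<Longrightarrow> (q + qi) * lam y = lam (h * y) + lam (y / h)"
  unfolding dir_def using q_nz by (elim disjE; hypsubst; simp add: lam_def field_simps)

lemma lam_prod: "dir h \<Longrightarrow> y \<noteq> 0 \<Longrightarrow> lam (h * y) * lam (y / h) = lam y * lam y - d\<^sup>2"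
  unfolding dir_def using q_nz by (elim disjE; hypsubst; simp add: lam_def field_simps power2_eq_square)

lemma lam_diff: "y \<noteq> 0 \<Longrightarrow> lam (y / qi) - lam (y / q) = d * br y"
  using q_nz by (simp add: lam_def br_def field_simps)

lemma lam_eq_iff: "x \<noteq> 0 \<Longrightarrow> y \<noteq> 0 \<Longrightarrow> lam x = lam y \<longleftrightarrow> x = y \<or> x * y = - 1"
proof -
  assume "x \<noteq> 0" "y \<noteq> 0"
  then have "x * y * (lam x - lam y) = (x - y) * (x * y + 1)" by (simp add: lam_def field_simps)
  then show ?thesis using \<open>x \<noteq> 0\<close> \<open>y \<noteq> 0\<close>
    by (metis (no_types, opaque_lifting) eq_iff_diff_eq_0 eq_neg_iff_add_eq_0 mult_eq_0_iff)
qed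

lemma br_nz: "good x \<Longrightarrow> br x \<noteq> 0"
proof
  assume "good x" "br x = 0"
  then have "x\<^sup>2 = - 1" by (simp add: good_def br_def field_simps power2_eq_square eq_neg_iff_add_eq_0)
  then show False using \<open>good x\<close> by (auto simp: good_def dest: spec[of _ 0])
qed

lemma good_step: "good x \<Longrightarrow> good (q * x)" "good x \<Longrightarrow> good (x / q)" "good x \<Longrightarrow> good (qi * x)" "good x \<Longrightarrow> good (x * q)"
proof -
  assume g: "good x"
  have sq: "(q * x)\<^sup>2 = q\<^sup>2 * x\<^sup>2" "(x / q)\<^sup>2 = x\<^sup>2 / q\<^sup>2" by (simp_all add: power_mult_distrib power_divide)
  show 1: "good (q * x)" unfolding good_def
  proof (intro conjI allI)
    show "q * x \<noteq> 0" using g q_nz by (simp add: good_def)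
    fix m
    show "(q * x)\<^sup>2 * q ^ (2 * m) \<noteq> - 1"
      using g[unfolded good_def] by (auto simp: sq dest!: spec[of _ "Suc m"]) (simp add: ac_simps power2_eq_square)
    show "(q * x)\<^sup>2 \<noteq> - (q ^ (2 * m))"
    proof (cases m)
      case 0
      then show ?thesis using g[unfolded good_def] by (auto simp: sq mult.commute dest!: spec[of _ "1"])
    next
      case (Suc n)
      have "x\<^sup>2 \<noteq> - (q ^ (2 * n))" using g by (simp add: good_def)
      then have "q\<^sup>2 * x\<^sup>2 \<noteq> q\<^sup>2 * - (q ^ (2 * n))"
        using q_nz by (simp only: mult_cancel_left power_eq_0_iff simp_thms)
      then show ?thesis unfolding sq Suc by (simp add: power2_eq_square mult.assoc)
    qed
  qed
  then show "good (x * q)" by (simp add: mult.commute)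
  show 2: "good (x / q)" unfolding good_def
  proof (intro conjI allI)
    show "x / q \<noteq> 0" using g q_nz by (simp add: good_def)
    fix m
    show "(x / q)\<^sup>2 \<noteq> - (q ^ (2 * m))"
      using g[unfolded good_def] q_nz by (auto simp: sq field_simps power2_eq_square dest!: spec[of _ "Suc m"])
    show "(x / q)\<^sup>2 * q ^ (2 * m) \<noteq> - 1"
    proof (cases m)
      case 0
      have "x\<^sup>2 \<noteq> - (q ^ (2 * 1))" using g unfolding good_def by blast
      with 0 show ?thesis unfolding sq using q_nz by (simp add: divide_eq_eq)
    next
      case (Suc n)
      then show ?thesis using g[unfolded good_def] q_nz by (auto simp: sq power2_eq_square mult.assoc dest!: spec[of _ "n"])
    qed
  qed
  then show "good (qi * x)" by (simp add: divide_inverse mult.commute)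
qed

text \<open>Two applications of B reach just these three C-eigenvalues from y; their distinctness
  allows a relation quadratic in B to be split.\<close>

lemma lam_distinct:
  assumes "good y"
  shows "lam (q * (q * y)) \<noteq> lam y" "lam (qi * (qi * y)) \<noteq> lam y" "lam (q * (q * y)) \<noteq> lam (qi * (qi * y))"
proof -
  have y: "y \<noteq> 0" "y * y \<noteq> - 1" "y * y * (q * q) \<noteq> - 1" "y * y \<noteq> - (q * q)"
  proof -
    have *: "y \<noteq> 0" "y\<^sup>2 \<noteq> - (q ^ (2 * m))" "y\<^sup>2 * q ^ (2 * m) \<noteq> - 1" for m
      using assms by (simp_all add: good_def)
    show "y \<noteq> 0" "y * y \<noteq> - 1" "y * y * (q * q) \<noteq> - 1" "y * y \<noteq> - (q * q)"
      using *(1) *(2)[of 0] *(3)[of 1] *(2)[of 1] by (simp_all add: power2_eq_square)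
  qed
  have "q * q \<noteq> 1" "q * q * (q * q) \<noteq> 1"
    using q_pow_1[of 2] q_pow_1[of 4] by (auto simp: power2_eq_square power4_eq_xxxx ac_simps)
  note qy = y this q_nz
  show "lam (q * (q * y)) \<noteq> lam y" 
    using qy by (simp add: lam_eq_iff) (metis (no_types, opaque_lifting) mult.commute mult.left_commute mult_cancel_right1)
  show "lam (qi * (qi * y)) \<noteq> lam y"
    using qy by (simp add: lam_eq_iff field_simps)
  show "lam (q * (q * y)) \<noteq> lam (qi * (qi * y))"
    using qy by (simp add: lam_eq_iff field_simps)
qed

end

context so4_rep
begin

lemma E_lin: "E h y (u + v) = E h y u + E h y v" "E h y (u - v) = E h y u - E h y v"
  "E h y (r *s v) = r *s E h y v" "E h y 0 = 0"
  by (simp_all add: E_def lins algebra_simps)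

lemma rho_lin: "rho g h x y (u + v) = rho g h x y u + rho g h x y v"
  "rho g h x y (u - v) = rho g h x y u - rho g h x y v"
  "rho g h x y (r *s v) = r *s rho g h x y v" "rho g h x y 0 = 0"
  by (simp_all add: rho_def E_lin lins algebra_simps)

lemma E_C:
  assumes "C v = lam y *s v" "dir h" "y \<noteq> 0"
  shows "C (E h y v) = lam (h * y) *s E h y v"
proof -
  have "C (E h y v) = ((q + qi) * lam y - lam (y / h)) *s C (B v) - (lam y * lam y - d\<^sup>2) *s B v"
    unfolding E_def by (simp add: lins CCB assms(1) algebra_simps)
  then show ?thesis
    unfolding lam_sum[OF assms(2,3)] lam_prod[OF assms(2,3), symmetric] E_def
    by (simp add: algebra_simps)
qed

lemma E_split: "y \<noteq> 0 \<Longrightarrow> (d * br y) *s B v = E q y v - E qi y v"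
  unfolding E_def by (simp add: lam_diff flip: scale_left_diff_distrib)

lemma rho_split: "x \<noteq> 0 \<Longrightarrow> (d * br x) *s E h y v = rho q h x y v - rho qi h x y v"
  unfolding rho_def by (simp add: lam_diff flip: scale_left_diff_distrib)

lemma rho_swap: "so4_rep.rho scale C B A h g y x v = rho g h x y v"
proof -
  interpret S: so4_rep scale Basis q C B A by (rule swap)
  show ?thesis by (simp add: S.rho_def S.E_def rho_def E_def lins AC algebra_simps)
qed

lemma K_swap: "so4_rep.K scale C A y x = K x y"
proof -
  interpret S: so4_rep scale Basis q C B A by (rule swap)
  show ?thesis by (auto simp: S.K_def K_def)
qed

text \<open>The factor with A is applied last and commutes with C, so the C-label is that of
  \<open>E\<close>; the A-label follows in the same way after exchanging A and C, since
  \<open>rho\<close> is symmetric under the exchange.\<close>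

lemma rho_K:
  assumes "v \<in> K x y" "dir g" "dir h" "x \<noteq> 0" "y \<noteq> 0"
  shows "rho g h x y v \<in> K (g * x) (h * y)"
proof -
  interpret S: so4_rep scale Basis q C B A by (rule swap)
  have "C (rho g h x y v) = lam (h * y) *s rho g h x y v"
    using assms E_C[of v y h] unfolding rho_def K_def by (simp add: lins AC[symmetric] algebra_simps)
  moreover have "A (S.rho h g y x v) = lam (g * x) *s S.rho h g y x v"
    using assms S.E_C[of v x g] unfolding S.rho_def K_def by (simp add: lins AC algebra_simps)
  ultimately show ?thesis by (simp add: K_def rho_swap)
qed

lemma K_good: "v \<in> K x y \<Longrightarrow> v \<noteq> 0 \<Longrightarrow> x \<noteq> 0 \<Longrightarrow> y \<noteq> 0 \<Longrightarrow> good x \<and> good y"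
  using AB.eigenvalue_good CB.eigenvalue_good by (auto simp: K_def)

lemma sep3:
  assumes "u1 + u2 + u3 = 0" "C u1 = l1 *s u1" "C u2 = l2 *s u2" "C u3 = l3 *s u3"
    "l1 \<noteq> l2" "l1 \<noteq> l3" "l2 \<noteq> l3"
  shows "u1 = 0" "u2 = 0" "u3 = 0"
proof -
  have key: "w3 = 0" if "w1 + w2 + w3 = 0" "C w1 = m1 *s w1" "C w2 = m2 *s w2" "C w3 = m3 *s w3"
    "m3 \<noteq> m1" "m3 \<noteq> m2" for w1 w2 w3 m1 m2 m3
  proof -
    have w: "w1 = - w2 - w3" using that(1) by (simp add: eq_neg_iff_add_eq_0 algebra_simps)
    have "C (w1 + w2 + w3) = 0" using that(1) by (simp add: lins)
    moreover have "C (w1 + w2 + w3) = C w1 + C w2 + C w3" by (simp add: lins)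
    ultimately have "m1 *s w1 + m2 *s w2 + m3 *s w3 = 0" by (simp only: that(2-4))
    then have 1: "(m2 - m1) *s w2 + (m3 - m1) *s w3 = 0" unfolding w by (simp add: algebra_simps)
    then have "C ((m2 - m1) *s w2 + (m3 - m1) *s w3) = 0" by (simp add: lins)
    then have "m2 *s ((m2 - m1) *s w2) + m3 *s ((m3 - m1) *s w3) = 0" by (simp add: lins that(3,4) ac_simps)
    moreover have "m2 *s ((m2 - m1) *s w2 + (m3 - m1) *s w3) = 0" unfolding 1 by simp
    ultimately have "m3 *s ((m3 - m1) *s w3) - m2 *s ((m3 - m1) *s w3) = 0"
      unfolding scale_right_distrib by (metis add_diff_cancel_left diff_self)
    then have "((m3 - m2) * (m3 - m1)) *s w3 = 0" by (simp only: scale_left_diff_distrib[symmetric] scale_scale left_diff_distrib)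
    then show ?thesis using that(5,6) by simp
  qed
  show "u3 = 0" using key[OF assms(1-4)] assms(6,7) by simp
  show "u2 = 0" using key[of u1 u3 u2 l1 l3 l2] assms by (simp add: ac_simps)
  show "u1 = 0" using key[of u3 u2 u1 l3 l2 l1] assms by (simp add: ac_simps)
qed

text \<open>The combination A B B - (q + 1/q) B A B + B B A with the first B replaced by its
  component in C-direction h and the second by the one in direction h'.\<close>

definition Phi :: "complex \<Rightarrow> complex \<Rightarrow> complex \<Rightarrow> 'v \<Rightarrow> 'v" where
  "Phi h' h y v = A (E h' (h * y) (E h y v)) - (q + qi) *s E h' (h * y) (A (E h y v))
     + E h' (h * y) (E h y (A v))"

text \<open>Both sides are combinations of A E' E v, E' A E v and E' E v, where E' is the second
  component map; the coefficients agree by the identities \<open>n\<close>. Thus the cubic relation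
  becomes a statement about commutators of ladder operators.\<close>

lemma Phi_rho:
  assumes "A v = lam x *s v" "x \<noteq> 0"
  shows "(d * br x) *s Phi h' h y v
    = rho qi h' (q * x) (h * y) (rho q h x y v) - rho q h' (qi * x) (h * y) (rho qi h x y v)"
proof -
  let ?E = "E h' (h * y)" and ?u = "E h y v"
  have n: "lam (q * x / qi) - lam (qi * x / q) = d * br x * (q + qi)"
    "lam (q * x / qi) * lam (x / q) - lam (qi * x / q) * lam (x / qi) = d * br x * lam x"
    using q_nz assms(2) by (simp_all add: lam_def br_def field_simps)
  have db: "d * br x = lam (x / qi) - lam (x / q)" using lam_diff assms(2) by simp
  have "rho qi h' (q * x) (h * y) (rho q h x y v) - rho q h' (qi * x) (h * y) (rho qi h x y v)
    = (lam (x / qi) - lam (x / q)) *s A (?E ?u) - (lam (q * x / qi) - lam (qi * x / q)) *s ?E (A ?u)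
     + (lam (q * x / qi) * lam (x / q) - lam (qi * x / q) * lam (x / qi)) *s ?E ?u"
    unfolding rho_def by (simp only: E_lin lins) (simp add: algebra_simps)
  also have "\<dots> = (d * br x) *s Phi h' h y v"
    unfolding n db[symmetric] Phi_def assms(1) by (simp add: E_lin algebra_simps)
  finally show ?thesis by simp
qed

lemma Phi_C:
  assumes "C v = lam y *s v" "dir h" "dir h'" "y \<noteq> 0"
  shows "C (Phi h' h y v) = lam (h' * (h * y)) *s Phi h' h y v"
proof -
  have *: "C (E h y u) = lam (h * y) *s E h y u" if "C u = lam y *s u" for u
    using E_C that assms by simp
  have **: "C (E h' (h * y) u) = lam (h' * (h * y)) *s E h' (h * y) u" if "C u = lam (h * y) *s u" for u
    using E_C that assms dir_nz by simp
  have 1: "C (E h' (h * y) (E h y v)) = lam (h' * (h * y)) *s E h' (h * y) (E h y v)"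
    using assms * ** by simp
  have 2: "C (E h' (h * y) (A (E h y v))) = lam (h' * (h * y)) *s E h' (h * y) (A (E h y v))"
    using assms * by (intro **) (simp add: AC[symmetric] lins)
  have 3: "C (E h' (h * y) (E h y (A v))) = lam (h' * (h * y)) *s E h' (h * y) (E h y (A v))"
    using assms by (intro ** *) (simp add: AC[symmetric] lins)
  show ?thesis unfolding Phi_def by (simp add: lins AC[symmetric] 1 2 3 algebra_simps)
qed

text \<open>Each B is recovered from its two components by \<open>E_split\<close>; the denominator
  of the outer one depends on the direction of the inner one. Reassembled, the four terms are the
  relation \<open>ABB\<close>.\<close>

lemma Phi_sum:
  assumes "y \<noteq> 0" "br y \<noteq> 0" "br (q * y) \<noteq> 0" "br (qi * y) \<noteq> 0"
  shows "(1 / br (q * y)) *s (Phi q q y v - Phi qi q y v) - (1 / br (qi * y)) *s (Phi q qi y v - Phi qi qi y v)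
    = (d * d * br y * d\<^sup>2) *s A v"
proof -
  let ?b = "d * br y"
  have nz: "q * y \<noteq> 0" "qi * y \<noteq> 0" using assms q_nz by simp_all
  \<comment> \<open>B' is instantiated with B and with v -> A (B v); w1 and w2 are its components at
    the C-labels q y and y / q, on which the outer B is split.\<close>
  have B: "(d * d * br y) *s B (B' v) = (1 / br (q * y)) *s (E q (q * y) w1 - E qi (q * y) w1)
      - (1 / br (qi * y)) *s (E q (qi * y) w2 - E qi (qi * y) w2)"
    if "?b *s B' v = w1 - w2" for B' v w1 w2
  proof -
    have "d *s B w1 = (1 / br (q * y)) *s (E q (q * y) w1 - E qi (q * y) w1)"
      unfolding E_split[OF nz(1), symmetric] using assms(3) by simp
    moreover have "d *s B w2 = (1 / br (qi * y)) *s (E q (qi * y) w2 - E qi (qi * y) w2)"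
      unfolding E_split[OF nz(2), symmetric] using assms(4) by simp
    moreover have "(d * d * br y) *s B (B' v) = d *s B (?b *s B' v)" by (simp add: lins mult.assoc)
    ultimately show ?thesis unfolding that by (simp only: lins scale_right_diff_distrib)
  qed
  have 1: "(d * d * br y) *s B (B v) = (1 / br (q * y)) *s (E q (q * y) (E q y v) - E qi (q * y) (E q y v))
      - (1 / br (qi * y)) *s (E q (qi * y) (E qi y v) - E qi (qi * y) (E qi y v))" for v
    by (rule B) (rule E_split[OF assms(1)])
  have 2: "(d * d * br y) *s B (A (B v)) = (1 / br (q * y)) *s (E q (q * y) (A (E q y v)) - E qi (q * y) (A (E q y v)))
      - (1 / br (qi * y)) *s (E q (qi * y) (A (E qi y v)) - E qi (qi * y) (A (E qi y v)))"
    by (rule B[of "\<lambda>v. A (B v)"]) (metis E_split[OF assms(1)] lins(2) lins(3))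
  have "(d * d * br y) *s (A (B (B v)) - (q + qi) *s B (A (B v)) + B (B (A v))) = (d * d * br y * d\<^sup>2) *s A v"
    unfolding ABB by simp
  moreover have "(d * d * br y) *s (A (B (B v)) - (q + qi) *s B (A (B v)) + B (B (A v)))
    = A ((d * d * br y) *s B (B v)) - (q + qi) *s ((d * d * br y) *s B (A (B v))) + (d * d * br y) *s B (B (A v))"
    by (simp only: lins scale_right_distrib scale_right_diff_distrib scale_left_commute)
  ultimately have "(d * d * br y * d\<^sup>2) *s A v = A ((d * d * br y) *s B (B v))
      - (q + qi) *s ((d * d * br y) *s B (A (B v))) + (d * d * br y) *s B (B (A v))" by simp
  also have "\<dots> = (1 / br (q * y)) *s (Phi q q y v - Phi qi q y v) - (1 / br (qi * y)) *s (Phi q qi y v - Phi qi qi y v)"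
    unfolding 1 2 Phi_def
    by (simp only: lins scale_right_distrib scale_right_diff_distrib scale_left_commute[of "q + qi"]) simp
  finally show ?thesis by simp
qed

end

context non_root
begin

text \<open>The multiplicative weight of the sl2 copy that is raised by moving (x, y) to (q x, h y):
  this step multiplies it by q^2, and the steps of the other copy leave it fixed.\<close>

definition wt :: "complex \<Rightarrow> complex \<Rightarrow> complex \<Rightarrow> complex" where
  "wt h x y = (if h = q then x * y else x / y)"

lemma q_neq_qi: "q \<noteq> qi" "qi \<noteq> q"
  using q_diff by auto

lemma s_nz: "q + qi \<noteq> 0"
proof
  assume "q + qi = 0"
  then have "q * q = - 1" using q_nz by (simp add: field_simps eq_neg_iff_add_eq_0)
  then have "q ^ 4 = 1" by (simp add: power4_eq_xxxx mult.assoc)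
  then show False using q_pow_1 by fastforce
qed

lemma br_sum: "y \<noteq> 0 \<Longrightarrow> br (q * y) + br (qi * y) = (q + qi) * br y"
  using q_nz by (simp add: br_def field_simps)

lemma lam_wt:
  assumes "x \<noteq> 0" "y \<noteq> 0"
  shows "br (q * y) * lam x + br (qi * x) * lam y = (q + qi) * lam (x * y)"
    and "br (qi * y) * lam x - br (qi * x) * lam y = (q + qi) * lam (x / y)"
  using q_nz assms by (simp_all add: br_def lam_def field_simps)

end

context so4_rep
begin

abbreviation up :: "complex \<Rightarrow> complex \<Rightarrow> complex \<Rightarrow> 'v \<Rightarrow> 'v" where "up h x y v \<equiv> rho q h x y v"
abbreviation dn :: "complex \<Rightarrow> complex \<Rightarrow> complex \<Rightarrow> 'v \<Rightarrow> 'v" where "dn h x y v \<equiv> rho qi h x y v"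

text \<open>The four terms of \<open>Phi_sum\<close> have the C-labels q^2 y, y, y and y / q^2, and
  the right-hand side has the label y; comparing components splits the identity into three.\<close>

lemma Phi_zero:
  assumes v: "v \<in> K x y" "good x" "good y"
  shows "Phi q q y v = 0" "Phi qi qi y v = 0"
    "- (1 / br (q * y)) *s Phi qi q y v - (1 / br (qi * y)) *s Phi q qi y v = (d * d * br y * d\<^sup>2) *s (lam x *s v)"
proof -
  have y: "y \<noteq> 0" using v(3) by (simp add: good_def)
  have br: "br y \<noteq> 0" "br (q * y) \<noteq> 0" "br (qi * y) \<noteq> 0" using v(3) br_nz good_step by blast+
  have Av: "A v = lam x *s v" "C v = lam y *s v" using v(1) by (simp_all add: K_def)
  let ?u1 = "(1 / br (q * y)) *s Phi q q y v" and ?u3 = "(1 / br (qi * y)) *s Phi qi qi y v"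
  let ?u2 = "- (1 / br (q * y)) *s Phi qi q y v - (1 / br (qi * y)) *s Phi q qi y v - (d * d * br y * d\<^sup>2) *s (lam x *s v)"
  have sum: "?u1 + ?u2 + ?u3 = 0"
    using Phi_sum[OF y br, of v] unfolding Av by (simp add: algebra_simps)
  have e: "q * (qi * y) = y" "qi * (q * y) = y" using q_nz by simp_all
  have P: "C (Phi qi q y v) = lam y *s Phi qi q y v" "C (Phi q qi y v) = lam y *s Phi q qi y v"
    using Phi_C[OF Av(2) _ _ y, of q qi] Phi_C[OF Av(2) _ _ y, of qi q] by (simp_all add: e del: right_inverse)
  have C: "C ?u1 = lam (q * (q * y)) *s ?u1" "C ?u2 = lam y *s ?u2" "C ?u3 = lam (qi * (qi * y)) *s ?u3"
    by (simp_all only: lins P Phi_C[OF Av(2) _ _ y] dir_simps Av(2))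
      (simp_all add: scale_right_diff_distrib ac_simps)
  note z = sep3[OF sum C lam_distinct(1)[OF v(3)] lam_distinct(3)[OF v(3)] lam_distinct(2)[OF v(3), symmetric]]
  show "Phi q q y v = 0" "Phi qi qi y v = 0" using z(1,3) br by simp_all
  show "- (1 / br (q * y)) *s Phi qi q y v - (1 / br (qi * y)) *s Phi q qi y v = (d * d * br y * d\<^sup>2) *s (lam x *s v)"
    using z(2) by simp
qed

text \<open>Together with \<open>rho_comm\<close> this says that the two copies of sl2, formed by
  \<open>up q\<close>, \<open>dn qi\<close> and by \<open>up qi\<close>, \<open>dn q\<close>,
  commute with each other.\<close>

lemma dn_up_same:
  assumes v: "v \<in> K x y" "x \<noteq> 0" "y \<noteq> 0" and h: "dir h"
  shows "dn h (q * x) (h * y) (up h x y v) = up h (qi * x) (h * y) (dn h x y v)"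
proof (cases "v = 0")
  case False
  then have g: "good x" "good y" using K_good v by blast+
  have "Phi h h y v = 0" using Phi_zero[OF v(1) g] h by (auto simp: dir_def)
  then show ?thesis using Phi_rho[of v x h h y] v by (simp add: K_def)
qed (simp add: rho_lin)

lemma rho_comm:
  assumes v: "v \<in> K x y" "x \<noteq> 0" "y \<noteq> 0" and h: "dir h"
  shows "rho h qi (h * x) (q * y) (rho h q x y v) = rho h q (h * x) (qi * y) (rho h qi x y v)"
proof -
  interpret S: so4_rep scale Basis q C B A by (rule swap)
  have "v \<in> S.K y x" using v K_swap by simp
  from S.dn_up_same[OF this v(3,2) h] show ?thesis unfolding rho_swap .
qed

lemma ladder_A:
  assumes v: "v \<in> K x y" "good x" "good y"
  shows "(1 / br (qi * y)) *s (up q (qi * x) (qi * y) (dn qi x y v) - dn q (q * x) (qi * y) (up qi x y v))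
      - (1 / br (q * y)) *s (dn qi (q * x) (q * y) (up q x y v) - up qi (qi * x) (q * y) (dn q x y v))
    = (d ^ 5 * lam x * br x * br y) *s v"
proof -
  have x: "x \<noteq> 0" "A v = lam x *s v" using v by (simp_all add: good_def K_def)
  have "(d * br x) *s (- (1 / br (q * y)) *s Phi qi q y v - (1 / br (qi * y)) *s Phi q qi y v)
     = (d * br x) *s ((d * d * br y * d\<^sup>2) *s (lam x *s v))"
    using Phi_zero(3)[OF v] by simp
  moreover have "(d * br x) *s (- (1 / br (q * y)) *s Phi qi q y v - (1 / br (qi * y)) *s Phi q qi y v)
    = - (1 / br (q * y)) *s ((d * br x) *s Phi qi q y v) - (1 / br (qi * y)) *s ((d * br x) *s Phi q qi y v)"
    by (simp only: scale_right_diff_distrib scale_left_commute[of "d * br x"])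
  moreover have "(d * br x) *s ((d * d * br y * d\<^sup>2) *s (lam x *s v)) = (d ^ 5 * lam x * br x * br y) *s v"
    by (simp add: eval_nat_numeral mult.assoc)
  ultimately have "- (1 / br (q * y)) *s (dn qi (q * x) (q * y) (up q x y v) - up qi (qi * x) (q * y) (dn q x y v))
      - (1 / br (qi * y)) *s (dn q (q * x) (qi * y) (up qi x y v) - up q (qi * x) (qi * y) (dn qi x y v))
    = (d ^ 5 * lam x * br x * br y) *s v"
    unfolding Phi_rho[OF x(2,1)] by (simp only:)
  then show ?thesis
    by (simp add: scale_right_diff_distrib) (simp only: diff_conv_add_uminus minus_add_distrib minus_minus ac_simps)
qed

lemma ladder_C:
  assumes v: "v \<in> K x y" "good x" "good y"
  shows "(1 / br (qi * x)) *s (up q (qi * x) (qi * y) (dn qi x y v) - up qi (qi * x) (q * y) (dn q x y v))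
      - (1 / br (q * x)) *s (dn qi (q * x) (q * y) (up q x y v) - dn q (q * x) (qi * y) (up qi x y v))
    = (d ^ 5 * lam y * br x * br y) *s v"
proof -
  interpret S: so4_rep scale Basis q C B A by (rule swap)
  have "v \<in> S.K y x" using v K_swap by simp
  from S.ladder_A[OF this v(3,2)] show ?thesis unfolding rho_swap by (simp add: ac_simps)
qed

text \<open>The last term involves the other ladder. It drops out on the vectors to which this is applied (modulo
  a stable subspace), which leaves an sl2-like relation with scalar coefficients.\<close>
lemma ladder:
  assumes v: "v \<in> K x y" "x \<noteq> 0" "y \<noteq> 0" and h: "dir h"
  shows "\<exists>k. (1 / (br x * br (inverse h * y))) *s up h (qi * x) (inverse h * y) (dn (inverse h) x y v)
      = (1 / (br (q * x) * br y)) *s dn (inverse h) (q * x) (h * y) (up h x y v)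
      + (d ^ 5 * lam (wt h x y)) *s v + k *s dn h (q * x) (inverse h * y) (up (inverse h) x y v)"
proof (cases "v = 0")
  case False
  then have g: "good x" "good y" using K_good v by blast+
  have nz: "br x \<noteq> 0" "br y \<noteq> 0" "br (q * x) \<noteq> 0" "br (qi * x) \<noteq> 0" "br (q * y) \<noteq> 0" "br (qi * y) \<noteq> 0"
    using g br_nz good_step by blast+
  define s where "s = q + qi"
  have s: "s \<noteq> 0" using s_nz by (simp add: s_def)
  define a where "a = up q (qi * x) (qi * y) (dn qi x y v)"
  define a' where "a' = dn qi (q * x) (q * y) (up q x y v)"
  define b where "b = up qi (qi * x) (q * y) (dn q x y v)"
  define b' where "b' = dn q (q * x) (qi * y) (up qi x y v)"
  note lA = ladder_A[OF v(1) g, folded a_def a'_def b_def b'_def]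
  note lC = ladder_C[OF v(1) g, folded a_def a'_def b_def b'_def]
  note bs = br_sum[OF v(2), folded s_def] br_sum[OF v(3), folded s_def]
  define F where "F = d ^ 5"
  from h consider "h = q" | "h = qi" by (auto simp: dir_def)
  then show ?thesis
  proof cases
    case 1
    \<comment> \<open>The multipliers of \<open>lA\<close> and \<open>lC\<close>. Their ratio
      cancels the term \<open>b\<close> (see \<open>c3\<close>), and their size makes the
      eigenvalues of A and C combine to that of the weight x y (see \<open>c4\<close>).\<close>
    let ?al = "br (q * y) / (s * br x * br y)" and ?be = "br (qi * x) / (s * br x * br y)"
    let ?k = "?al / br (qi * y) - ?be / br (q * x)"
    have c1: "?al / br (qi * y) + ?be / br (qi * x) = 1 / (br x * br (qi * y))"
    proof -
      have "?al / br (qi * y) + ?be / br (qi * x) = (br (q * y) + br (qi * y)) / (s * br x * br y * br (qi * y))"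
        using nz s by (simp add: field_simps)
      then show ?thesis unfolding bs using nz s by simp
    qed
    have c2: "?al / br (q * y) + ?be / br (q * x) = 1 / (br (q * x) * br y)"
    proof -
      have "?al / br (q * y) + ?be / br (q * x) = (br (q * x) + br (qi * x)) / (s * br x * br y * br (q * x))"
        using nz s by (simp add: field_simps)
      then show ?thesis unfolding bs using nz s by simp
    qed
    have c3: "?al / br (q * y) - ?be / br (qi * x) = 0" using nz s by simp
    have c4: "?al * (F * lam x * br x * br y) + ?be * (F * lam y * br x * br y) = F * lam (x * y)"
    proof -
      have "?al * (F * lam x * br x * br y) + ?be * (F * lam y * br x * br y)
        = F * (br (q * y) * lam x + br (qi * x) * lam y) / s"
        using nz s by (simp add: field_simps)
      then show ?thesis unfolding lam_wt(1)[OF v(2,3)] s_def[symmetric] using s by simp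
    qed
    have "?al *s ((1 / br (qi * y)) *s (a - b') - (1 / br (q * y)) *s (a' - b))
       + ?be *s ((1 / br (qi * x)) *s (a - b) - (1 / br (q * x)) *s (a' - b'))
       = (?al / br (qi * y) + ?be / br (qi * x)) *s a - (?al / br (q * y) + ?be / br (q * x)) *s a'
         + (?al / br (q * y) - ?be / br (qi * x)) *s b - ?k *s b'"
      by (simp add: algebra_simps)
    then have "(F * lam (x * y)) *s v = (1 / (br x * br (qi * y))) *s a - (1 / (br (q * x) * br y)) *s a' - ?k *s b'"
      unfolding lA lC c1 c2 c3 F_def[symmetric] c4[symmetric] by (simp add: scale_left_distrib)
    then show ?thesis
      by (intro exI[of _ ?k]) (simp add: 1 wt_def a_def a'_def b'_def F_def algebra_simps)
  next
    case 2
    \<comment> \<open>For the other copy the two relations are subtracted; now \<open>a\<close>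
      cancels and the weight is x / y.\<close>
    let ?al = "br (qi * y) / (s * br x * br y)" and ?be = "br (qi * x) / (s * br x * br y)"
    let ?k = "?al / br (q * y) - ?be / br (q * x)"
    have c1: "?al / br (q * y) + ?be / br (qi * x) = 1 / (br x * br (q * y))"
    proof -
      have "?al / br (q * y) + ?be / br (qi * x) = (br (q * y) + br (qi * y)) / (s * br x * br y * br (q * y))"
        using nz s by (simp add: field_simps)
      then show ?thesis unfolding bs using nz s by simp
    qed
    have c2: "?al / br (qi * y) + ?be / br (q * x) = 1 / (br (q * x) * br y)"
    proof -
      have "?al / br (qi * y) + ?be / br (q * x) = (br (q * x) + br (qi * x)) / (s * br x * br y * br (q * x))"
        using nz s by (simp add: field_simps)
      then show ?thesis unfolding bs using nz s by simp
    qed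
    have c3: "?al / br (qi * y) - ?be / br (qi * x) = 0" using nz s by simp
    have c4: "?al * (F * lam x * br x * br y) - ?be * (F * lam y * br x * br y) = F * lam (x / y)"
    proof -
      have "?al * (F * lam x * br x * br y) - ?be * (F * lam y * br x * br y)
        = F * (br (qi * y) * lam x - br (qi * x) * lam y) / s"
        using nz s by (simp add: field_simps)
      then show ?thesis unfolding lam_wt(2)[OF v(2,3)] s_def[symmetric] using s by simp
    qed
    have "?al *s ((1 / br (qi * y)) *s (a - b') - (1 / br (q * y)) *s (a' - b))
       - ?be *s ((1 / br (qi * x)) *s (a - b) - (1 / br (q * x)) *s (a' - b'))
       = (?al / br (q * y) + ?be / br (qi * x)) *s b - (?al / br (qi * y) + ?be / br (q * x)) *s b'
         + (?al / br (qi * y) - ?be / br (qi * x)) *s a - ?k *s a'"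
      by (simp add: algebra_simps)
    then have "(F * lam (x / y)) *s v = (1 / (br x * br (q * y))) *s b - (1 / (br (q * x) * br y)) *s b' - ?k *s a'"
      unfolding lA lC c1 c2 c3 F_def[symmetric] c4[symmetric] by (simp add: scale_left_diff_distrib)
    then show ?thesis
      using q_neq_qi by (intro exI[of _ ?k]) (simp add: 2 wt_def a'_def b_def b'_def F_def algebra_simps)
  qed
qed (simp add: rho_lin)

end

section \<open>Strings of ladder operators\<close>

context non_root
begin

lemma lam_0_iff: "lam z = 0 \<longleftrightarrow> z\<^sup>2 = 1 \<or> z = 0"
  by (cases "z = 0") (auto simp: lam_def power2_eq_square eq_divide_eq)

text \<open>Closed form of the sum of d^5 lam (w / q^(2i)) over i = 0, ..., k: the deformed
  coefficient of the sl2 identity that e f^(k+1) v is a multiple of f^k v.\<close>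

definition step_coeff :: "complex \<Rightarrow> nat \<Rightarrow> complex" where
  "step_coeff w k = d ^ 4 * (q ^ Suc k - qi ^ Suc k) * lam (qi ^ k * w)"

lemma step_coeff_0: "step_coeff w 0 = d ^ 5 * lam w"
  by (simp add: step_coeff_def eval_nat_numeral)

lemma step_coeff_Suc:
  assumes "w \<noteq> 0"
  shows "step_coeff w (Suc k) = step_coeff w k + d ^ 5 * lam (qi ^ (2 * Suc k) * w)"
proof -
  define p where "p = q ^ k"
  have p: "p \<noteq> 0" using q_nz by (simp add: p_def)
  have "(q * (q * p) - 1 / (q * (q * p))) * lam (w / (q * p))
      = (q * p - 1 / (q * p)) * lam (w / p) + d * lam (w / (q * q * p * p))"
    using assms p q_nz by (simp add: lam_def field_simps)
  then have "d ^ 4 * ((q ^ Suc (Suc k) - qi ^ Suc (Suc k)) * lam (qi ^ Suc k * w))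
      = d ^ 4 * ((q ^ Suc k - qi ^ Suc k) * lam (qi ^ k * w) + d * lam (qi ^ (2 * Suc k) * w))"
    by (simp add: p_def divide_inverse power_inverse mult_2 mult_2_right power_add ac_simps)
  then show ?thesis by (simp add: step_coeff_def algebra_simps eval_nat_numeral)
qed

lemma step_coeff_eq_0:
  assumes "w \<noteq> 0" "step_coeff w k = 0"
  shows "w\<^sup>2 = q ^ (2 * k)"
proof -
  have "q ^ Suc k - qi ^ Suc k \<noteq> 0"
  proof
    assume "q ^ Suc k - qi ^ Suc k = 0"
    then have "q ^ Suc k * q ^ Suc k = 1" using q_nz by (simp add: power_inverse field_simps)
    then have "q ^ (Suc k + Suc k) = 1" by (simp only: power_add)
    from q_pow_1[OF this] show False by simp
  qed
  then have "lam (qi ^ k * w) = 0" using assms q_diff by (simp add: step_coeff_def)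
  then have "(qi ^ k * w)\<^sup>2 = 1" using assms q_nz by (simp add: lam_0_iff)
  then show ?thesis using q_nz
    by (simp add: power_mult_distrib power_inverse field_simps flip: power_mult)
qed

lemma wt_nz: "x \<noteq> 0 \<Longrightarrow> y \<noteq> 0 \<Longrightarrow> wt h x y \<noteq> 0"
  by (simp add: wt_def)

lemma wt_step: "dir h \<Longrightarrow> wt h (qi ^ k * x) (inverse h ^ k * y) = qi ^ (2 * k) * wt h x y"
  using q_neq_qi unfolding dir_def
  by (elim disjE) (simp_all add: wt_def mult_2 mult_2_right power_add power_inverse field_simps)

lemma dir_inverse: "dir h \<Longrightarrow> dir (inverse h)"
  by (auto simp: dir_def)

lemma good_pow: "good x \<Longrightarrow> dir h \<Longrightarrow> good (h ^ k * x)"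
  by (induction k) (auto simp: dir_def mult.assoc intro: good_step)

end

context so4_rep
begin

primrec fch :: "complex \<Rightarrow> nat \<Rightarrow> complex \<Rightarrow> complex \<Rightarrow> 'v \<Rightarrow> 'v" where
  "fch h 0 x y v = v"
| "fch h (Suc k) x y v = dn (inverse h) (qi ^ k * x) (inverse h ^ k * y) (fch h k x y v)"

lemma pow_nz: "dir h \<Longrightarrow> x \<noteq> 0 \<Longrightarrow> h ^ k * x \<noteq> 0"
  using dir_nz by simp

lemma fch_K:
  assumes "v \<in> K x y" "x \<noteq> 0" "y \<noteq> 0" "dir h"
  shows "fch h k x y v \<in> K (qi ^ k * x) (inverse h ^ k * y)"
proof (induction k)
  case (Suc k)
  have "qi ^ k * x \<noteq> 0" "inverse h ^ k * y \<noteq> 0"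
    using assms pow_nz dir_inverse dir_simps(2) by blast+
  from rho_K[OF Suc dir_simps(2) dir_inverse[OF assms(4)] this] show ?case by (simp add: mult.assoc)
qed (simp add: assms)

lemma fch_lin: "fch h k x y (u + v) = fch h k x y u + fch h k x y v" "fch h k x y (r *s v) = r *s fch h k x y v"
  "fch h k x y 0 = 0" "fch h k x y (u - v) = fch h k x y u - fch h k x y v"
  by (induction k) (simp_all add: rho_lin)

lemma rho_fch_comm:
  assumes "v \<in> K x y" "x \<noteq> 0" "y \<noteq> 0" "dir h" "g \<noteq> 0" "h' \<noteq> 0"
    and comm: "\<And>x y v. v \<in> K x y \<Longrightarrow> x \<noteq> 0 \<Longrightarrow> y \<noteq> 0 \<Longrightarrow>
      rho g h' (qi * x) (inverse h * y) (dn (inverse h) x y v) = dn (inverse h) (g * x) (h' * y) (rho g h' x y v)"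
  shows "rho g h' (qi ^ k * x) (inverse h ^ k * y) (fch h k x y v) = fch h k (g * x) (h' * y) (rho g h' x y v)"
proof (induction k)
  case (Suc k)
  have nz: "qi ^ k * x \<noteq> 0" "inverse h ^ k * y \<noteq> 0"
    using assms pow_nz dir_inverse dir_simps(2) by blast+
  have "rho g h' (qi ^ Suc k * x) (inverse h ^ Suc k * y) (fch h (Suc k) x y v)
      = dn (inverse h) (g * (qi ^ k * x)) (h' * (inverse h ^ k * y)) (fch h k (g * x) (h' * y) (rho g h' x y v))"
    using comm[OF fch_K[OF assms(1-4)] nz] Suc by (simp add: mult.assoc)
  then show ?case by (simp add: mult.left_commute)
qed simp

lemma up_fch_comm:
  assumes "v \<in> K x y" "x \<noteq> 0" "y \<noteq> 0" "dir h"
  shows "up (inverse h) (qi ^ k * x) (inverse h ^ k * y) (fch h k x y v)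
    = fch h k (q * x) (inverse h * y) (up (inverse h) x y v)"
  using assms dir_nz[of h] q_nz dir_inverse
  by (intro rho_fch_comm) (auto simp: dn_up_same)

lemma dn_fch_comm:
  assumes "v \<in> K x y" "x \<noteq> 0" "y \<noteq> 0" "dir h"
  shows "dn h (qi ^ k * x) (inverse h ^ k * y) (fch h k x y v) = fch h k (qi * x) (h * y) (dn h x y v)"
  using assms dir_nz[of h] q_nz
  by (intro rho_fch_comm) (auto simp: dir_def rho_comm)

lemma fch_vanish:
  assumes "v \<in> K x y" "x \<noteq> 0" "y \<noteq> 0" "dir h"
  shows "\<exists>n. fch h n x y v = 0"
proof -
  have "\<exists>n. n \<notin> {n. lam (x / q ^ n) \<in> {l. \<exists>v. v \<noteq> 0 \<and> A v = l *s v}}"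
    using finite_chain(2)[OF AB.opA.finite_eigenvalues assms(2)] by (metis ex_new_if_finite infinite_UNIV_nat)
  then obtain n where n: "\<And>v. A v = lam (x / q ^ n) *s v \<Longrightarrow> v = 0" by auto
  have "A (fch h n x y v) = lam (x / q ^ n) *s fch h n x y v"
    using fch_K[OF assms, of n] by (simp add: K_def power_inverse divide_inverse mult.commute)
  then show ?thesis using n by blast
qed

text \<open>Induction from the highest labels down; it is founded because raising x by q leaves the
  finite spectrum of A.\<close>

lemma level_induct [consumes 3, case_names zero step]:
  assumes "w \<in> K x y" "x \<noteq> 0" "y \<noteq> 0"
    and zero: "\<And>x y. x \<noteq> 0 \<Longrightarrow> y \<noteq> 0 \<Longrightarrow> P x y 0"
    and step: "\<And>x y w. x \<noteq> 0 \<Longrightarrow> y \<noteq> 0 \<Longrightarrow> w \<in> K x y \<Longrightarrow>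
      (\<And>h w'. dir h \<Longrightarrow> w' \<in> K (q * x) (h * y) \<Longrightarrow> P (q * x) (h * y) w') \<Longrightarrow> P x y w"
  shows "P x y w"
proof -
  \<comment> \<open>From the n-th level above x onwards A has no eigenvectors; the hypothesis passes
    to q x with n lowered by one.\<close>
  have main: "P x y w" if "\<And>j v. n \<le> j \<Longrightarrow> A v = lam (x * q ^ j) *s v \<Longrightarrow> v = 0" "w \<in> K x y" "x \<noteq> 0" "y \<noteq> 0" for n x y w
    using that
  proof (induction n arbitrary: x y w)
    case 0
    from 0(1)[of 0 w] 0(2) have "w = 0" by (simp add: K_def)
    then show ?case using zero 0 by blast
  next
    case (Suc n)
    show ?case
    proof (rule step[OF Suc.prems(3,4,2)])
      fix h w' assume h: "dir h" "w' \<in> K (q * x) (h * y)"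
      show "P (q * x) (h * y) w'"
      proof (rule Suc.IH[OF _ h(2)])
        fix j v assume "n \<le> j" "A v = lam (q * x * q ^ j) *s v"
        then show "v = 0" using Suc.prems(1)[of "Suc j" v] by (simp add: ac_simps)
      qed (use h Suc.prems q_nz dir_nz in auto)
    qed
  qed
  have "finite {n. lam (x * q ^ n) \<in> {l. \<exists>v. v \<noteq> 0 \<and> A v = l *s v}}"
    by (rule finite_chain(1)[OF AB.opA.finite_eigenvalues assms(2)])
  then obtain n where "\<forall>m \<in> {n. lam (x * q ^ n) \<in> {l. \<exists>v. v \<noteq> 0 \<and> A v = l *s v}}. m < n"
    by (meson finite_nat_set_iff_bounded)
  then have "v = 0" if "n \<le> j" "A v = lam (x * q ^ j) *s v" for j v
    using that by (metis (mono_tags, lifting) leD mem_Collect_eq)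
  then show ?thesis using main assms by blast
qed

definition ladder_family :: "complex \<Rightarrow> (complex \<Rightarrow> complex \<Rightarrow> 'v set) \<Rightarrow> bool" where
  "ladder_family h S \<longleftrightarrow> (\<forall>x y. x \<noteq> 0 \<longrightarrow> y \<noteq> 0 \<longrightarrow> subspace (S x y) \<and>
     (\<forall>v \<in> S x y. up h x y v \<in> S (q * x) (h * y) \<and> dn (inverse h) x y v \<in> S (qi * x) (inverse h * y)))"

text \<open>Everything is done modulo \<open>S\<close> because \<open>w\<close> will be a vector that is killed by the raising operators
  only in a quotient.\<close>
lemma chain_mod:
  assumes S: "ladder_family h S" and h: "dir h" and w: "w \<in> K x y" "good x" "good y"
    and e: "up h x y w \<in> S (q * x) (h * y)"
    and cross: "\<And>k. dn h (q * (qi ^ k * x)) (inverse h * (inverse h ^ k * y))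
        (up (inverse h) (qi ^ k * x) (inverse h ^ k * y) (fch h k x y w)) \<in> S (qi ^ k * x) (inverse h ^ k * y)"
  shows "up h (qi ^ Suc k * x) (inverse h ^ Suc k * y) (fch h (Suc k) x y w)
      - (br (qi ^ k * x) * br (inverse h ^ Suc k * y) * step_coeff (wt h x y) k) *s fch h k x y w
      \<in> S (qi ^ k * x) (inverse h ^ k * y)"
proof -
  have xy: "x \<noteq> 0" "y \<noteq> 0" using w by (simp_all add: good_def)
  have hi: "dir (inverse h)" "inverse h \<noteq> 0" "h \<noteq> 0" using h dir_inverse dir_nz by blast+
  have nz: "qi ^ k * x \<noteq> 0" "inverse h ^ k * y \<noteq> 0" for k
    using xy hi q_nz by simp_all
  have br: "br (qi ^ k * x) \<noteq> 0" "br (inverse h ^ k * y) \<noteq> 0" for k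
    using w h hi good_pow br_nz dir_simps(2) by blast+
  have sub: "subspace (S (qi ^ k * x) (inverse h ^ k * y))" for k
    using S nz by (simp add: ladder_family_def)
  let ?u = "\<lambda>k. fch h k x y w"
  let ?b = "\<lambda>k. br (qi ^ k * x) * br (inverse h ^ Suc k * y)"
  \<comment> \<open>One application of \<open>ladder\<close> at level k: a is the normalized scalar
    by which raising followed by lowering acts on \<open>?u k\<close> modulo S, and the relation
    adds the weight at that level.\<close>
  have body: "up h (qi ^ Suc k * x) (inverse h ^ Suc k * y) (?u (Suc k)) - (?b k * (a + d ^ 5 * lam (qi ^ (2 * k) * wt h x y))) *s ?u k
      \<in> S (qi ^ k * x) (inverse h ^ k * y)"
    if "(1 / (br (q * (qi ^ k * x)) * br (inverse h ^ k * y))) *s dn (inverse h) (q * (qi ^ k * x)) (h * (inverse h ^ k * y)) (up h (qi ^ k * x) (inverse h ^ k * y) (?u k))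
        - a *s ?u k \<in> S (qi ^ k * x) (inverse h ^ k * y)" for k a
  proof -
    let ?S = "S (qi ^ k * x) (inverse h ^ k * y)"
    obtain r where r: "(1 / ?b k) *s up h (qi ^ Suc k * x) (inverse h ^ Suc k * y) (?u (Suc k))
      = (1 / (br (q * (qi ^ k * x)) * br (inverse h ^ k * y))) *s dn (inverse h) (q * (qi ^ k * x)) (h * (inverse h ^ k * y)) (up h (qi ^ k * x) (inverse h ^ k * y) (?u k))
       + (d ^ 5 * lam (qi ^ (2 * k) * wt h x y)) *s ?u k
       + r *s dn h (q * (qi ^ k * x)) (inverse h * (inverse h ^ k * y)) (up (inverse h) (qi ^ k * x) (inverse h ^ k * y) (?u k))"
      using ladder[OF fch_K[OF w(1) xy h] nz h, of k] unfolding wt_step[OF h] by (auto simp: mult.assoc)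
    have "(1 / ?b k) *s up h (qi ^ Suc k * x) (inverse h ^ Suc k * y) (?u (Suc k)) - (a + d ^ 5 * lam (qi ^ (2 * k) * wt h x y)) *s ?u k
      = ((1 / (br (q * (qi ^ k * x)) * br (inverse h ^ k * y))) *s dn (inverse h) (q * (qi ^ k * x)) (h * (inverse h ^ k * y)) (up h (qi ^ k * x) (inverse h ^ k * y) (?u k)) - a *s ?u k)
       + r *s dn h (q * (qi ^ k * x)) (inverse h * (inverse h ^ k * y)) (up (inverse h) (qi ^ k * x) (inverse h ^ k * y) (?u k))"
      unfolding r by (simp only: scale_left_distrib) (simp only: algebra_simps)
    also have "\<dots> \<in> ?S" by (intro subspace_add[OF sub] that subspace_scale[OF sub] cross)
    finally have "?b k *s ((1 / ?b k) *s up h (qi ^ Suc k * x) (inverse h ^ Suc k * y) (?u (Suc k)) - (a + d ^ 5 * lam (qi ^ (2 * k) * wt h x y)) *s ?u k) \<in> ?S"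
      by (rule subspace_scale[OF sub])
    moreover have "?b k \<noteq> 0" using br(1)[of k] br(2)[of "Suc k"] by (simp del: power_Suc)
    ultimately show ?thesis by (simp only: scale_right_diff_distrib scale_scale) simp
  qed
  show ?thesis
  proof (induction k)
    case 0
    have "dn (inverse h) (q * x) (h * y) (up h x y w) \<in> S (qi * (q * x)) (inverse h * (h * y))"
      using S e xy hi q_nz by (simp add: ladder_family_def)
    moreover have "qi * (q * x) = x" "inverse h * (h * y) = y" using q_nz hi by simp_all
    ultimately have "dn (inverse h) (q * x) (h * y) (up h x y w) \<in> S x y" by simp
    then have "up h (qi ^ Suc 0 * x) (inverse h ^ Suc 0 * y) (?u (Suc 0)) - (?b 0 * (0 + d ^ 5 * lam (qi ^ (2 * 0) * wt h x y))) *s ?u 0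
      \<in> S (qi ^ 0 * x) (inverse h ^ 0 * y)"
      using subspace_scale[OF sub[of 0]] by (intro body) simp
    then show ?case by (simp add: step_coeff_0)
  next
    case (Suc k)
    let ?c = "?b k * step_coeff (wt h x y) k" and ?S = "S (qi ^ Suc k * x) (inverse h ^ Suc k * y)"
    have lab: "q * (qi ^ Suc k * x) = qi ^ k * x" "h * (inverse h ^ Suc k * y) = inverse h ^ k * y"
      using q_nz hi by simp_all
    from Suc have "dn (inverse h) (qi ^ k * x) (inverse h ^ k * y)
       (up h (qi ^ Suc k * x) (inverse h ^ Suc k * y) (?u (Suc k)) - ?c *s ?u k) \<in> S (qi * (qi ^ k * x)) (inverse h * (inverse h ^ k * y))"
      using S nz by (simp add: ladder_family_def)
    then have "dn (inverse h) (qi ^ k * x) (inverse h ^ k * y) (up h (qi ^ Suc k * x) (inverse h ^ Suc k * y) (?u (Suc k))) - ?c *s ?u (Suc k) \<in> ?S"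
      by (simp add: rho_lin mult.assoc)
    from subspace_scale[OF sub[of "Suc k"] this, of "1 / ?b k"]
    have "(1 / ?b k) *s dn (inverse h) (qi ^ k * x) (inverse h ^ k * y) (up h (qi ^ Suc k * x) (inverse h ^ Suc k * y) (?u (Suc k)))
       - step_coeff (wt h x y) k *s ?u (Suc k) \<in> ?S"
      using br[of k] br(2)[of "Suc k"] by (simp only: scale_right_diff_distrib scale_scale) simp
    then have "(1 / (br (q * (qi ^ Suc k * x)) * br (inverse h ^ Suc k * y))) *s dn (inverse h) (q * (qi ^ Suc k * x)) (h * (inverse h ^ Suc k * y)) (up h (qi ^ Suc k * x) (inverse h ^ Suc k * y) (?u (Suc k)))
        - step_coeff (wt h x y) k *s ?u (Suc k) \<in> ?S"
      unfolding lab .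
    from body[OF this] show ?case unfolding step_coeff_Suc[OF wt_nz[OF xy]] by simp
  qed
qed

text \<open>The classical dominance argument: for the first k with f^(k+1) w in S,
  \<open>chain_mod\<close> puts a multiple of f^k w into S, so its coefficient must vanish, which
  determines the weight.\<close>

lemma dominant:
  assumes S: "ladder_family h S" and h: "dir h" and w: "w \<in> K x y" "x \<noteq> 0" "y \<noteq> 0"
    and e: "up h x y w \<in> S (q * x) (h * y)"
    and cross: "\<And>k. dn h (q * (qi ^ k * x)) (inverse h * (inverse h ^ k * y))
        (up (inverse h) (qi ^ k * x) (inverse h ^ k * y) (fch h k x y w)) \<in> S (qi ^ k * x) (inverse h ^ k * y)"
    and wS: "w \<notin> S x y"
  shows "\<exists>k. (wt h x y)\<^sup>2 = q ^ (2 * k) \<and> fch h k x y w \<notin> S (qi ^ k * x) (inverse h ^ k * y)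
     \<and> fch h (Suc k) x y w \<in> S (qi ^ Suc k * x) (inverse h ^ Suc k * y)"
proof -
  have hi: "dir (inverse h)" "inverse h \<noteq> 0" "h \<noteq> 0" using h dir_inverse dir_nz by blast+
  have nz: "qi ^ k * x \<noteq> 0" "inverse h ^ k * y \<noteq> 0" for k
    using w hi q_nz by simp_all
  have sub: "subspace (S (qi ^ k * x) (inverse h ^ k * y))" for k
    using S nz by (simp add: ladder_family_def)
  have "subspace (S x y)" using sub[of 0] by simp
  then have "w \<noteq> 0" using wS subspace_0 by blast
  then have g: "good x" "good y" using K_good w by blast+
  let ?P = "\<lambda>k. fch h k x y w \<in> S (qi ^ k * x) (inverse h ^ k * y)"
  obtain n where "fch h n x y w = 0" using fch_vanish w h by blast
  then have n: "?P n" using subspace_0[OF sub] by simp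
  define m where "m = (LEAST n. ?P n)"
  have m: "?P m" unfolding m_def using n by (rule LeastI)
  have "m \<noteq> 0" using m wS by (intro notI) simp
  then obtain k where k: "m = Suc k" by (cases m) auto
  have nk: "\<not> ?P k" using not_less_Least[of k ?P] k by (simp add: m_def)
  let ?c = "br (qi ^ k * x) * br (inverse h ^ Suc k * y) * step_coeff (wt h x y) k"
  have "up h (qi ^ Suc k * x) (inverse h ^ Suc k * y) (fch h (Suc k) x y w) \<in> S (q * (qi ^ Suc k * x)) (h * (inverse h ^ Suc k * y))"
    using S m k nz unfolding ladder_family_def by blast
  moreover have "q * (qi ^ Suc k * x) = qi ^ k * x" "h * (inverse h ^ Suc k * y) = inverse h ^ k * y"
    using q_nz hi by simp_all
  ultimately have 1: "up h (qi ^ Suc k * x) (inverse h ^ Suc k * y) (fch h (Suc k) x y w) \<in> S (qi ^ k * x) (inverse h ^ k * y)"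
    by (simp only:)
  have "?c *s fch h k x y w = up h (qi ^ Suc k * x) (inverse h ^ Suc k * y) (fch h (Suc k) x y w)
     - (up h (qi ^ Suc k * x) (inverse h ^ Suc k * y) (fch h (Suc k) x y w) - ?c *s fch h k x y w)" by simp
  also have "\<dots> \<in> S (qi ^ k * x) (inverse h ^ k * y)"
    by (intro subspace_diff[OF sub] 1 chain_mod[OF S h w(1) g e cross])
  finally have c: "?c *s fch h k x y w \<in> S (qi ^ k * x) (inverse h ^ k * y)" .
  have "?c = 0"
  proof (rule ccontr)
    assume c0: "?c \<noteq> 0"
    from subspace_scale[OF sub c, of "1 / ?c"] have "?P k" using c0 by (simp only: scale_scale) simp
    with nk show False by simp
  qed
  moreover have "br (qi ^ k * x) \<noteq> 0" "br (inverse h ^ Suc k * y) \<noteq> 0"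
    using g h hi good_pow br_nz dir_simps(2) by blast+
  ultimately have "step_coeff (wt h x y) k = 0" by (simp del: power_Suc)
  then show ?thesis using step_coeff_eq_0[OF wt_nz] w nk m k by blast
qed

section \<open>Highest weight vectors and the strings below them\<close>

lemma fch_fch:
  assumes "t \<in> K x y" "x \<noteq> 0" "y \<noteq> 0"
  shows "fch q k (qi ^ l * x) (q ^ l * y) (fch qi l x y t) = fch qi l (qi ^ k * x) (qi ^ k * y) (fch q k x y t)"
proof (induction k)
  case (Suc k)
  have nz: "qi ^ k * x \<noteq> 0" "qi ^ k * y \<noteq> 0" using assms q_nz by simp_all
  have K: "fch q k x y t \<in> K (qi ^ k * x) (qi ^ k * y)" using fch_K[OF assms, of q k] by simp
  have "fch q (Suc k) (qi ^ l * x) (q ^ l * y) (fch qi l x y t)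
      = dn qi (qi ^ l * (qi ^ k * x)) (inverse qi ^ l * (qi ^ k * y)) (fch qi l (qi ^ k * x) (qi ^ k * y) (fch q k x y t))"
    by (simp add: Suc mult.left_commute)
  also have "\<dots> = fch qi l (qi * (qi ^ k * x)) (qi * (qi ^ k * y)) (dn qi (qi ^ k * x) (qi ^ k * y) (fch q k x y t))"
    by (rule dn_fch_comm[OF K nz]) simp
  finally show ?case by (simp add: mult.assoc)
qed simp

text \<open>The coefficient is left unspecified, since later only its being nonzero away from the
  critical exponent matters; in this form the property is inherited along the other ladder.\<close>

definition ladder_vec :: "complex \<Rightarrow> complex \<Rightarrow> complex \<Rightarrow> 'v \<Rightarrow> bool" where
  "ladder_vec h x y v \<longleftrightarrow> v \<in> K x y \<and> up h x y v = 0 \<and>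
    (\<forall>k. \<exists>c. up h (qi ^ Suc k * x) (inverse h ^ Suc k * y) (fch h (Suc k) x y v) = c *s fch h k x y v
       \<and> ((wt h x y)\<^sup>2 \<noteq> q ^ (2 * k) \<longrightarrow> c \<noteq> 0))"

definition Top :: "complex \<Rightarrow> complex \<Rightarrow> 'v set" where
  "Top x y = {t \<in> K x y. up q x y t = 0 \<and> up qi x y t = 0}"

lemma Top_up: "t \<in> Top x y \<Longrightarrow> dir h \<Longrightarrow> up h x y t = 0"
  by (auto simp: Top_def dir_def)

lemma subspace_K: "subspace (K x y)"
  by (auto simp: subspace_def K_def lins scale_right_distrib scale_left_commute)

lemma subspace_Top: "subspace (Top x y)"
  using subspace_K[of x y] by (auto simp: subspace_def Top_def rho_lin)

lemma top_ladder:
  assumes t: "t \<in> Top x y" "x \<noteq> 0" "y \<noteq> 0" and h: "dir h"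
  shows "ladder_vec h x y t"
proof (cases "t = 0")
  case True
  have "\<exists>c. up h (qi ^ Suc k * x) (inverse h ^ Suc k * y) (fch h (Suc k) x y 0) = c *s fch h k x y 0
       \<and> ((wt h x y)\<^sup>2 \<noteq> q ^ (2 * k) \<longrightarrow> c \<noteq> 0)" for k
    by (intro exI[of _ 1]) (simp add: fch_lin rho_lin del: fch.simps)
  then show ?thesis using subspace_0[OF subspace_K] True by (auto simp: ladder_vec_def rho_lin)
next
  case False
  have tK: "t \<in> K x y" using t by (simp add: Top_def)
  have g: "good x" "good y" using K_good tK t False by blast+
  have hi: "dir (inverse h)" using h by (rule dir_inverse)
  have Z: "ladder_family h (\<lambda>x y. {0})" by (simp add: ladder_family_def rho_lin)
  have cross: "dn h (q * (qi ^ k * x)) (inverse h * (inverse h ^ k * y))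
        (up (inverse h) (qi ^ k * x) (inverse h ^ k * y) (fch h k x y t)) \<in> {0}" for k
    using up_fch_comm[OF tK t(2,3) h] Top_up[OF t(1) hi] by (simp add: fch_lin rho_lin)
  have e: "up h x y t \<in> {0}" using Top_up[OF t(1) h] by simp
  have "\<exists>c. up h (qi ^ Suc k * x) (inverse h ^ Suc k * y) (fch h (Suc k) x y t) = c *s fch h k x y t
       \<and> ((wt h x y)\<^sup>2 \<noteq> q ^ (2 * k) \<longrightarrow> c \<noteq> 0)" for k
  proof (intro exI conjI impI)
    let ?c = "br (qi ^ k * x) * br (inverse h ^ Suc k * y) * step_coeff (wt h x y) k"
    show "up h (qi ^ Suc k * x) (inverse h ^ Suc k * y) (fch h (Suc k) x y t) = ?c *s fch h k x y t"
      using chain_mod[OF Z h tK g e cross, of k] by simp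
    assume "(wt h x y)\<^sup>2 \<noteq> q ^ (2 * k)"
    then have "step_coeff (wt h x y) k \<noteq> 0" using step_coeff_eq_0 wt_nz t by blast
    moreover have "br (qi ^ k * x) \<noteq> 0" "br (inverse h ^ Suc k * y) \<noteq> 0"
      using g h hi good_pow br_nz dir_simps(2) by blast+
    ultimately show "?c \<noteq> 0" by (simp del: power_Suc)
  qed
  then show ?thesis using tK e by (simp add: ladder_vec_def)
qed

text \<open>The two ladders commute, so lowering a top vector along the qi-ladder changes neither
  the coefficients of its q-string nor its weight for q.\<close>

lemma string_ladder:
  assumes t: "t \<in> Top x y" "x \<noteq> 0" "y \<noteq> 0"
  shows "ladder_vec q (qi ^ l * x) (q ^ l * y) (fch qi l x y t)"
  unfolding ladder_vec_def
proof (intro conjI allI)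
  have tK: "t \<in> K x y" using t by (simp add: Top_def)
  show "fch qi l x y t \<in> K (qi ^ l * x) (q ^ l * y)" using fch_K[OF tK t(2,3), of qi l] by simp
  have up: "up q (qi ^ l * X) (q ^ l * Y) (fch qi l X Y v) = fch qi l (q * X) (q * Y) (up q X Y v)"
    if "v \<in> K X Y" "X \<noteq> 0" "Y \<noteq> 0" for v X Y
    using up_fch_comm[OF that, of qi l] by simp
  show "up q (qi ^ l * x) (q ^ l * y) (fch qi l x y t) = 0"
    using up[OF tK t(2,3)] t(1) by (simp add: Top_def fch_lin)
  fix k
  obtain c where c: "up q (qi ^ Suc k * x) (qi ^ Suc k * y) (fch q (Suc k) x y t) = c *s fch q k x y t"
    "(wt q x y)\<^sup>2 \<noteq> q ^ (2 * k) \<longrightarrow> c \<noteq> 0"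
    using top_ladder[OF t, of q] unfolding ladder_vec_def by auto
  have K: "fch q (Suc k) x y t \<in> K (qi ^ Suc k * x) (qi ^ Suc k * y)" using fch_K[OF tK t(2,3), of q "Suc k"] by simp
  have nz: "qi ^ Suc k * x \<noteq> 0" "qi ^ Suc k * y \<noteq> 0" using t q_nz by simp_all
  have lab: "q * (qi ^ Suc k * x) = qi ^ k * x" "q * (qi ^ Suc k * y) = qi ^ k * y" using q_nz by simp_all
  have "up q (qi ^ Suc k * (qi ^ l * x)) (qi ^ Suc k * (q ^ l * y)) (fch q (Suc k) (qi ^ l * x) (q ^ l * y) (fch qi l x y t))
    = up q (qi ^ l * (qi ^ Suc k * x)) (q ^ l * (qi ^ Suc k * y)) (fch qi l (qi ^ Suc k * x) (qi ^ Suc k * y) (fch q (Suc k) x y t))"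
    unfolding fch_fch[OF tK t(2,3)] by (simp only: mult.left_commute)
  also have "\<dots> = c *s fch q k (qi ^ l * x) (q ^ l * y) (fch qi l x y t)"
    unfolding up[OF K nz] c lab fch_fch[OF tK t(2,3)] fch_lin ..
  finally have "up q (qi ^ Suc k * (qi ^ l * x)) (qi ^ Suc k * (q ^ l * y)) (fch q (Suc k) (qi ^ l * x) (q ^ l * y) (fch qi l x y t))
    = c *s fch q k (qi ^ l * x) (q ^ l * y) (fch qi l x y t)" .
  moreover have "wt q (qi ^ l * x) (q ^ l * y) = wt q x y"
    using q_nz by (simp add: wt_def power_inverse)
  ultimately show "\<exists>c. up q (qi ^ Suc k * (qi ^ l * x)) (qi ^ Suc k * (q ^ l * y)) (fch q (Suc k) (qi ^ l * x) (q ^ l * y) (fch qi l x y t))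
    = c *s fch q k (qi ^ l * x) (q ^ l * y) (fch qi l x y t) \<and> ((wt q (qi ^ l * x) (q ^ l * y))\<^sup>2 \<noteq> q ^ (2 * k) \<longrightarrow> c \<noteq> 0)"
    using c(2) by auto
qed

definition strings :: "complex \<Rightarrow> (complex \<Rightarrow> complex \<Rightarrow> 'v set) \<Rightarrow> complex \<Rightarrow> complex \<Rightarrow> 'v set" where
  "strings h G x y = {fch h k x' y' t | k x' y' t. x' \<noteq> 0 \<and> y' \<noteq> 0 \<and> x = qi ^ k * x' \<and> y = inverse h ^ k * y' \<and> t \<in> G x' y'}"

abbreviation sspan :: "complex \<Rightarrow> (complex \<Rightarrow> complex \<Rightarrow> 'v set) \<Rightarrow> complex \<Rightarrow> complex \<Rightarrow> 'v set" where
  "sspan h G x y \<equiv> span (strings h G x y)"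

lemma rho_span:
  assumes "v \<in> span X" "\<And>u. u \<in> X \<Longrightarrow> rho g h x y u \<in> S" "subspace S"
  shows "rho g h x y v \<in> S"
  using assms(1)
proof (induction rule: span_induct_alt)
  case (step c u v)
  then show ?case using assms by (simp add: rho_lin subspace_add subspace_scale)
qed (use assms in \<open>simp add: rho_lin subspace_0\<close>)

lemma strings_base: "t \<in> G x y \<Longrightarrow> x \<noteq> 0 \<Longrightarrow> y \<noteq> 0 \<Longrightarrow> t \<in> strings h G x y"
  unfolding strings_def by (intro CollectI exI[of _ 0] exI[of _ x] exI[of _ y] exI[of _ t]) simp

lemma sspan_ladder_family:
  assumes G: "\<And>x y t. x \<noteq> 0 \<Longrightarrow> y \<noteq> 0 \<Longrightarrow> t \<in> G x y \<Longrightarrow> ladder_vec h x y t" and h: "dir h"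
  shows "ladder_family h (sspan h G)"
  unfolding ladder_family_def
proof (intro allI impI conjI ballI)
  fix x y :: complex and v assume xy: "x \<noteq> 0" "y \<noteq> 0" and v: "v \<in> sspan h G x y"
  have h0: "h \<noteq> 0" using h dir_nz by blast
  show "up h x y v \<in> sspan h G (q * x) (h * y)"
  proof (rule rho_span[OF v])
    fix u assume "u \<in> strings h G x y"
    then obtain k x' y' t where *: "u = fch h k x' y' t" "x' \<noteq> 0" "y' \<noteq> 0" "x = qi ^ k * x'" "y = inverse h ^ k * y'" "t \<in> G x' y'"
      unfolding strings_def by blast
    note L = G[OF *(2,3,6)]
    show "up h x y u \<in> sspan h G (q * x) (h * y)"
    proof (cases k)
      case 0
      then show ?thesis using * L by (simp add: ladder_vec_def span_zero)
    next
      case (Suc m)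
      obtain c where "up h x y u = c *s fch h m x' y' t" using L unfolding ladder_vec_def * Suc by blast
      moreover have "q * x = qi ^ m * x'" "h * y = inverse h ^ m * y'" using q_nz h0 by (simp_all add: * Suc)
      then have "fch h m x' y' t \<in> strings h G (q * x) (h * y)" unfolding strings_def using * by blast
      ultimately show ?thesis by (simp add: span_scale span_base)
    qed
  qed simp
  show "dn (inverse h) x y v \<in> sspan h G (qi * x) (inverse h * y)"
  proof (rule rho_span[OF v])
    fix u assume "u \<in> strings h G x y"
    then obtain k x' y' t where *: "u = fch h k x' y' t" "x' \<noteq> 0" "y' \<noteq> 0" "x = qi ^ k * x'" "y = inverse h ^ k * y'" "t \<in> G x' y'"
      unfolding strings_def by blast
    then have "dn (inverse h) x y u = fch h (Suc k) x' y' t" "qi * x = qi ^ Suc k * x'" "inverse h * y = inverse h ^ Suc k * y'"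
      by simp_all
    then have "dn (inverse h) x y u \<in> strings h G (qi * x) (inverse h * y)" unfolding strings_def using * by blast
    then show "dn (inverse h) x y u \<in> sspan h G (qi * x) (inverse h * y)" by (rule span_base)
  qed simp
qed simp

text \<open>A string element at (q x, h y) lies k steps below a generator whose weight is q^(2(k+1))
  times that of (x, y). As the latter is dominant, the generator's exponent exceeds k, so the
  coefficient of the raising step is nonzero and can be divided out.\<close>

lemma sspan_surj:
  assumes G: "\<And>x y t. x \<noteq> 0 \<Longrightarrow> y \<noteq> 0 \<Longrightarrow> t \<in> G x y \<Longrightarrow> ladder_vec h x y t" and h: "dir h"
    and xy: "x \<noteq> 0" "y \<noteq> 0" and wt: "(wt h x y)\<^sup>2 = q ^ (2 * n)"
    and u: "u \<in> sspan h G (q * x) (h * y)"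
  shows "\<exists>s\<in>sspan h G x y. up h x y s = u"
  using u
proof (induction rule: span_induct_alt)
  case base
  then show ?case by (intro bexI[of _ 0]) (simp_all add: rho_lin span_zero)
next
  case (step r u v)
  have h0: "h \<noteq> 0" using h dir_nz by blast
  from step(2) obtain s where s: "s \<in> sspan h G x y" "up h x y s = v" by blast
  from step(1) obtain k x' y' t where *: "u = fch h k x' y' t" "x' \<noteq> 0" "y' \<noteq> 0" "q * x = qi ^ k * x'" "h * y = inverse h ^ k * y'" "t \<in> G x' y'"
    unfolding strings_def by blast
  have lab: "x = qi ^ Suc k * x'" "y = inverse h ^ Suc k * y'"
  proof -
    have "x = qi * (q * x)" "y = inverse h * (h * y)" using q_nz h0 by simp_all
    then show "x = qi ^ Suc k * x'" "y = inverse h ^ Suc k * y'" unfolding *(4,5) by simp_all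
  qed
  obtain c where c: "up h x y (fch h (Suc k) x' y' t) = c *s fch h k x' y' t" "(wt h x' y')\<^sup>2 \<noteq> q ^ (2 * k) \<longrightarrow> c \<noteq> 0"
    using G[OF *(2,3,6)] unfolding ladder_vec_def lab by blast
  have "wt h x y = qi ^ (2 * Suc k) * wt h x' y'" unfolding lab by (rule wt_step[OF h])
  then have "wt h x' y' = q ^ (2 * Suc k) * wt h x y" by (simp only: AB.P.q_pow)
  then have "(wt h x' y')\<^sup>2 = q ^ (2 * (2 * Suc k + n))"
    by (simp only: power_mult_distrib wt power_mult[symmetric] power_add[symmetric]) (simp add: algebra_simps)
  moreover have "q ^ (2 * (2 * Suc k + n)) \<noteq> q ^ (2 * k)" using q_pow_inj[of "2 * (2 * Suc k + n)" "2 * k"] by auto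
  ultimately have c0: "c \<noteq> 0" using c(2) by simp
  have "fch h (Suc k) x' y' t \<in> strings h G x y" unfolding strings_def using lab * by blast
  then have "(r / c) *s fch h (Suc k) x' y' t + s \<in> sspan h G x y" by (intro span_add span_scale s(1) span_base)
  moreover have "up h x y ((r / c) *s fch h (Suc k) x' y' t + s) = r *s u + v"
    unfolding rho_lin c(1) s(2) *(1) using c0 by simp
  ultimately show ?case by blast
qed

section \<open>Systems of subspaces stable under all four ladder operators\<close>

definition family :: "(complex \<Rightarrow> complex \<Rightarrow> 'v set) \<Rightarrow> bool" where
  "family W \<longleftrightarrow> (\<forall>x y. x \<noteq> 0 \<longrightarrow> y \<noteq> 0 \<longrightarrow> subspace (W x y) \<and> W x y \<subseteq> K x y \<and>
     (\<forall>g h. \<forall>v\<in>W x y. dir g \<longrightarrow> dir h \<longrightarrow> rho g h x y v \<in> W (g * x) (h * y)))"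

lemma familyD:
  assumes "family W" "x \<noteq> 0" "y \<noteq> 0"
  shows "subspace (W x y)" "v \<in> W x y \<Longrightarrow> v \<in> K x y"
    "v \<in> W x y \<Longrightarrow> dir g \<Longrightarrow> dir h \<Longrightarrow> rho g h x y v \<in> W (g * x) (h * y)"
  using assms unfolding family_def by blast+

lemma family_ladder: "family W \<Longrightarrow> dir h \<Longrightarrow> ladder_family h W"
  using dir_inverse unfolding family_def ladder_family_def by (metis dir_simps)

lemma fch_family:
  assumes W: "family W" and "x \<noteq> 0" "y \<noteq> 0" "dir h" "v \<in> W x y"
  shows "fch h k x y v \<in> W (qi ^ k * x) (inverse h ^ k * y)"
proof (induction k)
  case (Suc k)
  have "qi ^ k * x \<noteq> 0" "inverse h ^ k * y \<noteq> 0"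
    using assms pow_nz dir_inverse dir_simps(2) by blast+
  from familyD(3)[OF W this Suc dir_simps(2) dir_inverse[OF assms(4)]] show ?case by (simp add: mult.assoc)
qed (simp add: assms)

lemma sspan_family:
  assumes W: "family W" and "x \<noteq> 0" "y \<noteq> 0" "dir h" and G: "\<And>x y. x \<noteq> 0 \<Longrightarrow> y \<noteq> 0 \<Longrightarrow> G x y \<subseteq> W x y"
  shows "sspan h G x y \<subseteq> W x y"
proof (rule span_minimal)
  show "strings h G x y \<subseteq> W x y"
    using fch_family[OF W _ _ \<open>dir h\<close>] G unfolding strings_def by blast
qed (use familyD(1)[OF W] assms in blast)

definition G0 :: "(complex \<Rightarrow> complex \<Rightarrow> 'v set) \<Rightarrow> complex \<Rightarrow> complex \<Rightarrow> 'v set" where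
  "G0 W x y = Top x y \<inter> W x y"

text \<open>Top vectors of W lowered along the qi-ladder; taken as generators for the q-ladder, they
  make \<open>sspan q (G1 W)\<close> the span of the double strings.\<close>

definition G1 :: "(complex \<Rightarrow> complex \<Rightarrow> 'v set) \<Rightarrow> complex \<Rightarrow> complex \<Rightarrow> 'v set" where
  "G1 W = strings qi (G0 W)"

lemma G0_ladder: "x \<noteq> 0 \<Longrightarrow> y \<noteq> 0 \<Longrightarrow> t \<in> G0 W x y \<Longrightarrow> ladder_vec qi x y t"
  by (auto simp: G0_def intro: top_ladder)

lemma G1_ladder: "x \<noteq> 0 \<Longrightarrow> y \<noteq> 0 \<Longrightarrow> t \<in> G1 W x y \<Longrightarrow> ladder_vec q x y t"
  by (auto simp: G0_def G1_def strings_def intro: string_ladder)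

lemma G0_surj:
  assumes "x \<noteq> 0" "y \<noteq> 0" "(wt qi x y)\<^sup>2 = q ^ (2 * n)" "u \<in> span (G1 W (q * x) (qi * y))"
  shows "\<exists>s\<in>span (G1 W x y). up qi x y s = u"
  using assms unfolding G1_def by (intro sspan_surj) (blast intro: G0_ladder | simp)+

lemma G1_surj:
  assumes "x \<noteq> 0" "y \<noteq> 0" "(wt q x y)\<^sup>2 = q ^ (2 * n)" "u \<in> sspan q (G1 W) (q * x) (q * y)"
  shows "\<exists>s\<in>sspan q (G1 W) x y. up q x y s = u"
  using assms by (intro sspan_surj) (blast intro: G1_ladder | simp)+

lemma G1_W: "family W \<Longrightarrow> x \<noteq> 0 \<Longrightarrow> y \<noteq> 0 \<Longrightarrow> span (G1 W x y) \<subseteq> W x y"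
  unfolding G1_def by (rule sspan_family) (auto simp: G0_def)

lemma G1_up: "x \<noteq> 0 \<Longrightarrow> y \<noteq> 0 \<Longrightarrow> v \<in> span (G1 W x y) \<Longrightarrow> up q x y v = 0"
  using rho_span[of v "G1 W x y" q q x y "{0}"] G1_ladder[of x y _ W] by (auto simp: ladder_vec_def)

text \<open>Were w missing at a highest label, \<open>dominant\<close> for the qi-ladder would make
  its weight dominant. Then \<open>G0_surj\<close> gives s in the span with the same image under
  \<open>up qi\<close>, and w - s is a top vector, hence in the span.\<close>

lemma kernel_spanned:
  assumes W: "family W" and w: "w \<in> W x y" "x \<noteq> 0" "y \<noteq> 0" "up q x y w = 0"
  shows "w \<in> span (G1 W x y)"
proof -
  have "w \<in> K x y" using familyD(2)[OF W] w by blast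
  then have "w \<in> W x y \<longrightarrow> up q x y w = 0 \<longrightarrow> w \<in> span (G1 W x y)" using w(2,3)
  proof (induction rule: level_induct)
    case (step x y w)
    show ?case
    proof (intro impI, rule ccontr)
      assume w: "w \<in> W x y" "up q x y w = 0" and nS: "w \<notin> span (G1 W x y)"
      note xy = \<open>x \<noteq> 0\<close> \<open>y \<noteq> 0\<close>
      have nz: "q * x \<noteq> 0" "qi * y \<noteq> 0" using xy q_nz by simp_all
      have eW: "up qi x y w \<in> W (q * x) (qi * y)" using familyD(3)[OF W xy w(1)] by simp
      have "up q (q * x) (qi * y) (up qi x y w) = 0"
        using rho_comm[OF \<open>w \<in> K x y\<close> xy, of q] w by (simp add: rho_lin)
      then have e: "up qi x y w \<in> sspan qi (G0 W) (q * x) (qi * y)"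
        using step.IH[of qi "up qi x y w"] eW familyD(2)[OF W nz] by (simp add: G1_def)
      have "\<exists>k. (wt qi x y)\<^sup>2 = q ^ (2 * k) \<and> fch qi k x y w \<notin> sspan qi (G0 W) (qi ^ k * x) (inverse qi ^ k * y)
         \<and> fch qi (Suc k) x y w \<in> sspan qi (G0 W) (qi ^ Suc k * x) (inverse qi ^ Suc k * y)"
      proof (rule dominant[OF sspan_ladder_family[OF G0_ladder[where W = W]] _ \<open>w \<in> K x y\<close> xy e])
        fix k
        have "up (inverse qi) (qi ^ k * x) (inverse qi ^ k * y) (fch qi k x y w) = 0"
          using up_fch_comm[OF \<open>w \<in> K x y\<close> xy, of qi k] w by (simp add: fch_lin)
        then show "dn qi (q * (qi ^ k * x)) (inverse qi * (inverse qi ^ k * y)) (up (inverse qi) (qi ^ k * x) (inverse qi ^ k * y) (fch qi k x y w))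
          \<in> sspan qi (G0 W) (qi ^ k * x) (inverse qi ^ k * y)" by (simp add: rho_lin span_zero)
        show "w \<notin> sspan qi (G0 W) x y" using nS by (simp add: G1_def)
      qed simp_all
      then obtain n where n: "(wt qi x y)\<^sup>2 = q ^ (2 * n)" by blast
      from G0_surj[OF xy n e[folded G1_def]] obtain s where s: "s \<in> span (G1 W x y)" "up qi x y s = up qi x y w" ..
      have "w - s \<in> W x y" using s(1) G1_W[OF W xy] w subspace_diff[OF familyD(1)[OF W xy]] by blast
      moreover have "w - s \<in> Top x y"
        using G1_up[OF xy s(1)] s w calculation familyD(2)[OF W xy] by (simp add: Top_def rho_lin)
      ultimately have "w - s \<in> G1 W x y" unfolding G1_def by (intro strings_base xy) (simp add: G0_def)
      then have "(w - s) + s \<in> span (G1 W x y)" by (intro span_add s span_base)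
      with nS show False by simp
    qed
  qed (simp add: span_zero)
  then show ?thesis using w by blast
qed

lemma sspan_G1_dn:
  assumes "v \<in> sspan q (G1 W) x y" "x \<noteq> 0" "y \<noteq> 0"
  shows "dn q x y v \<in> sspan q (G1 W) (qi * x) (q * y)"
proof (rule rho_span[OF assms(1)])
  fix u assume "u \<in> strings q (G1 W) x y"
  then obtain k x' y' t where *: "u = fch q k x' y' t" "x' \<noteq> 0" "y' \<noteq> 0" "x = qi ^ k * x'" "y = qi ^ k * y'" "t \<in> G1 W x' y'"
    unfolding strings_def by auto
  then have tK: "t \<in> K x' y'" using G1_ladder by (auto simp: ladder_vec_def)
  have "dn q x' y' t \<in> G1 W (qi * x') (q * y')"
  proof -
    from *(6) obtain l x2 y2 r where r: "t = fch qi l x2 y2 r" "x2 \<noteq> 0" "y2 \<noteq> 0" "x' = qi ^ l * x2" "y' = q ^ l * y2" "r \<in> G0 W x2 y2"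
      unfolding G1_def strings_def by auto
    then have "dn q x' y' t = fch qi (Suc l) x2 y2 r" "qi * x' = qi ^ Suc l * x2" "q * y' = inverse qi ^ Suc l * y2" by simp_all
    then show ?thesis unfolding G1_def strings_def using r by blast
  qed
  moreover have "dn q x y u = fch q k (qi * x') (q * y') (dn q x' y' t)"
    using dn_fch_comm[OF tK *(2,3), of q k] * by simp
  moreover have "qi * x = qi ^ k * (qi * x')" "q * y = inverse q ^ k * (q * y')" using * by simp_all
  moreover have "qi * x' \<noteq> 0" "q * y' \<noteq> 0" using * q_nz by simp_all
  ultimately have "dn q x y u \<in> strings q (G1 W) (qi * x) (q * y)" unfolding strings_def by blast
  then show "dn q x y u \<in> sspan q (G1 W) (qi * x) (q * y)" by (rule span_base)
qed simp

lemma sspan_G1_fch: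
  assumes "v \<in> sspan q (G1 W) x y" "x \<noteq> 0" "y \<noteq> 0"
  shows "fch q k x y v \<in> sspan q (G1 W) (qi ^ k * x) (qi ^ k * y)"
proof (induction k)
  case (Suc k)
  have L: "ladder_family q (sspan q (G1 W))" by (rule sspan_ladder_family[OF G1_ladder[where W = W]]) simp_all
  have "qi ^ k * x \<noteq> 0" "qi ^ k * y \<noteq> 0" using assms q_nz by simp_all
  then have "dn qi (qi ^ k * x) (qi ^ k * y) (fch q k x y v) \<in> sspan q (G1 W) (qi * (qi ^ k * x)) (qi * (qi ^ k * y))"
    using L Suc unfolding ladder_family_def by blast
  then show ?case by (simp add: mult.assoc)
qed (simp add: assms)

text \<open>The same scheme for the q-ladder: after the correction the difference lies in the kernel
  of \<open>up q\<close>, which is already covered. Hence a family is determined by its top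
  vectors.\<close>

lemma family_spanned:
  assumes W: "family W" and w: "w \<in> W x y" "x \<noteq> 0" "y \<noteq> 0"
  shows "w \<in> sspan q (G1 W) x y"
proof -
  have "w \<in> K x y" using familyD(2)[OF W] w by blast
  then have "w \<in> W x y \<longrightarrow> w \<in> sspan q (G1 W) x y" using w(2,3)
  proof (induction rule: level_induct)
    case (step x y w)
    show ?case
    proof (intro impI, rule ccontr)
      let ?S = "sspan q (G1 W)"
      assume w: "w \<in> W x y" and nS: "w \<notin> ?S x y"
      note xy = \<open>x \<noteq> 0\<close> \<open>y \<noteq> 0\<close>
      have nz: "q * x \<noteq> 0" "qi * y \<noteq> 0" "q * y \<noteq> 0" using xy q_nz by simp_all
      have L: "ladder_family q ?S" by (rule sspan_ladder_family[OF G1_ladder[where W = W]]) simp_all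
      have e: "up h x y w \<in> ?S (q * x) (h * y)" if "dir h" for h
        using familyD(3)[OF W xy w(1), of q h] familyD(2)[OF W nz(1), of "h * y"] step.IH[OF that, of "up h x y w"] that xy dir_nz by simp
      have "\<exists>k. (wt q x y)\<^sup>2 = q ^ (2 * k) \<and> fch q k x y w \<notin> ?S (qi ^ k * x) (inverse q ^ k * y)
         \<and> fch q (Suc k) x y w \<in> ?S (qi ^ Suc k * x) (inverse q ^ Suc k * y)"
      proof (rule dominant[OF L _ \<open>w \<in> K x y\<close> xy e _ nS])
        fix k
        have n2: "q * (qi ^ k * x) \<noteq> 0" "qi * (qi ^ k * y) \<noteq> 0" using xy q_nz by simp_all
        have "up qi (qi ^ k * x) (qi ^ k * y) (fch q k x y w) \<in> ?S (qi ^ k * (q * x)) (qi ^ k * (qi * y))"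
          using up_fch_comm[OF \<open>w \<in> K x y\<close> xy, of q k] sspan_G1_fch[OF e nz(1,2)] by simp
        then have "up qi (qi ^ k * x) (qi ^ k * y) (fch q k x y w) \<in> ?S (q * (qi ^ k * x)) (qi * (qi ^ k * y))"
          by (simp only: mult.left_commute)
        from sspan_G1_dn[OF this n2]
        have "dn q (q * (qi ^ k * x)) (qi * (qi ^ k * y)) (up qi (qi ^ k * x) (qi ^ k * y) (fch q k x y w)) \<in> ?S (qi * (q * (qi ^ k * x))) (q * (qi * (qi ^ k * y)))" .
        moreover have "qi * (q * (qi ^ k * x)) = qi ^ k * x" "q * (qi * (qi ^ k * y)) = qi ^ k * y" using q_nz by simp_all
        ultimately show "dn q (q * (qi ^ k * x)) (qi * (qi ^ k * y)) (up qi (qi ^ k * x) (qi ^ k * y) (fch q k x y w)) \<in> ?S (qi ^ k * x) (qi ^ k * y)"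
          by (simp only:)
      qed simp_all
      then obtain n where n: "(wt q x y)\<^sup>2 = q ^ (2 * n)" by blast
      from G1_surj[OF xy n e[of q]] obtain s where s: "s \<in> ?S x y" "up q x y s = up q x y w" by auto
      have "G1 W x y \<subseteq> W x y" if "x \<noteq> 0" "y \<noteq> 0" for x y using G1_W[OF W that] span_superset by blast
      then have "?S x y \<subseteq> W x y" using xy by (intro sspan_family W) simp_all
      then have "w - s \<in> W x y" using s(1) w subspace_diff[OF familyD(1)[OF W xy]] by blast
      moreover have "up q x y (w - s) = 0" using s(2) by (simp add: rho_lin)
      ultimately have "w - s \<in> span (G1 W x y)" using kernel_spanned[OF W _ xy] by blast
      moreover have "span (G1 W x y) \<subseteq> ?S x y" using strings_base[of _ "G1 W" x y q] xy by (intro span_mono) blast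
      ultimately have "(w - s) + s \<in> ?S x y" using s(1) by (intro span_add) auto
      with nS show False by simp
    qed
  qed (simp add: span_zero)
  then show ?thesis using w by blast
qed

text \<open>Two corrections in turn: the first makes \<open>up q\<close> vanish; the second is
  chosen in \<open>span (G1 W x y)\<close>, which \<open>up q\<close> kills, so it removes
  \<open>up qi\<close> without spoiling the first.\<close>

lemma correction:
  assumes W: "family W" and w: "w \<in> K x y" "x \<noteq> 0" "y \<noteq> 0" "w \<notin> W x y"
    and e: "up q x y w \<in> W (q * x) (q * y)" "up qi x y w \<in> W (q * x) (qi * y)"
  shows "\<exists>s\<in>W x y. w - s \<in> Top x y"
proof -
  note xy = w(2,3)
  have nz: "q * x \<noteq> 0" "qi * y \<noteq> 0" "q * y \<noteq> 0" using xy q_nz by simp_all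
  have sub: "subspace (W x y)" using familyD(1)[OF W xy] .
  have G1W: "G1 W x y \<subseteq> W x y" if "x \<noteq> 0" "y \<noteq> 0" for x y using G1_W[OF W that] span_superset by blast
  have "\<exists>k. (wt q x y)\<^sup>2 = q ^ (2 * k) \<and> fch q k x y w \<notin> W (qi ^ k * x) (inverse q ^ k * y)
         \<and> fch q (Suc k) x y w \<in> W (qi ^ Suc k * x) (inverse q ^ Suc k * y)"
  proof (rule dominant[OF family_ladder[OF W] _ w(1) xy e(1) _ w(4)])
    fix k
    have n2: "q * (qi ^ k * x) \<noteq> 0" "qi * (qi ^ k * y) \<noteq> 0" using xy q_nz by simp_all
    have "up qi (qi ^ k * x) (qi ^ k * y) (fch q k x y w) \<in> W (qi ^ k * (q * x)) (qi ^ k * (qi * y))"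
      using up_fch_comm[OF w(1) xy, of q k] fch_family[OF W nz(1,2) _ e(2), of q k] by simp
    then have "up qi (qi ^ k * x) (qi ^ k * y) (fch q k x y w) \<in> W (q * (qi ^ k * x)) (qi * (qi ^ k * y))"
      by (simp only: mult.left_commute)
    from familyD(3)[OF W n2 this, of qi q]
    have "dn q (q * (qi ^ k * x)) (qi * (qi ^ k * y)) (up qi (qi ^ k * x) (qi ^ k * y) (fch q k x y w)) \<in> W (qi * (q * (qi ^ k * x))) (q * (qi * (qi ^ k * y)))"
      by simp
    moreover have "qi * (q * (qi ^ k * x)) = qi ^ k * x" "q * (qi * (qi ^ k * y)) = qi ^ k * y" using q_nz by simp_all
    ultimately show "dn q (q * (qi ^ k * x)) (qi * (qi ^ k * y)) (up qi (qi ^ k * x) (qi ^ k * y) (fch q k x y w)) \<in> W (qi ^ k * x) (qi ^ k * y)"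
      by (simp only:)
  qed simp_all
  then obtain n where n: "(wt q x y)\<^sup>2 = q ^ (2 * n)" by blast
  from G1_surj[OF xy n family_spanned[OF W e(1) nz(1,3)]]
  obtain s where s: "s \<in> sspan q (G1 W) x y" "up q x y s = up q x y w" ..
  have sW: "s \<in> W x y" using s(1) sspan_family[OF W xy dir_simps(1) G1W] by auto
  let ?w = "w - s"
  have sK: "s \<in> K x y" using familyD(2)[OF W xy sW] .
  have w': "?w \<in> K x y" "?w \<notin> W x y" "up q x y ?w = 0"
    using w sW sK subspace_diff[OF subspace_K] subspace_add[OF sub, of "w - s" s] s by (auto simp: rho_lin)
  have e': "up qi x y ?w \<in> W (q * x) (qi * y)"
    using e(2) familyD(3)[OF W xy sW, of q qi] subspace_diff[OF familyD(1)[OF W nz(1,2)]] by (simp add: rho_lin)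
  have "up q (q * x) (qi * y) (up qi x y ?w) = 0"
    using rho_comm[OF w'(1) xy, of q] w'(3) by (simp add: rho_lin)
  then have e2: "up qi x y ?w \<in> span (G1 W (q * x) (qi * y))"
    by (rule kernel_spanned[OF W e' nz(1,2)])
  have "\<exists>k. (wt qi x y)\<^sup>2 = q ^ (2 * k) \<and> fch qi k x y ?w \<notin> W (qi ^ k * x) (inverse qi ^ k * y)
         \<and> fch qi (Suc k) x y ?w \<in> W (qi ^ Suc k * x) (inverse qi ^ Suc k * y)"
  proof (rule dominant[OF family_ladder[OF W] _ w'(1) xy e' _ w'(2)])
    fix k
    have n3: "qi ^ k * x \<noteq> 0" "inverse qi ^ k * y \<noteq> 0" using xy q_nz by simp_all
    have "up (inverse qi) (qi ^ k * x) (inverse qi ^ k * y) (fch qi k x y ?w) = 0"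
      using up_fch_comm[OF w'(1) xy, of qi k] w'(3) by (simp add: fch_lin)
    then show "dn qi (q * (qi ^ k * x)) (inverse qi * (inverse qi ^ k * y)) (up (inverse qi) (qi ^ k * x) (inverse qi ^ k * y) (fch qi k x y ?w))
      \<in> W (qi ^ k * x) (inverse qi ^ k * y)" using subspace_0[OF familyD(1)[OF W n3]] by (simp add: rho_lin)
  qed simp_all
  then obtain m where m: "(wt qi x y)\<^sup>2 = q ^ (2 * m)" by blast
  from G0_surj[OF xy m e2] obtain r where r: "r \<in> span (G1 W x y)" "up qi x y r = up qi x y ?w" ..
  have rW: "r \<in> W x y" using r(1) G1_W[OF W xy] by blast
  have "w - (s + r) \<in> Top x y"
    using w(1) w'(3) r G1_up[OF xy r(1)] sK familyD(2)[OF W xy rW] subspace_diff[OF subspace_K] subspace_add[OF subspace_K]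
    by (simp add: Top_def rho_lin)
  then show ?thesis using subspace_add[OF sub sW rW] by blast
qed

end

section \<open>Complements\<close>

context so4_rep
begin

lemma family_sum:
  assumes "family M" "family N"
  shows "family (\<lambda>x y. {m + n | m n. m \<in> M x y \<and> n \<in> N x y})"
  unfolding family_def
proof (intro allI impI conjI ballI)
  fix x y :: complex assume xy: "x \<noteq> 0" "y \<noteq> 0"
  note M = familyD[OF assms(1) xy] and N = familyD[OF assms(2) xy]
  show "subspace {m + n | m n. m \<in> M x y \<and> n \<in> N x y}"
    using subspace_sums[OF M(1) N(1)] by simp
  show "{m + n | m n. m \<in> M x y \<and> n \<in> N x y} \<subseteq> K x y"
    using M(2) N(2) subspace_add[OF subspace_K] by blast
  fix g h v assume "v \<in> {m + n | m n. m \<in> M x y \<and> n \<in> N x y}" "dir g" "dir h"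
  then show "rho g h x y v \<in> {m + n | m n. m \<in> M (g * x) (h * y) \<and> n \<in> N (g * x) (h * y)}"
    using M(3) N(3) rho_lin(1) by blast
qed

lemma family_Int:
  assumes "family M" "family N"
  shows "family (\<lambda>x y. M x y \<inter> N x y)"
  using assms unfolding family_def by (auto intro: subspace_inter)

lemma family_zero: "family (\<lambda>x y. {0})"
  using subspace_0[OF subspace_K] by (auto simp: family_def rho_lin)

lemma sspan_G1_up:
  assumes "v \<in> sspan q (G1 W) x y" "x \<noteq> 0" "y \<noteq> 0"
  shows "up qi x y v \<in> sspan q (G1 W) (q * x) (qi * y)"
proof (rule rho_span[OF assms(1)])
  fix u assume "u \<in> strings q (G1 W) x y"
  then obtain k x' y' t where *: "u = fch q k x' y' t" "x' \<noteq> 0" "y' \<noteq> 0" "x = qi ^ k * x'" "y = qi ^ k * y'" "t \<in> G1 W x' y'"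
    unfolding strings_def by auto
  then have tK: "t \<in> K x' y'" using G1_ladder by (auto simp: ladder_vec_def)
  have nz: "q * x' \<noteq> 0" "qi * y' \<noteq> 0" using * q_nz by simp_all
  have L: "ladder_family qi (sspan qi (G0 W))"
    by (rule sspan_ladder_family) (auto intro: G0_ladder)
  have "t \<in> sspan qi (G0 W) x' y'" using *(6) unfolding G1_def by (rule span_base)
  then have "up qi x' y' t \<in> span (G1 W (q * x') (qi * y'))"
    using L *(2,3) unfolding ladder_family_def G1_def by blast
  moreover have "span (G1 W (q * x') (qi * y')) \<subseteq> sspan q (G1 W) (q * x') (qi * y')"
    using strings_base[of _ "G1 W" "q * x'" "qi * y'" q] nz by (intro span_mono) blast
  ultimately have "fch q k (q * x') (qi * y') (up qi x' y' t) \<in> sspan q (G1 W) (qi ^ k * (q * x')) (qi ^ k * (qi * y'))"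
    using nz by (intro sspan_G1_fch) auto
  moreover have "up qi x y u = fch q k (q * x') (qi * y') (up qi x' y' t)"
    using up_fch_comm[OF tK *(2,3), of q k] * by simp
  moreover have "qi ^ k * (q * x') = q * x" "qi ^ k * (qi * y') = qi * y" using * by simp_all
  ultimately show "up qi x y u \<in> sspan q (G1 W) (q * x) (qi * y)" by simp
qed simp

text \<open>Stability comes from the top vectors alone, W being an arbitrary system of sets; this
  permits adjoining what a single top vector generates.\<close>

lemma family_sspan_G1: "family (sspan q (G1 W))"
  unfolding family_def
proof (intro allI impI conjI ballI)
  fix x y :: complex assume xy: "x \<noteq> 0" "y \<noteq> 0"
  have "strings q (G1 W) x y \<subseteq> K x y"
  proof
    fix u assume "u \<in> strings q (G1 W) x y"
    then obtain k x' y' t where *: "u = fch q k x' y' t" "x' \<noteq> 0" "y' \<noteq> 0" "x = qi ^ k * x'" "y = inverse q ^ k * y'" "t \<in> G1 W x' y'"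
      unfolding strings_def by auto
    then have "t \<in> K x' y'" using G1_ladder by (auto simp: ladder_vec_def)
    from fch_K[OF this *(2,3), of q k] show "u \<in> K x y" using * by simp
  qed
  then show "sspan q (G1 W) x y \<subseteq> K x y" by (intro span_minimal subspace_K)
  fix g h v assume v: "v \<in> sspan q (G1 W) x y" and d: "dir g" "dir h"
  have L: "ladder_family q (sspan q (G1 W))"
    by (rule sspan_ladder_family) (auto intro: G1_ladder)
  from d consider "g = q" "h = q" | "g = q" "h = qi" | "g = qi" "h = q" | "g = qi" "h = qi"
    by (auto simp: dir_def)
  then show "rho g h x y v \<in> sspan q (G1 W) (g * x) (h * y)"
    using L xy v sspan_G1_up[OF v xy] sspan_G1_dn[OF v xy] unfolding ladder_family_def by cases auto
qed simp

lemma top_dominant: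
  assumes t: "t \<in> Top x y" "x \<noteq> 0" "y \<noteq> 0" "t \<noteq> 0" and h: "dir h"
  shows "\<exists>k. (wt h x y)\<^sup>2 = q ^ (2 * k)"
proof -
  have tK: "t \<in> K x y" using t by (simp add: Top_def)
  have "\<exists>k. (wt h x y)\<^sup>2 = q ^ (2 * k) \<and> fch h k x y t \<notin> {0} \<and> fch h (Suc k) x y t \<in> {0}"
  proof (rule dominant[OF family_ladder[OF family_zero h] h tK t(2,3)])
    show "up h x y t \<in> {0}" using Top_up[OF t(1) h] by simp
    fix k
    show "dn h (q * (qi ^ k * x)) (inverse h * (inverse h ^ k * y))
        (up (inverse h) (qi ^ k * x) (inverse h ^ k * y) (fch h k x y t)) \<in> {0}"
      using up_fch_comm[OF tK t(2,3) h] Top_up[OF t(1) dir_inverse[OF h]] by (simp add: fch_lin rho_lin)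
  qed (use t in simp)
  then show ?thesis by blast
qed

text \<open>Were the vector nonzero, its own weight would be dominant, and the vanishing of its
  raising would give the head v the squared weight q^(2k). But the weight of v is q^(2(k+1)) times a
  dominant one, so the exponents disagree.\<close>

lemma no_lower_top:
  assumes v: "ladder_vec h x y v" "x \<noteq> 0" "y \<noteq> 0" and h: "dir h"
    and top: "fch h (Suc k) x y v \<in> Top (qi ^ Suc k * x) (inverse h ^ Suc k * y)"
  shows "fch h (Suc k) x y v = 0"
proof (rule ccontr)
  assume nz: "fch h (Suc k) x y v \<noteq> 0"
  have l: "qi ^ Suc k * x \<noteq> 0" "inverse h ^ Suc k * y \<noteq> 0"
    using v h pow_nz dir_inverse dir_simps(2) by blast+
  obtain n where n: "(wt h (qi ^ Suc k * x) (inverse h ^ Suc k * y))\<^sup>2 = q ^ (2 * n)"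
    using top_dominant[OF top l nz h] by blast
  obtain c where c: "up h (qi ^ Suc k * x) (inverse h ^ Suc k * y) (fch h (Suc k) x y v) = c *s fch h k x y v"
    "(wt h x y)\<^sup>2 \<noteq> q ^ (2 * k) \<longrightarrow> c \<noteq> 0" using v(1) unfolding ladder_vec_def by blast
  have "c *s fch h k x y v = 0" using c(1) Top_up[OF top h] by simp
  moreover have "fch h k x y v \<noteq> 0" using nz by (auto simp: rho_lin)
  ultimately have wt: "(wt h x y)\<^sup>2 = q ^ (2 * k)" using c(2) by auto
  have "wt h x y = q ^ (2 * Suc k) * wt h (qi ^ Suc k * x) (inverse h ^ Suc k * y)"
    unfolding wt_step[OF h] by (simp only: AB.P.q_pow)
  then have "(wt h x y)\<^sup>2 = q ^ (2 * Suc k * 2 + 2 * n)"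
    by (simp only: power_mult_distrib n power_mult[symmetric] power_add[symmetric])
  with wt have "q ^ (2 * k) = q ^ (2 * Suc k * 2 + 2 * n)" by simp
  from q_pow_inj[OF this] show False by simp
qed

lemma trivial_family:
  assumes W: "family W" and "\<And>x y t. x \<noteq> 0 \<Longrightarrow> y \<noteq> 0 \<Longrightarrow> t \<in> Top x y \<Longrightarrow> t \<in> W x y \<Longrightarrow> t = 0"
    and w: "w \<in> W x y" "x \<noteq> 0" "y \<noteq> 0"
  shows "w = 0"
proof -
  have 1: "u = 0" if "u \<in> G1 W x y" for u x y
  proof -
    from that obtain k x' y' t where "u = fch qi k x' y' t" "x' \<noteq> 0" "y' \<noteq> 0" "t \<in> Top x' y'" "t \<in> W x' y'"
      unfolding G1_def G0_def strings_def by blast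
    then show ?thesis using assms(2)[of x' y' t] by (simp add: fch_lin)
  qed
  have "strings q (G1 W) x y \<subseteq> {0}"
    unfolding strings_def by (auto dest!: 1 simp: fch_lin)
  then have "sspan q (G1 W) x y \<subseteq> {0}" by (intro span_minimal) auto
  then show ?thesis using family_spanned[OF W w] by blast
qed

text \<open>By \<open>trivial_family\<close> only top vectors of the intersection matter. Each label
  carries at most one vector of the double string of t, and among these no nonzero one besides t is
  a top vector; but t is not in M.\<close>

lemma generated_disjoint:
  assumes M: "family M" and t: "t \<in> Top x y" "x \<noteq> 0" "y \<noteq> 0" "t \<notin> M x y"
  defines "T \<equiv> (\<lambda>x' y'. if x' = x \<and> y' = y then {t} else {})"
  assumes w: "w \<in> M x' y'" "w \<in> sspan q (G1 T) x' y'" "x' \<noteq> 0" "y' \<noteq> 0"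
  shows "w = 0"
proof -
  have G0: "r = t" "x' = x" "y' = y" if "r \<in> G0 T x' y'" for r x' y'
    using that by (auto simp: G0_def T_def split: if_splits)
  have gen: "\<exists>k l. u = fch q k (qi ^ l * x) (q ^ l * y) (fch qi l x y t) \<and> x' = qi ^ k * (qi ^ l * x) \<and> y' = qi ^ k * (q ^ l * y)"
    if u: "u \<in> strings q (G1 T) x' y'" for u x' y'
  proof -
    from u obtain k x1 y1 r where 1: "u = fch q k x1 y1 r" "x' = qi ^ k * x1" "y' = qi ^ k * y1" "r \<in> G1 T x1 y1"
      unfolding strings_def by auto
    from 1(4) obtain l x2 y2 r2 where 2: "r = fch qi l x2 y2 r2" "x1 = qi ^ l * x2" "y1 = q ^ l * y2" "r2 \<in> G0 T x2 y2"
      unfolding G1_def strings_def by auto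
    show ?thesis using 1 2 G0[OF 2(4)] by blast
  qed
  show ?thesis
  proof (rule trivial_family[OF family_Int[OF M family_sspan_G1[of T]] _ _ w(3,4)])
    show "w \<in> M x' y' \<inter> sspan q (G1 T) x' y'" using w by blast
    fix x' y' r assume xy': "x' \<noteq> 0" "y' \<noteq> 0" and r: "r \<in> Top x' y'" "r \<in> M x' y' \<inter> sspan q (G1 T) x' y'"
    show "r = 0"
    proof (rule ccontr)
      assume r0: "r \<noteq> 0"
      then have "\<not> strings q (G1 T) x' y' \<subseteq> {0}" using r(2) span_minimal[of "strings q (G1 T) x' y'" "{0}"] by auto
      then obtain u where u: "u \<in> strings q (G1 T) x' y'" by blast
      from gen[OF u] obtain k l where kl: "u = fch q k (qi ^ l * x) (q ^ l * y) (fch qi l x y t)"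
        "x' = qi ^ k * (qi ^ l * x)" "y' = qi ^ k * (q ^ l * y)" by blast
      \<comment> \<open>The two labels determine k + l and l - k, because q is not a root of
        unity.\<close>
      have "strings q (G1 T) x' y' \<subseteq> {u}"
      proof
        fix u' assume "u' \<in> strings q (G1 T) x' y'"
        from gen[OF this] obtain k' l' where kl': "u' = fch q k' (qi ^ l' * x) (q ^ l' * y) (fch qi l' x y t)"
          "x' = qi ^ k' * (qi ^ l' * x)" "y' = qi ^ k' * (q ^ l' * y)" by blast
        have "q ^ (k + l) = q ^ (k' + l')"
          using kl(2) kl'(2) t(2) q_nz by (simp add: power_add power_inverse) (metis inverse_inverse_eq inverse_mult_distrib)
        then have 1: "k + l = k' + l'" by (rule q_pow_inj)
        have "q ^ l / q ^ k = q ^ l' / q ^ k'"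
          using kl(3) kl'(3) t(3) by (simp add: power_inverse divide_inverse mult.commute)
        then have "q ^ (l + k') = q ^ (l' + k)" using q_nz by (simp add: power_add field_simps)
        from q_pow_inj[OF this] 1 have "k = k'" "l = l'" by simp_all
        then show "u' \<in> {u}" using kl kl' by simp
      qed
      then have "r \<in> span {u}" using r(2) span_mono by blast
      then obtain c where c: "r = c *s u" by (auto simp: span_singleton)
      have uT: "u \<in> Top x' y'"
      proof -
        have "(1 / c) *s r \<in> Top x' y'" using r(1) subspace_scale[OF subspace_Top] by blast
        then show ?thesis using c r0 by simp
      qed
      have u0: "u \<noteq> 0" using c r0 by auto
      show False
      proof (cases k)
        case (Suc m)
        have "qi ^ l * x \<noteq> 0" "q ^ l * y \<noteq> 0" using t q_nz by simp_all
        from no_lower_top[OF string_ladder[OF t(1-3)] this, of m] uT u0 kl Suc show False by simp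
      next
        case 0
        show False
        proof (cases l)
          case (Suc m)
          from no_lower_top[OF top_ladder[OF t(1-3)] t(2,3), of qi m] uT u0 kl Suc \<open>k = 0\<close> show False by simp
        next
          case l: 0
          then have "u = t" "x' = x" "y' = y" using kl \<open>k = 0\<close> by simp_all
          then have "(1 / c) *s r \<in> M x y" using r(2) subspace_scale[OF familyD(1)[OF M t(2,3)]] by blast
          then have "t \<in> M x y" using c r0 \<open>u = t\<close> by simp
          with t(4) show False by blast
        qed
      qed
    qed
  qed
qed

text \<open>A maximal family N meeting W trivially is a complement: a vector outside N + W, taken at
  a highest label, is corrected to a top vector outside N + W, and what this generates could be
  added to N.\<close>

lemma family_complement:
  assumes W: "family W"
  shows "\<exists>N. family N \<and> (\<forall>x y. x \<noteq> 0 \<longrightarrow> y \<noteq> 0 \<longrightarrow> W x y \<inter> N x y = {0} \<and>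
    (\<forall>v\<in>K x y. \<exists>w\<in>W x y. v - w \<in> N x y))"
proof -
  \<comment> \<open>Families are coded as sets of triples, so that Zorn's lemma for set inclusion
    applies and the upper bound of a chain is its union.\<close>
  let ?f = "\<lambda>F x y. {v. (x, y, v) \<in> F}"
  define admissible where "admissible F \<longleftrightarrow> family (?f F) \<and> (\<forall>x y. x \<noteq> 0 \<longrightarrow> y \<noteq> 0 \<longrightarrow> W x y \<inter> ?f F x y \<subseteq> {0})" for F
  have "\<exists>F\<in>Collect admissible. \<forall>X\<in>Collect admissible. F \<subseteq> X \<longrightarrow> X = F"
  proof (rule subset_Zorn_nonempty)
    have "admissible {(x, y, v). v = 0}" using family_zero by (simp add: admissible_def)
    then show "Collect admissible \<noteq> {}" by blast
    fix \<C> assume ne: "\<C> \<noteq> {}" and ch: "subset.chain (Collect admissible) \<C>"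
    have mem: "admissible F" if "F \<in> \<C>" for F using ch that unfolding subset.chain_def by blast
    have tot: "F \<subseteq> G \<or> G \<subseteq> F" if "F \<in> \<C>" "G \<in> \<C>" for F G
      using ch that unfolding subset_chain_def by blast
    have "family (?f (\<Union>\<C>))" unfolding family_def
    proof (intro allI impI conjI ballI)
      fix x y :: complex assume xy: "x \<noteq> 0" "y \<noteq> 0"
      have D: "subspace (?f F x y)" "v \<in> ?f F x y \<Longrightarrow> v \<in> K x y"
        "v \<in> ?f F x y \<Longrightarrow> dir g \<Longrightarrow> dir h \<Longrightarrow> rho g h x y v \<in> ?f F (g * x) (h * y)"
        if "F \<in> \<C>" for F v g h
        using familyD[of "?f F", OF _ xy] mem[OF that] unfolding admissible_def by blast+
      show "subspace (?f (\<Union>\<C>) x y)" unfolding subspace_def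
      proof (intro conjI ballI allI)
        show "0 \<in> ?f (\<Union>\<C>) x y" using ne D(1) subspace_0 by blast
        fix u assume u: "u \<in> ?f (\<Union>\<C>) x y"
        then obtain F where F: "F \<in> \<C>" "u \<in> ?f F x y" by blast
        show "c *s u \<in> ?f (\<Union>\<C>) x y" for c using subspace_scale[OF D(1)[OF F(1)] F(2)] F(1) by blast
        fix v assume "v \<in> ?f (\<Union>\<C>) x y"
        then obtain G where G: "G \<in> \<C>" "v \<in> ?f G x y" by blast
        from tot[OF F(1) G(1)] show "u + v \<in> ?f (\<Union>\<C>) x y"
        proof
          assume "F \<subseteq> G"
          then have "u \<in> ?f G x y" using F by blast
          from subspace_add[OF D(1)[OF G(1)] this G(2)] show ?thesis using G(1) by blast
        next
          assume "G \<subseteq> F"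
          then have "v \<in> ?f F x y" using G by blast
          from subspace_add[OF D(1)[OF F(1)] F(2) this] show ?thesis using F(1) by blast
        qed
      qed
      show "?f (\<Union>\<C>) x y \<subseteq> K x y" using D(2) by blast
      fix g h v assume "v \<in> ?f (\<Union>\<C>) x y" "dir g" "dir h"
      then show "rho g h x y v \<in> ?f (\<Union>\<C>) (g * x) (h * y)" using D(3) by blast
    qed
    moreover have "W x y \<inter> ?f (\<Union>\<C>) x y \<subseteq> {0}" if "x \<noteq> 0" "y \<noteq> 0" for x y
    proof
      fix v assume "v \<in> W x y \<inter> ?f (\<Union>\<C>) x y"
      then obtain F where "F \<in> \<C>" "v \<in> W x y \<inter> ?f F x y" by blast
      then show "v \<in> {0}" using mem[of F] that unfolding admissible_def by blast
    qed
    ultimately show "\<Union>\<C> \<in> Collect admissible" unfolding mem_Collect_eq admissible_def by blast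
  qed
  then obtain F where "F \<in> Collect admissible" and max': "\<forall>X\<in>Collect admissible. F \<subseteq> X \<longrightarrow> X = F" by (rule bexE)
  then have F: "admissible F" by simp
  have max: "X = F" if "admissible X" "F \<subseteq> X" for X using max' that by simp
  let ?N = "?f F"
  let ?M = "\<lambda>x y. {n + w | n w. n \<in> ?N x y \<and> w \<in> W x y}"
  have N: "family ?N" using F unfolding admissible_def by blast
  have WN: "W x y \<inter> ?N x y \<subseteq> {0}" if "x \<noteq> 0" "y \<noteq> 0" for x y using F that unfolding admissible_def by blast
  have M: "family ?M" by (rule family_sum[OF N W])
  have NM: "n \<in> ?M x y" if "n \<in> ?N x y" "x \<noteq> 0" "y \<noteq> 0" for n x y
    using that subspace_0[OF familyD(1)[OF W that(2,3)]] by force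
  have WM: "n \<in> ?M x y" if "n \<in> W x y" "x \<noteq> 0" "y \<noteq> 0" for n x y
    using that subspace_0[OF familyD(1)[OF N that(2,3)]] by force
  have all: "v \<in> ?M x y" if "v \<in> K x y" "x \<noteq> 0" "y \<noteq> 0" for v x y
    using that
  proof (induction rule: level_induct)
    case (zero x y)
    then show ?case using subspace_0[OF familyD(1)[OF M zero]] by blast
  next
    case (step x y w)
    note xy = \<open>x \<noteq> 0\<close> \<open>y \<noteq> 0\<close>
    show ?case
    proof (rule ccontr)
      assume nM: "w \<notin> ?M x y"
      have up: "up h x y w \<in> ?M (q * x) (h * y)" if "dir h" for h
        using step.IH[OF that rho_K[OF \<open>w \<in> K x y\<close> _ that xy]] by simp
      obtain s where s: "s \<in> ?M x y" "w - s \<in> Top x y"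
        using correction[OF M \<open>w \<in> K x y\<close> xy nM up[OF dir_simps(1)] up[OF dir_simps(2)]] by blast
      let ?t = "w - s"
      have tM: "?t \<notin> ?M x y" using subspace_add[OF familyD(1)[OF M xy], of ?t s] s nM by auto
      define T where "T = (\<lambda>x' y'. if x' = x \<and> y' = y then {?t} else {})"
      let ?Q = "sspan q (G1 T)"
      let ?N' = "\<lambda>x y. {n + u | n u. n \<in> ?N x y \<and> u \<in> ?Q x y}"
      let ?X = "{(x, y, v). v \<in> ?N' x y}"
      have "admissible ?X" unfolding admissible_def
      proof (intro conjI allI impI subsetI)
        show "family (?f ?X)" using family_sum[OF N family_sspan_G1[of T]] by simp
        fix x' y' v assume xy': "x' \<noteq> 0" "y' \<noteq> 0" and v: "v \<in> W x' y' \<inter> ?f ?X x' y'"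
        then obtain n u where nu: "v = n + u" "n \<in> ?N x' y'" "u \<in> ?Q x' y'" by blast
        have "u = v - n" using nu by simp
        then have "u \<in> ?M x' y'"
          using v NM[OF nu(2) xy'] WM[OF _ xy'] subspace_diff[OF familyD(1)[OF M xy']] by blast
        then have "u = 0" using generated_disjoint[OF M s(2) xy tM, of u x' y'] nu(3) xy' unfolding T_def by blast
        then have "v \<in> W x' y' \<inter> ?N x' y'" using nu v by simp
        then show "v \<in> {0}" using WN[OF xy'] by blast
      qed
      moreover have "F \<subseteq> ?X"
      proof
        fix p assume "p \<in> F"
        moreover obtain x y v where "p = (x, y, v)" by (metis prod_cases3)
        moreover have "v = v + 0" by simp
        ultimately show "p \<in> ?X" using span_zero by blast
      qed
      ultimately have "?X = F" by (rule max)
      moreover have "?t \<in> ?N' x y"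
      proof -
        have "?t \<in> G0 T x y" using s(2) by (simp add: G0_def T_def)
        then have "?t \<in> G1 T x y" unfolding G1_def using xy by (rule strings_base)
        then have "?t \<in> ?Q x y" using strings_base xy span_base by blast
        moreover have "0 \<in> ?N x y" by (rule subspace_0[OF familyD(1)[OF N xy]])
        moreover have "?t = 0 + ?t" by simp
        ultimately show ?thesis by blast
      qed
      ultimately have "?t \<in> ?N x y" by blast
      from NM[OF this xy] tM show False by blast
    qed
  qed
  have "W x y \<inter> ?N x y = {0}" if "x \<noteq> 0" "y \<noteq> 0" for x y
    using WN[OF that] subspace_0[OF familyD(1)[OF N that]] subspace_0[OF familyD(1)[OF W that]] by blast
  moreover have "\<exists>w\<in>W x y. v - w \<in> ?N x y" if "x \<noteq> 0" "y \<noteq> 0" "v \<in> K x y" for x y v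
  proof -
    from all[OF that(3,1,2)] obtain n w where "v = n + w" "n \<in> ?N x y" "w \<in> W x y" by blast
    then show ?thesis by (intro bexI[of _ w]) auto
  qed
  ultimately show ?thesis using N by (intro exI[of _ ?N]) blast
qed

end

section \<open>From complements on labels to invariant complements\<close>

lemma (in complex_operator) shift_prod_eigen:
  "T v = m *s v \<Longrightarrow> shift_prod scale T ls v = (\<Prod>l\<leftarrow>ls. m - l) *s v"
proof (induction ls arbitrary: v)
  case (Cons l ls)
  have "T v - l *s v = (m - l) *s v" using Cons.prems by (simp add: algebra_simps)
  moreover have "T ((m - l) *s v) = m *s ((m - l) *s v)" using Cons.prems by (simp add: linT mult.commute)
  ultimately show ?case using Cons.IH by (simp add: mult.commute)
qed simp

context so4_rep
begin

definition invariant :: "'v set \<Rightarrow> bool" where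
  "invariant U \<longleftrightarrow> subspace U \<and> (\<forall>u\<in>U. A u \<in> U \<and> B u \<in> U \<and> C u \<in> U)"

text \<open>C preserves each A-eigenspace inside U and is diagonalizable there by the same
  theorem.\<close>

lemma span_joint:
  assumes U: "subspace U" "\<And>u. u \<in> U \<Longrightarrow> A u \<in> U" "\<And>u. u \<in> U \<Longrightarrow> C u \<in> U" and v: "v \<in> U"
  shows "v \<in> span {u \<in> U. \<exists>x y. x \<noteq> 0 \<and> y \<noteq> 0 \<and> u \<in> K x y}"
proof -
  let ?E = "{u \<in> U. \<exists>x y. x \<noteq> 0 \<and> y \<noteq> 0 \<and> u \<in> K x y}"
  have "{u \<in> U. \<exists>x. x \<noteq> 0 \<and> A u = lam x *s u} \<subseteq> span ?E"
  proof
    fix u assume "u \<in> {u \<in> U. \<exists>x. x \<noteq> 0 \<and> A u = lam x *s u}"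
    then obtain x where u: "u \<in> U" "x \<noteq> 0" "A u = lam x *s u" by blast
    let ?U = "{u \<in> U. A u = lam x *s u}"
    have "subspace ?U" using U(1)
      by (auto simp: subspace_def lins scale_right_distrib scale_left_commute)
    moreover have "C w \<in> ?U" if "w \<in> ?U" for w using that U(3) by (simp add: AC lins)
    ultimately have "u \<in> span {w \<in> ?U. \<exists>y. y \<noteq> 0 \<and> C w = lam y *s w}"
      using u by (intro CB.span_A_eigenvectors) auto
    moreover have "{w \<in> ?U. \<exists>y. y \<noteq> 0 \<and> C w = lam y *s w} \<subseteq> ?E" using u(2) by (auto simp: K_def)
    ultimately show "u \<in> span ?E" using span_mono by blast
  qed
  then have "span {u \<in> U. \<exists>x. x \<noteq> 0 \<and> A u = lam x *s u} \<subseteq> span ?E" by (rule span_minimal) simp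
  then show ?thesis using AB.span_A_eigenvectors[OF U(1,2) v] by blast
qed

lemma K_neg: "K (- 1 / x) y = K x y" "K x (- 1 / y) = K x y"
  by (auto simp: K_def lam_def)

lemma lam_eq_cases: "lam x' = lam x \<Longrightarrow> x \<noteq> 0 \<Longrightarrow> x' \<noteq> 0 \<Longrightarrow> x' = x \<or> x' = - 1 / x"
  using lam_eq_iff[of x' x] nonzero_eq_divide_eq[of x x' "- 1"] by blast

lemma dir_inv: "dir g \<Longrightarrow> dir (1 / g)"
  using dir_inverse by (simp add: inverse_eq_divide)

text \<open>Replacing x by -1/x keeps its eigenvalue and exchanges the directions g and 1/g.\<close>

lemma rho_neg: "x \<noteq> 0 \<Longrightarrow> g \<noteq> 0 \<Longrightarrow> rho (1 / g) h (- 1 / x) y = rho g h x y"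
  "y \<noteq> 0 \<Longrightarrow> h \<noteq> 0 \<Longrightarrow> rho g (1 / h) x (- 1 / y) = rho g h x y"
  by (simp_all add: fun_eq_iff rho_def E_def lam_def)

lemma rho_invariant: "invariant U \<Longrightarrow> v \<in> U \<Longrightarrow> rho g h x y v \<in> U"
  by (simp add: invariant_def rho_def E_def subspace_diff subspace_scale)

text \<open>Projections onto U, one for each label, that commute with the ladder operators.
  Different labels of the same eigenspace may carry different projections, so P need not come from
  an operator on the space.\<close>

definition equivariant :: "'v set \<Rightarrow> (complex \<Rightarrow> complex \<Rightarrow> 'v \<Rightarrow> 'v) \<Rightarrow> bool" where
  "equivariant U P \<longleftrightarrow> (\<forall>x y. x \<noteq> 0 \<longrightarrow> y \<noteq> 0 \<longrightarrow>
     (\<forall>v\<in>K x y. P x y v \<in> U \<inter> K x y \<and> (v \<in> U \<longrightarrow> P x y v = v) \<and> (\<forall>c. P x y (c *s v) = c *s P x y v) \<and>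
       (\<forall>u\<in>K x y. P x y (u + v) = P x y u + P x y v) \<and>
       (\<forall>g h. dir g \<longrightarrow> dir h \<longrightarrow> P (g * x) (h * y) (rho g h x y v) = rho g h x y (P x y v))))"

lemma equivariantD:
  assumes "equivariant U P" "x \<noteq> 0" "y \<noteq> 0" "v \<in> K x y"
  shows "P x y v \<in> U" "P x y v \<in> K x y" "v \<in> U \<Longrightarrow> P x y v = v" "P x y (c *s v) = c *s P x y v"
    "u \<in> K x y \<Longrightarrow> P x y (u + v) = P x y u + P x y v"
    "dir g \<Longrightarrow> dir h \<Longrightarrow> P (g * x) (h * y) (rho g h x y v) = rho g h x y (P x y v)"
  using assms unfolding equivariant_def by blast+

lemma equivariant_exists:
  assumes U: "invariant U"
  shows "\<exists>p. equivariant U p"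
proof -
  have Us: "subspace U" using U by (simp add: invariant_def)
  let ?W = "\<lambda>x y. U \<inter> K x y"
  have W: "family ?W" unfolding family_def
    using subspace_inter[OF Us subspace_K] rho_invariant[OF U] rho_K by blast
  from family_complement[OF W] obtain N where N: "family N"
    and N': "\<forall>x y. x \<noteq> 0 \<longrightarrow> y \<noteq> 0 \<longrightarrow> ?W x y \<inter> N x y = {0} \<and> (\<forall>v\<in>K x y. \<exists>w\<in>?W x y. v - w \<in> N x y)"
    by (elim exE conjE)
  have WN: "?W x y \<inter> N x y = {0}" if "x \<noteq> 0" "y \<noteq> 0" for x y
    using N' that by blast
  have dec: "\<exists>w. w \<in> ?W x y \<and> v - w \<in> N x y" if "x \<noteq> 0" "y \<noteq> 0" "v \<in> K x y" for x y v
    using N' that by blast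
  define p where "p x y v = (SOME w. w \<in> ?W x y \<and> v - w \<in> N x y)" for x y v
  have p: "p x y v \<in> ?W x y" "v - p x y v \<in> N x y" if "x \<noteq> 0" "y \<noteq> 0" "v \<in> K x y" for x y v
    using someI_ex[OF dec[OF that]] unfolding p_def by simp_all
  have p_eq: "p x y v = w" if xy: "x \<noteq> 0" "y \<noteq> 0" and "v \<in> K x y" "w \<in> ?W x y" "v - w \<in> N x y" for x y v w
  proof -
    have "p x y v - w \<in> ?W x y" by (rule subspace_diff[OF familyD(1)[OF W xy] p(1)[OF xy that(3)] that(4)])
    moreover have "(v - w) - (v - p x y v) \<in> N x y"
      by (rule subspace_diff[OF familyD(1)[OF N xy] that(5) p(2)[OF xy that(3)]])
    then have "p x y v - w \<in> N x y" by simp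
    ultimately have "p x y v - w \<in> ?W x y \<inter> N x y" by (rule IntI)
    then show ?thesis unfolding WN[OF xy] by simp
  qed
  have "equivariant U p" unfolding equivariant_def
  proof (intro allI impI ballI conjI)
    fix x y v assume xy: "x \<noteq> 0" "y \<noteq> 0" and v: "v \<in> K x y"
    note Ws = familyD(1)[OF W xy] and Ns = familyD(1)[OF N xy]
    show "p x y v \<in> U \<inter> K x y" by (rule p(1)[OF xy v])
    show "p x y v = v" if "v \<in> U"
      using that v subspace_0[OF Ns] by (intro p_eq[OF xy v]) simp_all
    show "p x y (c *s v) = c *s p x y v" for c
    proof (rule p_eq[OF xy])
      show "c *s v \<in> K x y" by (rule subspace_scale[OF subspace_K v])
      show "c *s p x y v \<in> ?W x y" by (rule subspace_scale[OF Ws p(1)[OF xy v]])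
      have "c *s (v - p x y v) \<in> N x y" by (rule subspace_scale[OF Ns p(2)[OF xy v]])
      then show "c *s v - c *s p x y v \<in> N x y" by (simp add: scale_right_diff_distrib)
    qed
    show "p x y (u + v) = p x y u + p x y v" if u: "u \<in> K x y" for u
    proof (rule p_eq[OF xy])
      show "u + v \<in> K x y" by (rule subspace_add[OF subspace_K u v])
      show "p x y u + p x y v \<in> ?W x y" by (rule subspace_add[OF Ws p(1)[OF xy u] p(1)[OF xy v]])
      have "(u - p x y u) + (v - p x y v) \<in> N x y" by (rule subspace_add[OF Ns p(2)[OF xy u] p(2)[OF xy v]])
      then show "u + v - (p x y u + p x y v) \<in> N x y" by (simp add: algebra_simps)
    qed
    fix g h assume d: "dir g" "dir h"
    show "p (g * x) (h * y) (rho g h x y v) = rho g h x y (p x y v)"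
    proof (rule p_eq)
      show "g * x \<noteq> 0" "h * y \<noteq> 0" using xy d dir_nz by simp_all
      show "rho g h x y v \<in> K (g * x) (h * y)" by (rule rho_K[OF v d xy])
      show "rho g h x y (p x y v) \<in> ?W (g * x) (h * y)" by (rule familyD(3)[OF W xy p(1)[OF xy v] d])
      have "rho g h x y (v - p x y v) \<in> N (g * x) (h * y)" by (rule familyD(3)[OF N xy p(2)[OF xy v] d])
      then show "rho g h x y v - rho g h x y (p x y v) \<in> N (g * x) (h * y)" by (simp add: rho_lin)
    qed
  qed
  then show ?thesis by (rule exI[of _ p])
qed

text \<open>The labels \<open>x\<close> and \<open>- 1 / x\<close> name the same eigenspace; averaging over them makes the
  projections descend from labels to eigenspaces.\<close>
lemma equivariant_flip:
  assumes p: "equivariant U p"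
  shows "equivariant U (\<lambda>x y. p (- 1 / x) y)" "equivariant U (\<lambda>x y. p x (- 1 / y))"
proof -
  show "equivariant U (\<lambda>x y. p (- 1 / x) y)" unfolding equivariant_def
  proof (intro allI impI ballI conjI)
    fix x y :: complex and v assume xy: "x \<noteq> 0" "y \<noteq> 0" and v: "v \<in> K x y"
    have nx: "- 1 / x \<noteq> 0" using xy by simp
    note D = equivariantD[OF p nx xy(2), unfolded K_neg, OF v]
    show "p (- 1 / x) y v \<in> U \<inter> K x y" using D(1,2) by simp
    show "v \<in> U \<Longrightarrow> p (- 1 / x) y v = v" by (rule D(3))
    show "p (- 1 / x) y (c *s v) = c *s p (- 1 / x) y v" for c by (rule D(4))
    show "u \<in> K x y \<Longrightarrow> p (- 1 / x) y (u + v) = p (- 1 / x) y u + p (- 1 / x) y v" for u by (rule D(5))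
    fix g h assume d: "dir g" "dir h"
    have "- 1 / (g * x) = (1 / g) * (- 1 / x)" by simp
    then show "p (- 1 / (g * x)) (h * y) (rho g h x y v) = rho g h x y (p (- 1 / x) y v)"
      using D(6)[OF dir_inv[OF d(1)] d(2)] unfolding rho_neg(1)[OF xy(1) dir_nz[OF d(1)]] by (simp only:)
  qed
  show "equivariant U (\<lambda>x y. p x (- 1 / y))" unfolding equivariant_def
  proof (intro allI impI ballI conjI)
    fix x y :: complex and v assume xy: "x \<noteq> 0" "y \<noteq> 0" and v: "v \<in> K x y"
    have ny: "- 1 / y \<noteq> 0" using xy by simp
    note D = equivariantD[OF p xy(1) ny, unfolded K_neg, OF v]
    show "p x (- 1 / y) v \<in> U \<inter> K x y" using D(1,2) by simp
    show "v \<in> U \<Longrightarrow> p x (- 1 / y) v = v" by (rule D(3))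
    show "p x (- 1 / y) (c *s v) = c *s p x (- 1 / y) v" for c by (rule D(4))
    show "u \<in> K x y \<Longrightarrow> p x (- 1 / y) (u + v) = p x (- 1 / y) u + p x (- 1 / y) v" for u by (rule D(5))
    fix g h assume d: "dir g" "dir h"
    have "- 1 / (h * y) = (1 / h) * (- 1 / y)" by simp
    then show "p (g * x) (- 1 / (h * y)) (rho g h x y v) = rho g h x y (p x (- 1 / y) v)"
      using D(6)[OF d(1) dir_inv[OF d(2)]] unfolding rho_neg(2)[OF xy(2) dir_nz[OF d(2)]] by (simp only:)
  qed
qed

lemma equivariant_mean:
  assumes p: "equivariant U p" and r: "equivariant U r" and U: "subspace U"
  shows "equivariant U (\<lambda>x y v. (1 / 2) *s (p x y v + r x y v))"
  unfolding equivariant_def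
proof (intro allI impI ballI conjI)
  fix x y v assume xy: "x \<noteq> 0" "y \<noteq> 0" and v: "v \<in> K x y"
  note D = equivariantD[OF p xy v] and R = equivariantD[OF r xy v]
  show "(1 / 2) *s (p x y v + r x y v) \<in> U \<inter> K x y"
    by (intro IntI subspace_scale subspace_add U subspace_K D(1,2) R(1,2))
  have half: "(1 / 2) *s (v + v) = v" for v
  proof -
    have "v + v = 2 *s v" using scale_left_distrib[of 1 1 v] by simp
    then show ?thesis by simp
  qed
  show "(1 / 2) *s (p x y v + r x y v) = v" if "v \<in> U"
    unfolding D(3)[OF that] R(3)[OF that] by (rule half)
  show "(1 / 2) *s (p x y (c *s v) + r x y (c *s v)) = c *s ((1 / 2) *s (p x y v + r x y v))" for c
    unfolding D(4) R(4) by (simp add: scale_right_distrib mult.commute)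
  show "(1 / 2) *s (p x y (u + v) + r x y (u + v)) = (1 / 2) *s (p x y u + r x y u) + (1 / 2) *s (p x y v + r x y v)"
    if "u \<in> K x y" for u
    unfolding D(5)[OF that] R(5)[OF that] by (simp add: scale_right_distrib ac_simps)
  show "(1 / 2) *s (p (g * x) (h * y) (rho g h x y v) + r (g * x) (h * y) (rho g h x y v))
      = rho g h x y ((1 / 2) *s (p x y v + r x y v))" if "dir g" "dir h" for g h
    unfolding D(6)[OF that] R(6)[OF that] by (simp only: rho_lin)
qed

lemma equivariant_symmetric:
  assumes U: "invariant U"
  obtains P where "equivariant U P" "\<And>x y. P (- 1 / x) y = P x y" "\<And>x y. P x (- 1 / y) = P x y"
proof -
  have Us: "subspace U" using U by (simp add: invariant_def)
  from equivariant_exists[OF U] obtain p where p: "equivariant U p" ..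
  define r where "r = (\<lambda>x y v. (1 / 2) *s (p x y v + p (- 1 / x) y v))"
  define P where "P = (\<lambda>x y v. (1 / 2) *s (r x y v + r x (- 1 / y) v))"
  have r: "equivariant U r" unfolding r_def by (rule equivariant_mean[OF p equivariant_flip(1)[OF p] Us])
  have P: "equivariant U P" unfolding P_def by (rule equivariant_mean[OF r equivariant_flip(2)[OF r] Us])
  show thesis
    by (rule that[OF P]) (simp_all add: P_def r_def add.commute)
qed

text \<open>The vectors v - P x y v span the complement. It is stable under B because B can be
  rebuilt from ladder operators, which commute with P; that it meets U trivially is checked on one
  joint eigenspace at a time.\<close>

theorem invariant_complement:
  assumes U: "invariant U"
  shows "\<exists>V. invariant V \<and> U \<inter> V = {0} \<and> (\<forall>v. \<exists>u\<in>U. v - u \<in> V)"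
proof -
  have Us: "subspace U" using U by (simp add: invariant_def)
  obtain P where P: "equivariant U P" and P_neg: "\<And>x y. P (- 1 / x) y = P x y" "\<And>x y. P x (- 1 / y) = P x y"
    using equivariant_symmetric[OF U] by blast
  note PD = equivariantD[OF P]
  have P0: "P x y 0 = 0" if "x \<noteq> 0" "y \<noteq> 0" for x y
    using PD(4)[OF that subspace_0[OF subspace_K], of 0] by simp
  define G where "G = {v - P x y v | x y v. x \<noteq> 0 \<and> y \<noteq> 0 \<and> v \<in> K x y}"
  have GI: "v - P x y v \<in> span G" if "x \<noteq> 0" "y \<noteq> 0" "v \<in> K x y" for x y v
    unfolding G_def using that by (intro span_base) blast
  have PK: "v - P x y v \<in> K x y" if "x \<noteq> 0" "y \<noteq> 0" "v \<in> K x y" for x y v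
    by (rule subspace_diff[OF subspace_K that(3) PD(2)[OF that]])
  have gen: "A z \<in> span G \<and> B z \<in> span G \<and> C z \<in> span G" if "z \<in> G" for z
  proof -
    from that obtain x y v where z: "z = v - P x y v" and xy: "x \<noteq> 0" "y \<noteq> 0" and v: "v \<in> K x y"
      unfolding G_def by blast
    have zK: "z \<in> K x y" unfolding z by (rule PK[OF xy v])
    have zs: "z \<in> span G" unfolding z by (rule GI[OF xy v])
    have "A z = lam x *s z" "C z = lam y *s z" using zK by (simp_all add: K_def)
    then have "A z \<in> span G" "C z \<in> span G" using span_scale[OF zs] by simp_all
    moreover have "B z \<in> span G"
    proof (cases "z = 0")
      case False
      then have g: "good x" "good y" using K_good[OF zK] xy by simp_all
      have r: "rho g h x y z \<in> span G" if d: "dir g" "dir h" for g h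
      proof -
        have "rho g h x y z = rho g h x y v - P (g * x) (h * y) (rho g h x y v)"
          unfolding z rho_lin PD(6)[OF xy v d] ..
        moreover have "g * x \<noteq> 0" "h * y \<noteq> 0" using xy d dir_nz by simp_all
        ultimately show ?thesis using GI[OF _ _ rho_K[OF v d xy]] by simp
      qed
      \<comment> \<open>B z is rebuilt from its four components; the factors are divided out
        afterwards, as z is nonzero and its labels are therefore good.\<close>
      have "(d * br x) *s ((d * br y) *s B z) = (d * br x) *s E q y z - (d * br x) *s E qi y z"
        unfolding E_split[OF xy(2)] by (rule scale_right_diff_distrib)
      also have "\<dots> \<in> span G"
        unfolding rho_split[OF xy(1)] by (intro span_diff r) simp_all
      finally have "(1 / ((d * br x) * (d * br y))) *s ((d * br x) *s ((d * br y) *s B z)) \<in> span G" by (rule span_scale)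
      moreover have "d * br x \<noteq> 0" "d * br y \<noteq> 0" using br_nz[OF g(1)] br_nz[OF g(2)] q_diff by simp_all
      ultimately show ?thesis by (simp only: scale_scale) simp
    qed (simp add: lins span_zero)
    ultimately show ?thesis by simp
  qed
  have inv: "invariant (span G)" unfolding invariant_def
  proof (intro conjI ballI)
    fix z assume z: "z \<in> span G"
    have "A z \<in> span G \<and> B z \<in> span G \<and> C z \<in> span G"
      using z
    proof (induction rule: span_induct_alt)
      case (step c u v)
      then show ?case using gen[of u] by (simp add: lins span_add span_scale)
    qed (simp add: lins span_zero)
    then show "A z \<in> span G" "B z \<in> span G" "C z \<in> span G" by simp_all
  qed simp
  have cover: "\<exists>u\<in>U. v - u \<in> span G" for v
  proof -
    have "v \<in> span {u \<in> UNIV. \<exists>x y. x \<noteq> 0 \<and> y \<noteq> 0 \<and> u \<in> K x y}"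
      by (rule span_joint) simp_all
    then show ?thesis
    proof (induction rule: span_induct_alt)
      case base
      then show ?case using subspace_0[OF Us] by (intro bexI[of _ 0]) (simp_all add: span_zero)
    next
      case (step c w v)
      then obtain u x y where *: "u \<in> U" "v - u \<in> span G" "x \<noteq> 0" "y \<noteq> 0" "w \<in> K x y" by blast
      have "c *s (w - P x y w) + (v - u) \<in> span G" by (intro span_add span_scale GI *)
      moreover have "c *s (w - P x y w) + (v - u) = c *s w + v - (c *s P x y w + u)" by (simp add: algebra_simps)
      moreover have "c *s P x y w + u \<in> U" by (intro subspace_add subspace_scale Us PD(1) *)
      ultimately show ?case by (intro bexI[of _ "c *s P x y w + u"]) simp_all
    qed
  qed
  have zero: "z = 0" if z: "z \<in> span G" "z \<in> U" "z \<in> K x y" and xy: "x \<noteq> 0" "y \<noteq> 0" for z x y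
  proof -
    obtain ls where ls: "set ls = {l. \<exists>v. v \<noteq> 0 \<and> A v = l *s v} - {lam x}"
      using finite_list[OF finite_Diff[OF AB.opA.finite_eigenvalues]] by blast
    obtain ms where ms: "set ms = {l. \<exists>v. v \<noteq> 0 \<and> C v = l *s v} - {lam y}"
      using finite_list[OF finite_Diff[OF CB.opA.finite_eigenvalues]] by blast
    \<comment> \<open>A polynomial in A and C that kills every joint eigenspace except
      \<open>K x y\<close> and acts on that one by the nonzero scalar c below.\<close>
    define F where "F v = shift_prod scale C ms (shift_prod scale A ls v)" for v
    have F_lin: "F (c *s u) = c *s F u" "F (u + w) = F u + F w" "F 0 = 0" for c u w
      by (simp_all add: F_def AB.opA.shift_prod_lin CB.opA.shift_prod_lin)
    have F_eig: "F u = ((\<Prod>l\<leftarrow>ls. lam x' - l) * (\<Prod>l\<leftarrow>ms. lam y' - l)) *s u" if "u \<in> K x' y'" for u x' y'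
    proof -
      have u: "A u = lam x' *s u" "C u = lam y' *s u" using that by (simp_all add: K_def)
      show ?thesis
        unfolding F_def AB.opA.shift_prod_eigen[OF u(1)] CB.opA.shift_prod_lin CB.opA.shift_prod_eigen[OF u(2)] by simp
    qed
    define c where "c = (\<Prod>l\<leftarrow>ls. lam x - l) * (\<Prod>l\<leftarrow>ms. lam y - l)"
    have c: "c \<noteq> 0" using ls ms by (auto simp: c_def prod_list_zero_iff)
    have "\<exists>v\<in>K x y. F w = v - P x y v" if "w \<in> span G" for w
      using that
    proof (induction rule: span_induct_alt)
      case base
      show ?case using F_lin P0[OF xy] subspace_0[OF subspace_K] by (intro bexI[of _ 0]) simp_all
    next
      case (step r u w)
      from step(1) obtain x' y' v' where u: "u = v' - P x' y' v'" and xy': "x' \<noteq> 0" "y' \<noteq> 0" and v': "v' \<in> K x' y'"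
        unfolding G_def by blast
      have uK: "u \<in> K x' y'" unfolding u by (rule PK[OF xy' v'])
      have "\<exists>v\<in>K x y. F u = v - P x y v"
      proof (cases "u = 0 \<or> lam x' \<noteq> lam x \<or> lam y' \<noteq> lam y")
        case True
        have "F u = 0"
        proof (cases "u = 0")
          case True
          then show ?thesis by (simp add: F_lin)
        next
          case False
          have "lam x' \<in> {l. \<exists>v. v \<noteq> 0 \<and> A v = l *s v}" "lam y' \<in> {l. \<exists>v. v \<noteq> 0 \<and> C v = l *s v}"
            using uK False by (auto simp: K_def)
          then have "lam x' \<in> set ls \<or> lam y' \<in> set ms" using True False unfolding ls ms by blast
          then have "(\<Prod>l\<leftarrow>ls. lam x' - l) * (\<Prod>l\<leftarrow>ms. lam y' - l) = 0" by (auto simp: prod_list_zero_iff)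
          then show ?thesis unfolding F_eig[OF uK] by simp
        qed
        then show ?thesis using P0[OF xy] subspace_0[OF subspace_K] by (intro bexI[of _ 0]) simp_all
      next
        case False
        \<comment> \<open>The symmetry of P enters here: (x', y') may be another label of the
          eigenspace \<open>K x y\<close>.\<close>
        then have "x' = x \<or> x' = - 1 / x" "y' = y \<or> y' = - 1 / y"
          using lam_eq_cases[of x' x] lam_eq_cases[of y' y] xy xy' by simp_all
        then have "P x' y' v' = P x y v'" "K x' y' = K x y" by (elim disjE; simp only: P_neg K_neg)+
        then have *: "u = v' - P x y v'" "v' \<in> K x y" "u \<in> K x y" using u v' uK by simp_all
        have "F u = c *s u" unfolding F_eig[OF *(3)] c_def ..
        also have "\<dots> = c *s v' - P x y (c *s v')"
          unfolding PD(4)[OF xy *(2)] by (simp only: *(1) scale_right_diff_distrib)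
        finally have "F u = c *s v' - P x y (c *s v')" .
        moreover have "c *s v' \<in> K x y" by (rule subspace_scale[OF subspace_K *(2)])
        ultimately show ?thesis by blast
      qed
      then obtain a b where ab: "a \<in> K x y" "F u = a - P x y a" "b \<in> K x y" "F w = b - P x y b" using step(2) by blast
      have ra: "r *s a \<in> K x y" by (rule subspace_scale[OF subspace_K ab(1)])
      have "F (r *s u + w) = (r *s a + b) - P x y (r *s a + b)"
        unfolding F_lin ab(2,4) PD(5)[OF xy ab(3) ra] PD(4)[OF xy ab(1)] by (simp add: algebra_simps)
      moreover have "r *s a + b \<in> K x y" by (rule subspace_add[OF subspace_K ra ab(3)])
      ultimately show ?case by blast
    qed
    from this[OF z(1)] obtain v where v: "v \<in> K x y" "c *s z = v - P x y v" unfolding F_eig[OF z(3)] c_def by blast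
    have cz: "c *s z \<in> U" "c *s z \<in> K x y" using subspace_scale[OF Us z(2)] subspace_scale[OF subspace_K z(3)] by simp_all
    \<comment> \<open>Both summands lie in U and are fixed by P, so applying P to this equation
      leaves c z = 0.\<close>
    have "v = c *s z + P x y v" using v(2) by simp
    then have "P x y v = P x y (c *s z + P x y v)" by simp
    also have "\<dots> = c *s z + P x y v"
      unfolding PD(5)[OF xy PD(2)[OF xy v(1)] cz(2)] PD(3)[OF xy cz(2,1)] PD(3)[OF xy PD(2)[OF xy v(1)] PD(1)[OF xy v(1)]] ..
    finally have "c *s z = 0" by simp
    then show ?thesis using c by simp
  qed
  have "U \<inter> span G = {0}"
  proof
    show "U \<inter> span G \<subseteq> {0}"
    proof
      fix z assume z: "z \<in> U \<inter> span G"
      have "z \<in> span {u \<in> U \<inter> span G. \<exists>x y. x \<noteq> 0 \<and> y \<noteq> 0 \<and> u \<in> K x y}"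
      proof (rule span_joint[OF subspace_inter[OF Us subspace_span] _ _ z])
        show "A u \<in> U \<inter> span G" "C u \<in> U \<inter> span G" if "u \<in> U \<inter> span G" for u
          using that U inv unfolding invariant_def by simp_all
      qed
      also have "\<dots> \<subseteq> {0}" by (rule span_minimal) (use zero in auto)
      finally show "z \<in> {0}" .
    qed
    show "{0} \<subseteq> U \<inter> span G" using subspace_0[OF Us] by (simp add: span_zero)
  qed
  with inv cover show ?thesis by blast
qed

end

section \<open>Decomposition into irreducible subrepresentations\<close>

context so4_rep
begin

lemma invariant_Int: "invariant U \<Longrightarrow> invariant V \<Longrightarrow> invariant (U \<inter> V)"
  by (auto simp: invariant_def subspace_inter)

definition irreducible_invariant :: "'v set \<Rightarrow> bool" where
  "irreducible_invariant M \<longleftrightarrow> invariant M \<and> M \<noteq> {0} \<and> (\<forall>W. invariant W \<and> W \<subseteq> M \<longrightarrow> W = {0} \<or> W = M)"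

lemma dim_less:
  assumes "subspace U" "subspace V" "U \<subset> V"
  shows "dim U < dim V"
  using assms by (intro dim_psubset) (simp add: span_eq_iff[THEN iffD2])

lemma irreducible_exists:
  assumes "invariant U" "U \<noteq> {0}"
  shows "\<exists>M\<subseteq>U. irreducible_invariant M"
  using assms
proof (induction "dim U" arbitrary: U rule: less_induct)
  case less
  show ?case
  proof (cases "irreducible_invariant U")
    case False
    then obtain W where W: "invariant W" "W \<subseteq> U" "W \<noteq> {0}" "W \<noteq> U"
      using less.prems unfolding irreducible_invariant_def by blast
    then have "dim W < dim U" using less.prems by (intro dim_less) (auto simp: invariant_def)
    from less.hyps[OF this W(1,3)] W(2) show ?thesis by blast
  qed blast
qed

text \<open>An irreducible M in U is split off by a complement V in the whole space; the induction
  continues in U \<inter> V, which is smaller and complements M in U.\<close>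

lemma irreducible_decomposition:
  assumes "invariant U"
  shows "\<exists>\<W>. finite \<W> \<and> (\<forall>W\<in>\<W>. irreducible_invariant W \<and> W \<subseteq> U) \<and>
    (\<forall>v\<in>U. \<exists>!f. f \<in> (\<Pi>\<^sub>E W\<in>\<W>. W) \<and> v = (\<Sum>W\<in>\<W>. f W))"
  using assms
proof (induction "dim U" arbitrary: U rule: less_induct)
  case less
  show ?case
  proof (cases "U = {0}")
    case True
    then show ?thesis by (intro exI[of _ "{}"]) auto
  next
    case False
    have Us: "subspace U" using less.prems by (simp add: invariant_def)
    obtain M where M: "M \<subseteq> U" "irreducible_invariant M" using irreducible_exists[OF less.prems False] by blast
    have Mi: "invariant M" "M \<noteq> {0}" using M by (simp_all add: irreducible_invariant_def)
    have Ms: "subspace M" using Mi by (simp add: invariant_def)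
    obtain V where V: "invariant V" "M \<inter> V = {0}" "\<forall>v. \<exists>u\<in>M. v - u \<in> V"
      using invariant_complement[OF Mi(1)] by blast
    let ?U = "U \<inter> V"
    have Ui: "invariant ?U" by (rule invariant_Int[OF less.prems V(1)])
    then have Us': "subspace ?U" by (simp add: invariant_def)
    have "\<not> M \<subseteq> V" using V(2) Mi(2) by blast
    then have "?U \<subset> U" using M(1) by blast
    from less.hyps[OF dim_less[OF Us' Us this] Ui] obtain \<W> where fin: "finite \<W>"
      and irr: "\<forall>W\<in>\<W>. irreducible_invariant W \<and> W \<subseteq> ?U"
      and dec: "\<forall>v\<in>?U. \<exists>!f. f \<in> (\<Pi>\<^sub>E W\<in>\<W>. W) \<and> v = (\<Sum>W\<in>\<W>. f W)"
      by (elim exE conjE)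
    \<comment> \<open>M must be a new member of the set, for otherwise \<open>insert\<close> would
      add no summand.\<close>
    have MW: "M \<notin> \<W>" using irr \<open>\<not> M \<subseteq> V\<close> by blast
    have sumU: "(\<Sum>W\<in>\<W>. f W) \<in> ?U" if "f \<in> (\<Pi>\<^sub>E W\<in>\<W>. W)" for f
      using that irr by (intro subspace_sum[OF Us']) (meson PiE_mem subsetD)
    have unique: "\<exists>!f. f \<in> (\<Pi>\<^sub>E W\<in>insert M \<W>. W) \<and> v = (\<Sum>W\<in>insert M \<W>. f W)" if v: "v \<in> U" for v
    proof -
      obtain u where u: "u \<in> M" "v - u \<in> V" using V(3) by blast
      have "v - u \<in> ?U" using u v M(1) subspace_diff[OF Us] by blast
      from bspec[OF dec this] obtain f where f': "f \<in> (\<Pi>\<^sub>E W\<in>\<W>. W) \<and> v - u = (\<Sum>W\<in>\<W>. f W)"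
        and uniq': "\<forall>g. g \<in> (\<Pi>\<^sub>E W\<in>\<W>. W) \<and> v - u = (\<Sum>W\<in>\<W>. g W) \<longrightarrow> g = f" by (rule ex1E)
      note f = conjunct1[OF f'] conjunct2[OF f']
      have uniq: "g = f" if "g \<in> (\<Pi>\<^sub>E W\<in>\<W>. W)" "v - u = (\<Sum>W\<in>\<W>. g W)" for g
        using uniq'[rule_format, of g] that by simp
      show ?thesis
      proof (intro ex1I[of _ "f(M := u)"] conjI)
        show "f(M := u) \<in> (\<Pi>\<^sub>E W\<in>insert M \<W>. W)" using f(1) u(1) by (rule PiE_fun_upd[rotated])
        have "(\<Sum>W\<in>\<W>. (f(M := u)) W) = (\<Sum>W\<in>\<W>. f W)" using MW by (intro sum.cong) auto
        then have "(\<Sum>W\<in>insert M \<W>. (f(M := u)) W) = u + (v - u)"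
          unfolding sum.insert[OF fin MW] f(2) by simp
        then show "v = (\<Sum>W\<in>insert M \<W>. (f(M := u)) W)" by simp
        fix g assume "g \<in> (\<Pi>\<^sub>E W\<in>insert M \<W>. W) \<and> v = (\<Sum>W\<in>insert M \<W>. g W)"
        then have g: "g \<in> (\<Pi>\<^sub>E W\<in>insert M \<W>. W)" "v = (\<Sum>W\<in>insert M \<W>. g W)" by simp_all
        let ?g = "restrict g \<W>"
        have gM: "g M \<in> M" using g(1) by (rule PiE_mem) simp
        have gW: "?g \<in> (\<Pi>\<^sub>E W\<in>\<W>. W)" using g(1) by (auto simp: PiE_def Pi_def)
        have "(\<Sum>W\<in>\<W>. ?g W) = (\<Sum>W\<in>\<W>. g W)" by (intro sum.cong) auto
        then have v': "v = g M + (\<Sum>W\<in>\<W>. ?g W)" unfolding g(2) sum.insert[OF fin MW] by simp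
        have "g M - u = (v - u) - (\<Sum>W\<in>\<W>. ?g W)" using v' by simp
        also have "\<dots> \<in> ?U" by (rule subspace_diff[OF Us' \<open>v - u \<in> ?U\<close> sumU[OF gW]])
        finally have "g M - u \<in> M \<inter> V" using subspace_diff[OF Ms gM u(1)] by blast
        then have gu: "g M = u" unfolding V(2) by simp
        then have "v - u = (\<Sum>W\<in>\<W>. ?g W)" using v' by simp
        from uniq[OF gW this] have "?g = f" .
        show "g = f(M := u)"
        proof
          fix W
          consider "W = M" | "W \<in> \<W>" "W \<noteq> M" | "W \<notin> insert M \<W>" by blast
          then show "g W = (f(M := u)) W"
          proof cases
            case 2
            then show ?thesis using \<open>?g = f\<close> by (metis fun_upd_other restrict_apply')
          next
            case 3
            then show ?thesis using PiE_arb[OF g(1)] PiE_arb[OF f(1)] by simp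
          qed (simp add: gu)
        qed
      qed
    qed
    have "\<forall>W\<in>insert M \<W>. irreducible_invariant W \<and> W \<subseteq> U" using M irr by blast
    moreover have "finite (insert M \<W>)" using fin by simp
    moreover have "\<forall>v\<in>U. \<exists>!f. f \<in> (\<Pi>\<^sub>E W\<in>insert M \<W>. W) \<and> v = (\<Sum>W\<in>insert M \<W>. f W)"
      by (rule ballI) (rule unique)
    ultimately show ?thesis by (intro exI[of _ "insert M \<W>"] conjI)
  qed
qed

end

section \<open>From the quotient algebra to three operators\<close>

lemma free_alg_induct [case_names zero add const gen one]:
  fixes P :: "free_alg \<Rightarrow> bool"
  assumes "P 0" and "\<And>a b. P a \<Longrightarrow> P b \<Longrightarrow> P (a + b)"
    and "\<And>c a. P a \<Longrightarrow> P (const_elem c * a)" and "\<And>g a. P a \<Longrightarrow> P (gen_elem g * a)" and "P 1"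
  shows "P a"
proof (induction a rule: update_induct)
  case const
  show ?case by fact
next
  case (update f w c)
  have word: "P (Poly_Mapping.single (Word gs) 1)" for gs
  proof (induction gs)
    case Nil
    then show ?case using assms(5) by (simp flip: single_one add: zero_word_def)
  next
    case (Cons g gs)
    have "Poly_Mapping.single (Word (g # gs)) 1 = gen_elem g * Poly_Mapping.single (Word gs) 1"
      by (simp add: gen_elem_def mult_single plus_word_def)
    then show ?case using assms(4)[OF Cons] by simp
  qed
  have "Poly_Mapping.single w c = const_elem c * Poly_Mapping.single (Word (letters w)) 1"
    by (simp add: const_elem_def mult_single)
  then have "P (Poly_Mapping.single w c)" using assms(3)[OF word, of c "letters w"] by (simp only:)
  moreover have "Poly_Mapping.update w c f = f + Poly_Mapping.single w c"
    using update(1) by (intro poly_mapping_eqI) (auto simp: lookup_update lookup_add lookup_single in_keys_iff when_def)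
  ultimately show ?case using assms(2)[OF update(3)] by simp
qed

locale Uq_representation = complex_space scale Basis
  for scale :: "complex \<Rightarrow> 'v::ab_group_add \<Rightarrow> 'v" (infixr \<open>*s\<close> 75) and Basis +
  fixes q :: complex and \<rho> :: "free_alg set \<Rightarrow> 'v \<Rightarrow> 'v"
  assumes rep: "is_representation q scale \<rho>"
begin

text \<open>Composing with the quotient map lifts the representation to the free algebra, where
  relators and generators can be evaluated without cosets.\<close>

definition act :: "free_alg \<Rightarrow> 'v \<Rightarrow> 'v" where
  "act a = \<rho> (rel_ideal q +>\<^bsub>free_ring\<^esub> a)"

lemma ideal: "ideal (rel_ideal q) free_ring"
  unfolding rel_ideal_def by (rule ring.genideal_ideal[OF free_ring_ring]) (simp add: free_ring_def)

lemma act_hom: "act \<in> ring_hom free_ring (End_ring scale)"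
proof -
  have "\<rho> \<in> ring_hom (free_ring Quot rel_ideal q) (End_ring scale)"
    using rep by (simp add: is_representation_def Uq_so4_def)
  from ring_hom_trans[OF ideal.rcos_ring_hom[OF ideal] this]
  moreover have "act = \<rho> \<circ> a_r_coset free_ring (rel_ideal q)" by (simp add: fun_eq_iff act_def)
  ultimately show ?thesis by simp
qed

lemma carrier_free: "a \<in> carrier free_ring"
  by (simp add: free_ring_def)

lemma act_linear: "Vector_Spaces.linear scale scale (act a)"
  using ring_hom_closed[OF act_hom carrier_free] by (simp add: End_ring_def)

lemma act_add: "act (a + b) v = act a v + act b v"
  using ring_hom_add[OF act_hom carrier_free carrier_free, of a b] by (simp add: End_ring_def free_ring_def)

lemma act_mult: "act (a * b) v = act a (act b v)"
  using ring_hom_mult[OF act_hom carrier_free carrier_free, of a b] by (simp add: End_ring_def free_ring_def)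

lemma act_one: "act 1 v = v"
  using ring_hom_one[OF act_hom] by (simp add: End_ring_def free_ring_def)

lemma act_0: "act 0 v = 0"
  using act_add[of 0 0 v] by simp

lemma act_minus: "act (- a) v = - act a v"
  using act_add[of a "- a" v] by (simp add: act_0 eq_neg_iff_add_eq_0 add.commute)

lemma act_diff: "act (a - b) v = act a v - act b v"
  using act_add[of a "- b" v] by (simp add: act_minus)

lemma coset_carrier: "rel_ideal q +>\<^bsub>free_ring\<^esub> a \<in> carrier (Uq_so4 q)"
  by (auto simp: Uq_so4_def FactRing_def A_RCOSETS_def' carrier_free)

lemma carrier_coset: "x \<in> carrier (Uq_so4 q) \<Longrightarrow> \<exists>a. x = rel_ideal q +>\<^bsub>free_ring\<^esub> a"
  by (auto simp: Uq_so4_def FactRing_def A_RCOSETS_def')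

lemma act_const: "act (const_elem c * a) v = c *s act a v"
proof -
  have "Uq_smult q c (rel_ideal q +>\<^bsub>free_ring\<^esub> a) = rel_ideal q +>\<^bsub>free_ring\<^esub> (const_elem c * a)"
    using ring_hom_mult[OF ideal.rcos_ring_hom[OF ideal] carrier_free carrier_free, of "const_elem c" a]
    by (simp add: Uq_smult_def Uq_so4_def free_ring_def)
  then show ?thesis using rep coset_carrier by (simp add: is_representation_def act_def) metis
qed

lemma act_const_elem: "act (const_elem c) v = c *s v"
  using act_const[of c 1 v] by (simp add: act_one)

lemma act_relator: "r \<in> relators q \<Longrightarrow> act r v = 0"
proof -
  interpret I: ideal "rel_ideal q" free_ring by (rule ideal)
  assume "r \<in> relators q"
  then have "r \<in> rel_ideal q"
    using ring.genideal_self[OF free_ring_ring, of "relators q"] carrier_free unfolding rel_ideal_def by blast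
  moreover have "0 \<in> rel_ideal q" using I.zero_closed I.additive_subgroup_axioms additive_subgroup.zero_closed[OF I.additive_subgroup_axioms] by (simp add: free_ring_def)
  ultimately have "rel_ideal q +>\<^bsub>free_ring\<^esub> r = rel_ideal q +>\<^bsub>free_ring\<^esub> 0"
    using I.a_rcos_const by simp
  then have "act r v = act 0 v" by (simp add: act_def)
  then show ?thesis by (simp add: act_0)
qed

lemma act_cubic:
  assumes "cubic_relator q g h \<in> relators q"
  shows "act (gen_elem g) (act (gen_elem h) (act (gen_elem h) v))
    = (q + inverse q) *s act (gen_elem h) (act (gen_elem g) (act (gen_elem h) v))
      - act (gen_elem h) (act (gen_elem h) (act (gen_elem g) v)) - act (gen_elem g) v"
  using act_relator[OF assms, of v]
  by (simp add: cubic_relator_def Let_def act_add act_diff act_minus act_mult act_const_elem power2_eq_square)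
    (simp add: algebra_simps)

lemma subrepresentation_iff:
  "subrepresentation q scale \<rho> W \<longleftrightarrow> subspace W \<and> (\<forall>g. \<forall>w\<in>W. act (gen_elem g) w \<in> W)"
proof
  assume "subrepresentation q scale \<rho> W"
  then show "subspace W \<and> (\<forall>g. \<forall>w\<in>W. act (gen_elem g) w \<in> W)"
    using coset_carrier unfolding subrepresentation_def act_def by blast
next
  assume W: "subspace W \<and> (\<forall>g. \<forall>w\<in>W. act (gen_elem g) w \<in> W)"
  have "\<forall>w\<in>W. act a w \<in> W" for a
  proof (induction a rule: free_alg_induct)
    case zero
    then show ?case using W by (simp add: act_0 subspace_0)
  next
    case (add a b)
    then show ?case using W by (simp add: act_add subspace_add)
  next
    case (const c a)
    then show ?case using W by (simp add: act_const subspace_scale)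
  next
    case (gen g a)
    then show ?case using W by (simp add: act_mult)
  next
    case one
    then show ?case by (simp add: act_one)
  qed
  then have "\<rho> x ` W \<subseteq> W" if "x \<in> carrier (Uq_so4 q)" for x
    using carrier_coset[OF that] by (auto simp: act_def)
  then show "subrepresentation q scale \<rho> W" using W by (simp add: subrepresentation_def)
qed

end

theorem theorem5:
  fixes q :: complex
    and scale :: "complex \<Rightarrow> 'v::ab_group_add \<Rightarrow> 'v"
    and B :: "'v set"
    and \<rho> :: "free_alg set \<Rightarrow> 'v \<Rightarrow> 'v"
  assumes "q \<noteq> 0"
    and "\<not> root_of_unity q"
    and "finite_dimensional_vector_space scale B"
    and "is_representation q scale \<rho>"
  shows "completely_reducible q scale \<rho>"
proof -
  interpret V: complex_space scale B
    unfolding complex_space_def by (rule assms)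
  interpret R: Uq_representation scale B q \<rho>
    using assms by unfold_locales
  interpret N: non_root q
    using assms unfolding root_of_unity_def by unfold_locales auto
  \<comment> \<open>Chosen with k^2 = -(q - 1/q)^2: multiplying every generator by k turns the term
    -x of the relations into (q - 1/q)^2 x.\<close>
  define k where "k = \<i> * (q - inverse q)"
  have k0: "k \<noteq> 0" using N.q_diff by (simp add: k_def)
  have kk: "k * k = - ((q - inverse q)\<^sup>2)" proof -
    have "k * k = (\<i> * \<i>) * ((q - inverse q) * (q - inverse q))" by (simp only: k_def ac_simps)
    then show ?thesis by (simp add: power2_eq_square)
  qed
  define T where "T g v = scale k (R.act (gen_elem g) v)" for g v
  have lin: "module_hom scale scale (R.act (gen_elem g))" for g
    using R.act_linear by (simp add: linear_iff_module_hom)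
  note L = module_hom.add[OF lin] module_hom.scale[OF lin] module_hom.diff[OF lin]
  have hom: "module_hom scale scale (T g)" for g
    unfolding T_def by unfold_locales (simp_all add: L V.scale_right_distrib mult.commute)
  have cubic: "T g (T h (T h v)) = scale (q + inverse q) (T h (T g (T h v))) - T h (T h (T g v))
      + scale ((q - inverse q)\<^sup>2) (T g v)" if "cubic_relator q g h \<in> relators q" for g h v
  proof -
    have "T g (T h (T h v)) = scale (k * (k * k)) (R.act (gen_elem g) (R.act (gen_elem h) (R.act (gen_elem h) v)))"
      by (simp add: T_def L)
    also have "\<dots> = scale (q + inverse q) (T h (T g (T h v))) - T h (T h (T g v)) - scale (k * k) (T g v)"
      unfolding R.act_cubic[OF that] by (simp add: T_def L V.scale_right_diff_distrib ac_simps)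
    finally show ?thesis unfolding kk by simp
  qed
  have comm: "T I21 (T I43 v) = T I43 (T I21 v)" for v
  proof -
    have "R.act (gen_elem I21 * gen_elem I43 - gen_elem I43 * gen_elem I21) v = 0"
      by (rule R.act_relator) (simp add: relators_def)
    then show ?thesis by (simp add: T_def L R.act_diff R.act_mult)
  qed
  interpret S: so4_rep scale B q "T I21" "T I32" "T I43"
  proof (intro so4_rep.intro so4_rep_axioms.intro V.complex_space_axioms N.non_root_axioms hom comm)
    fix v
    let ?A = "T I21" and ?B = "T I32" and ?C = "T I43"
    show "?A (?B (?B v)) = scale (q + inverse q) (?B (?A (?B v))) - ?B (?B (?A v)) + scale ((q - inverse q)\<^sup>2) (?A v)"
      and "?C (?B (?B v)) = scale (q + inverse q) (?B (?C (?B v))) - ?B (?B (?C v)) + scale ((q - inverse q)\<^sup>2) (?C v)"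
      by (rule cubic, simp add: relators_def)+
    \<comment> \<open>The relations linear in B come with the word that has B in front; they are
      solved for the word that has B applied first.\<close>
    have "?B (?A (?A v)) = scale (q + inverse q) (?A (?B (?A v))) - ?A (?A (?B v)) + scale ((q - inverse q)\<^sup>2) (?B v)"
      "?B (?C (?C v)) = scale (q + inverse q) (?C (?B (?C v))) - ?C (?C (?B v)) + scale ((q - inverse q)\<^sup>2) (?B v)"
      by (rule cubic, simp add: relators_def)+
    then show "?A (?A (?B v)) = scale (q + inverse q) (?A (?B (?A v))) - ?B (?A (?A v)) + scale ((q - inverse q)\<^sup>2) (?B v)"
      and "?C (?C (?B v)) = scale (q + inverse q) (?C (?B (?C v))) - ?B (?C (?C v)) + scale ((q - inverse q)\<^sup>2) (?B v)"
      by simp_all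
  qed
  have inv: "S.invariant W \<longleftrightarrow> subrepresentation q scale \<rho> W" for W
  proof
    assume W: "S.invariant W"
    have "R.act (gen_elem g) w \<in> W" if "w \<in> W" for g w
    proof -
      have "T g w \<in> W" using W that by (cases g) (simp_all add: S.invariant_def)
      then have "scale (1 / k) (T g w) \<in> W" using W V.subspace_scale by (simp add: S.invariant_def)
      then show ?thesis using k0 by (simp add: T_def)
    qed
    then show "subrepresentation q scale \<rho> W" using W by (simp add: R.subrepresentation_iff S.invariant_def)
  next
    assume "subrepresentation q scale \<rho> W"
    then show "S.invariant W" by (simp add: R.subrepresentation_iff S.invariant_def T_def V.subspace_scale)
  qed
  have "S.invariant UNIV" by (simp add: S.invariant_def)
  from S.irreducible_decomposition[OF this] obtain \<W> where W: "finite \<W>"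
    "\<forall>W\<in>\<W>. S.irreducible_invariant W \<and> W \<subseteq> UNIV"
    "\<forall>v\<in>UNIV. \<exists>!f. f \<in> (\<Pi>\<^sub>E W\<in>\<W>. W) \<and> v = (\<Sum>W\<in>\<W>. f W)"
    by (elim exE conjE)
  have "\<forall>W\<in>\<W>. irreducible_subrepresentation q scale \<rho> W"
    using W(2) unfolding irreducible_subrepresentation_def S.irreducible_invariant_def inv by simp
  moreover have "internal_direct_sum \<W>"
    using W(3) unfolding internal_direct_sum_def by simp
  ultimately show ?thesis
    unfolding completely_reducible_def using W(1) by (intro exI[of _ \<W>] conjI)
qed

end
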